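(* Let $K$ be an algebraically closed field of characteristic zero, let $Q$ be a connected affine algebraic group over $K$, let $\mathfrak q=\mathrm{Lie}\,Q$, and set $\widetilde Q=Q\times K^{\times}$, acting on $\mathfrak q^*$ via the coadjoint action of $Q$ and scalar multiplication by $K^\times$. If $\alpha\in\mathfrak q^*$ is a contact linear form, then $\widetilde Q\alpha$ is a dense open subset of $\mathfrak q^*$. Consequently, a contact form is unique up to conjugation by elements of $Q$ and scalar multiplication: if $\alpha,\beta\in\mathfrak q^*$ are contact linear forms, then $\beta\in\widetilde Q\alpha$.
   Context: Let $\dim\mathfrak q=2n+1$. A linear form $\alpha\in\mathfrak q^*$ is a contact linear form if $(d_{\mathfrak q}\alpha)^{\wedge n}\wedge\alpha\neq 0$, where $d_{\mathfrak q}\alpha\in\wedge^2\mathfrak q^*$ is the Chevalley--Eilenberg differential, $d_{\mathfrak q}\alpha(\xi,\eta)=-\alpha([\xi,\eta])$ (up to an irrelevant sign convention). The topology on $\mathfrak q^*$ is the Zariski topology. *)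

theory Defs
  imports
    "HOL-Analysis.Finite_Cartesian_Product"
    "HOL-Analysis.Abstract_Topology"
    "HOL-Algebra.Group_Action"
    "HOL-Combinatorics.Permutations"
    "HOL-Computational_Algebra.Polynomial"
    "HOL-Library.Function_Algebras"
begin

section \<open>Polynomial functions and Zariski topologies\<close>

text \<open>The algebra of functions generated by a set \<open>F\<close> of coordinate functions. With the
  coordinates of \<open>K\<^sup>n\<close> these are the polynomial functions on \<open>K\<^sup>n\<close>; with the evaluations at the
  elements of a vector space they are the polynomial functions on its dual.\<close>

inductive_set poly_functions :: "('a \<Rightarrow> 'k::field) set \<Rightarrow> ('a \<Rightarrow> 'k) set"
  for F :: "('a \<Rightarrow> 'k) set" where
  const: "(\<lambda>_. c) \<in> poly_functions F"
| coord: "f \<in> F \<Longrightarrow> f \<in> poly_functions F"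
| add: "f \<in> poly_functions F \<Longrightarrow> g \<in> poly_functions F \<Longrightarrow> (\<lambda>x. f x + g x) \<in> poly_functions F"
| mult: "f \<in> poly_functions F \<Longrightarrow> g \<in> poly_functions F \<Longrightarrow> (\<lambda>x. f x * g x) \<in> poly_functions F"

text \<open>Open sets are the complements in \<open>X\<close> of common zero loci of polynomial functions.\<close>

definition zariski_topology :: "'a set \<Rightarrow> ('a \<Rightarrow> 'k::field) set \<Rightarrow> 'a topology" where
  "zariski_topology X F =
     topology (\<lambda>U. \<exists>S \<subseteq> poly_functions F. U = X - {x \<in> X. \<forall>f\<in>S. f x = 0})"

lemma openin_zariski_topology:
  "openin (zariski_topology X F) U \<longleftrightarrow>
     (\<exists>S \<subseteq> poly_functions F. U = X - {x \<in> X. \<forall>f\<in>S. f x = 0})"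
proof -
  let ?Op = "\<lambda>U. \<exists>S \<subseteq> poly_functions F. U = X - {x \<in> X. \<forall>f\<in>S. f x = 0}"
  have "?Op (U \<inter> V)" if "?Op U" "?Op V" for U V
  proof -
    from that obtain S T where S: "S \<subseteq> poly_functions F" "U = X - {x \<in> X. \<forall>f\<in>S. f x = 0}"
      and T: "T \<subseteq> poly_functions F" "V = X - {x \<in> X. \<forall>f\<in>T. f x = 0}"
      by blast
    let ?R = "{\<lambda>x. f x * g x |f g. f \<in> S \<and> g \<in> T}"
    have "?R \<subseteq> poly_functions F"
      using S(1) T(1) by (auto intro: poly_functions.mult)
    moreover have "(\<forall>f\<in>?R. f x = 0) \<longleftrightarrow> (\<forall>f\<in>S. f x = 0) \<or> (\<forall>f\<in>T. f x = 0)" for x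
    proof
      assume R: "\<forall>f\<in>?R. f x = 0"
      have "f x * g x = 0" if "f \<in> S" "g \<in> T" for f g
        using bspec[OF R, of "\<lambda>x. f x * g x"] that by blast
      then show "(\<forall>f\<in>S. f x = 0) \<or> (\<forall>f\<in>T. f x = 0)"
        by (metis mult_eq_0_iff)
    qed auto
    then have "U \<inter> V = X - {x \<in> X. \<forall>f\<in>?R. f x = 0}"
      unfolding S(2) T(2) by auto
    ultimately show ?thesis by (intro exI[of _ ?R]) simp
  qed
  moreover have "?Op (\<Union>\<K>)" if "\<forall>U\<in>\<K>. ?Op U" for \<K>
  proof -
    from bchoice[OF that] obtain S where
      S: "\<forall>U\<in>\<K>. S U \<subseteq> poly_functions F \<and> U = X - {x \<in> X. \<forall>f\<in>S U. f x = 0}" ..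
    have "\<Union>\<K> = X - {x \<in> X. \<forall>f\<in>(\<Union>U\<in>\<K>. S U). f x = 0}"
    proof (rule Set.set_eqI)
      fix x
      have "x \<in> U \<longleftrightarrow> x \<in> X \<and> (\<exists>f\<in>S U. f x \<noteq> 0)" if "U \<in> \<K>" for U
        using bspec[OF S that] by auto
      then show "x \<in> \<Union>\<K> \<longleftrightarrow> x \<in> X - {x \<in> X. \<forall>f\<in>(\<Union>U\<in>\<K>. S U). f x = 0}"
        by auto
    qed
    moreover have "(\<Union>U\<in>\<K>. S U) \<subseteq> poly_functions F"
      using S by blast
    ultimately show ?thesis by (intro exI[of _ "\<Union>U\<in>\<K>. S U"] conjI)
  qed
  ultimately have "istopology ?Op"
    unfolding istopology_def by simp
  then show ?thesis
    unfolding zariski_topology_def by (simp add: topology_inverse')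
qed

lemma topspace_zariski_topology [simp]: "topspace (zariski_topology X F) = X"
proof -
  have "openin (zariski_topology X F) X"
    unfolding openin_zariski_topology
    by (rule exI[of _ "{\<lambda>_. 1}"]) (auto intro: poly_functions.const)
  moreover have "U \<subseteq> X" if "openin (zariski_topology X F) U" for U
    using that unfolding openin_zariski_topology by blast
  ultimately show ?thesis
    unfolding topspace_def by blast
qed

abbreviation affine_space :: "('k::field ^ 'n) topology" where
  "affine_space \<equiv> zariski_topology UNIV (range (\<lambda>i x. x $ i))"


section \<open>Affine algebraic groups\<close>

text \<open>A Zariski closed subset of \<open>K\<^sup>n\<close> with a group structure whose multiplication and inversion
  are morphisms of varieties, i.e. are given by polynomials in the coordinates.\<close>

definition affine_algebraic_group :: "('k::field ^ 'n) monoid \<Rightarrow> bool" where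
  "affine_algebraic_group Q \<longleftrightarrow>
     group Q \<and>
     closedin affine_space (carrier Q) \<and>
     (\<forall>i. \<exists>p \<in> poly_functions (range (\<lambda>j (x, y). x $ j) \<union> range (\<lambda>j (x, y). y $ j)).
        \<forall>x\<in>carrier Q. \<forall>y\<in>carrier Q. (x \<otimes>\<^bsub>Q\<^esub> y) $ i = p (x, y)) \<and>
     (\<forall>i. \<exists>p \<in> poly_functions (range (\<lambda>j x. x $ j)).
        \<forall>x\<in>carrier Q. (inv\<^bsub>Q\<^esub> x) $ i = p x)"

definition connected_algebraic_group :: "('k::field ^ 'n) monoid \<Rightarrow> bool" where
  "connected_algebraic_group Q \<longleftrightarrow>
     affine_algebraic_group Q \<and> connectedin affine_space (carrier Q)"

text \<open>Regular functions on \<open>X\<close> are represented by their extension by zero outside \<open>X\<close>, so that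
  equality of regular functions is equality in HOL.\<close>

definition coordinate_ring :: "('k::field ^ 'n) set \<Rightarrow> ('k ^ 'n \<Rightarrow> 'k) set" where
  "coordinate_ring X =
     {\<lambda>x. if x \<in> X then p x else 0 |p. p \<in> poly_functions (range (\<lambda>i x. x $ i))}"

definition left_translate ::
    "('k::field ^ 'n) monoid \<Rightarrow> 'k ^ 'n \<Rightarrow> ('k ^ 'n \<Rightarrow> 'k) \<Rightarrow> 'k ^ 'n \<Rightarrow> 'k" where
  "left_translate Q g f = (\<lambda>x. if x \<in> carrier Q then f (inv\<^bsub>Q\<^esub> g \<otimes>\<^bsub>Q\<^esub> x) else 0)"

definition right_translate ::
    "('k::field ^ 'n) monoid \<Rightarrow> 'k ^ 'n \<Rightarrow> ('k ^ 'n \<Rightarrow> 'k) \<Rightarrow> 'k ^ 'n \<Rightarrow> 'k" where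
  "right_translate Q g f = (\<lambda>x. if x \<in> carrier Q then f (x \<otimes>\<^bsub>Q\<^esub> g) else 0)"


section \<open>The Lie algebra and the adjoint action\<close>

text \<open>Endomorphisms of the coordinate ring are likewise extended by zero; they are added
  pointwise.\<close>

type_synonym ('k, 'n) operator = "('k ^ 'n \<Rightarrow> 'k) \<Rightarrow> 'k ^ 'n \<Rightarrow> 'k"

definition op_scale :: "'k::field \<Rightarrow> ('k, 'n) operator \<Rightarrow> ('k, 'n) operator" where
  "op_scale c D = (\<lambda>f x. c * D f x)"

lemma vector_space_op_scale: "vector_space op_scale"
  by unfold_locales (simp_all add: op_scale_def fun_eq_iff algebra_simps)

text \<open>\<open>Lie Q\<close> is the space of left-invariant \<open>K\<close>-derivations of \<open>K[Q]\<close>.\<close>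

definition lie_algebra :: "('k::field ^ 'n) monoid \<Rightarrow> ('k, 'n) operator set" where
  "lie_algebra Q = (let A = coordinate_ring (carrier Q) in
     {D. (\<forall>f\<in>A. D f \<in> A) \<and>
         (\<forall>f. f \<notin> A \<longrightarrow> D f = 0) \<and>
         (\<forall>f\<in>A. \<forall>g\<in>A. D (f + g) = D f + D g) \<and>
         (\<forall>c. \<forall>f\<in>A. D (\<lambda>x. c * f x) = (\<lambda>x. c * D f x)) \<and>
         (\<forall>f\<in>A. \<forall>g\<in>A. D (f * g) = D f * g + f * D g) \<and>
         (\<forall>g\<in>carrier Q. \<forall>f\<in>A. D (left_translate Q g f) = left_translate Q g (D f))})"

definition lie_bracket ::
    "('k::field, 'n) operator \<Rightarrow> ('k, 'n) operator \<Rightarrow> ('k, 'n) operator" where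
  "lie_bracket D E = (\<lambda>f. D (E f) - E (D f))"

text \<open>\<open>Ad g\<close> is the differential of \<open>x \<mapsto> g x g\<^sup>-\<^sup>1\<close>. On left-invariant derivations it is
  conjugation by right translation.\<close>

definition Ad :: "('k::field ^ 'n) monoid \<Rightarrow> 'k ^ 'n \<Rightarrow> ('k, 'n) operator \<Rightarrow> ('k, 'n) operator" where
  "Ad Q g D = (\<lambda>f. if f \<in> coordinate_ring (carrier Q)
     then right_translate Q g (D (right_translate Q (inv\<^bsub>Q\<^esub> g) f)) else 0)"


section \<open>The dual space and the coadjoint action\<close>

text \<open>Linear forms on the subspace \<open>V\<close>, extended by zero outside \<open>V\<close>.\<close>

definition dual_space :: "('k::field \<Rightarrow> 'v::ab_group_add \<Rightarrow> 'v) \<Rightarrow> 'v set \<Rightarrow> ('v \<Rightarrow> 'k) set" where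
  "dual_space smul V =
     {\<alpha>. (\<forall>x\<in>V. \<forall>y\<in>V. \<alpha> (x + y) = \<alpha> x + \<alpha> y) \<and>
         (\<forall>c. \<forall>x\<in>V. \<alpha> (smul c x) = c * \<alpha> x) \<and>
         (\<forall>x. x \<notin> V \<longrightarrow> \<alpha> x = 0)}"

abbreviation lie_dual :: "('k::field ^ 'n) monoid \<Rightarrow> (('k, 'n) operator \<Rightarrow> 'k) set" where
  "lie_dual Q \<equiv> dual_space op_scale (lie_algebra Q)"

abbreviation lie_dual_topology ::
    "('k::field ^ 'n) monoid \<Rightarrow> (('k, 'n) operator \<Rightarrow> 'k) topology" where
  "lie_dual_topology Q \<equiv> zariski_topology (lie_dual Q) {\<lambda>\<alpha>. \<alpha> \<xi> |\<xi>. \<xi> \<in> lie_algebra Q}"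

definition coadjoint ::
    "('k::field ^ 'n) monoid \<Rightarrow> 'k ^ 'n \<Rightarrow> (('k, 'n) operator \<Rightarrow> 'k) \<Rightarrow> ('k, 'n) operator \<Rightarrow> 'k" where
  "coadjoint Q g \<alpha> = (\<lambda>\<xi>. if \<xi> \<in> lie_algebra Q then \<alpha> (Ad Q (inv\<^bsub>Q\<^esub> g) \<xi>) else 0)"

definition mult_group :: "'k::field monoid" where
  "mult_group = \<lparr>carrier = {t. t \<noteq> 0}, monoid.mult = (*), one = 1\<rparr>"

definition extended_group :: "('k::field ^ 'n) monoid \<Rightarrow> (('k ^ 'n) \<times> 'k) monoid" where
  "extended_group Q = Q \<times>\<times> mult_group"

definition extended_action ::
    "('k::field ^ 'n) monoid \<Rightarrow> ('k ^ 'n) \<times> 'k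
      \<Rightarrow> (('k, 'n) operator \<Rightarrow> 'k) \<Rightarrow> ('k, 'n) operator \<Rightarrow> 'k" where
  "extended_action Q = (\<lambda>(g, t) \<alpha> \<xi>. t * coadjoint Q g \<alpha> \<xi>)"


section \<open>Contact linear forms\<close>

text \<open>A \<open>p\<close>-form is an alternating multilinear function of \<open>v 0, \<dots>, v (p - 1)\<close>. The wedge
  product of a \<open>p\<close>-form and a \<open>q\<close>-form is the usual antisymmetrised product, which is meaningful in
  characteristic zero.\<close>

definition wedge ::
    "nat \<Rightarrow> nat \<Rightarrow> ((nat \<Rightarrow> 'v) \<Rightarrow> 'k::field_char_0) \<Rightarrow> ((nat \<Rightarrow> 'v) \<Rightarrow> 'k) \<Rightarrow> (nat \<Rightarrow> 'v) \<Rightarrow> 'k" where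
  "wedge p q \<omega> \<eta> = (\<lambda>v.
     (\<Sum>\<sigma> | \<sigma> permutes {..<p + q}.
        of_int (sign \<sigma>) * \<omega> (\<lambda>i. v (\<sigma> i)) * \<eta> (\<lambda>i. v (\<sigma> (p + i)))) / (fact p * fact q))"

primrec wedge_power ::
    "nat \<Rightarrow> ((nat \<Rightarrow> 'v) \<Rightarrow> 'k::field_char_0) \<Rightarrow> nat \<Rightarrow> (nat \<Rightarrow> 'v) \<Rightarrow> 'k" where
  "wedge_power p \<omega> 0 = (\<lambda>_. 1)"
| "wedge_power p \<omega> (Suc m) = wedge p (p * m) \<omega> (wedge_power p \<omega> m)"

definition chevalley_eilenberg ::
    "('v \<Rightarrow> 'v \<Rightarrow> 'v) \<Rightarrow> ('v \<Rightarrow> 'k::field_char_0) \<Rightarrow> (nat \<Rightarrow> 'v) \<Rightarrow> 'k" where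
  "chevalley_eilenberg br \<alpha> = (\<lambda>v. - \<alpha> (br (v 0) (v 1)))"

definition contact_linear_form ::
    "('k::field_char_0 ^ 'n) monoid \<Rightarrow> nat \<Rightarrow> (('k, 'n) operator \<Rightarrow> 'k) \<Rightarrow> bool" where
  "contact_linear_form Q m \<alpha> \<longleftrightarrow>
     \<alpha> \<in> lie_dual Q \<and>
     (\<exists>v. (\<forall>i < 2 * m + 1. v i \<in> lie_algebra Q) \<and>
        wedge (2 * m) 1 (wedge_power 2 (chevalley_eilenberg lie_bracket \<alpha>) m)
          (\<lambda>v. \<alpha> (v 0)) v \<noteq> 0)"

end

(*
  The tangent space at alpha of the orbit of Q x K^* is {alpha o ad D + c alpha}, and the contact
  condition says exactly that its common kernel in q is zero, i.e. that it is all of q^*. Hence the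
  ideal of polynomial functions vanishing on the orbit is stable under all partial derivatives, and
  by Taylor expansion in characteristic zero it is zero: the orbit is dense.

  So the polynomial functions on q^* embed, by pullback along the orbit map, into the regular
  functions on Q x K^*. Extending homomorphisms to K generator by generator modulo a prime ideal
  (Chevalley's extension theorem) shows that the orbit contains a nonempty basic open set; by
  homogeneity it is open. Two nonempty open subsets of q^* meet, so the orbits of two contact forms
  coincide.
*)
theory Submission
  imports Defs
begin

section \<open>Extension of homomorphisms into an algebraically closed field\<close>

text \<open>The prime ideal is where density is used. Zorn's lemma gives a prime ideal
  \<open>I\<close> of the polynomial functions on K^n x K that contains all functions vanishing on Q
  x K^* and avoids every t^k F(orbit map) with F nonzero somewhere on the dual; density makes the
  two demands compatible. Modulo \<open>I\<close>, polynomial functions on the dual remain distinct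
  and t remains nonzero. Quotients and fraction fields are avoided: all rings are subsets of one
  ring of functions, "zero" is read as "in \<open>I\<close>", and division becomes pseudo-division.

  Since q consists of derivations of regular functions, tangent vectors are reached through
  functions: every linear form on q is \<xi> \<mapsto> (\<xi> f)(1) for some regular f. Hence g
  \<mapsto> \<beta>(Ad g \<xi>) is regular, and its derivative at 1 along D is \<beta>([D, \<xi>]).
  The coadjoint action involves Ad of the inverse of g; parametrising the orbit by inverses removes
  it.\<close>

definition subring_on :: "'a::comm_ring_1 set \<Rightarrow> bool" where
  "subring_on R \<longleftrightarrow> 1 \<in> R \<and> (\<forall>x\<in>R. \<forall>y\<in>R. x - y \<in> R \<and> x * y \<in> R)"

lemma subring_on_closed:
  assumes "subring_on R"
  shows "1 \<in> R" "0 \<in> R" "x \<in> R \<Longrightarrow> - x \<in> R"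
    "x \<in> R \<Longrightarrow> y \<in> R \<Longrightarrow> x + y \<in> R" "x \<in> R \<Longrightarrow> y \<in> R \<Longrightarrow> x - y \<in> R"
    "x \<in> R \<Longrightarrow> y \<in> R \<Longrightarrow> x * y \<in> R" "x \<in> R \<Longrightarrow> x ^ k \<in> R"
proof -
  note R = assms[unfolded subring_on_def]
  show one: "1 \<in> R" using R by blast
  show zero: "0 \<in> R" using R by (metis diff_self)
  show neg: "- x \<in> R" if "x \<in> R" for x
    using R zero that by (metis diff_0)
  show "x + y \<in> R" if "x \<in> R" "y \<in> R"
    using R neg[OF that(2)] that by (metis diff_minus_eq_add)
  show "x - y \<in> R" "x * y \<in> R" if "x \<in> R" "y \<in> R"
    using R that by blast+
  show "x ^ k \<in> R" if "x \<in> R"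
    using R one that by (induction k) auto
qed

lemma sum_closed:
  fixes f :: "'i \<Rightarrow> 'a::comm_monoid_add"
  assumes "0 \<in> R" "\<And>x y. x \<in> R \<Longrightarrow> y \<in> R \<Longrightarrow> x + y \<in> R" "\<And>i. i \<in> A \<Longrightarrow> f i \<in> R"
  shows "sum f A \<in> R"
  using assms(3) by (induction A rule: infinite_finite_induct) (auto intro: assms(1,2))

section \<open>Polynomials over a subring and pseudo-division\<close>

text \<open>Applied to ideals as well as to subrings: \<open>polys_over I\<close> collects the
  polynomials that become zero modulo \<open>I\<close>.\<close>

definition polys_over :: "'a::comm_ring_1 set \<Rightarrow> 'a poly set" where
  "polys_over R = {p. \<forall>i. coeff p i \<in> R}"

lemma polys_over_closed:
  assumes "subring_on R"
  shows "0 \<in> polys_over R" "1 \<in> polys_over R"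
    "p \<in> polys_over R \<Longrightarrow> q \<in> polys_over R \<Longrightarrow> p + q \<in> polys_over R"
    "p \<in> polys_over R \<Longrightarrow> q \<in> polys_over R \<Longrightarrow> p - q \<in> polys_over R"
    "p \<in> polys_over R \<Longrightarrow> q \<in> polys_over R \<Longrightarrow> p * q \<in> polys_over R"
    "c \<in> R \<Longrightarrow> p \<in> polys_over R \<Longrightarrow> smult c p \<in> polys_over R"
    "c \<in> R \<Longrightarrow> monom c k \<in> polys_over R"
    "c \<in> R \<Longrightarrow> [:c:] \<in> polys_over R"
    "[:0, 1:] \<in> polys_over R"
  using assms
  by (auto simp: polys_over_def coeff_1 coeff_mult coeff_monom coeff_pCons
      intro!: subring_on_closed sum_closed split: nat.splits)

text \<open>The leading coefficient of \<open>p\<close> may fail to be a unit, so each cancellation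
  of the top term of \<open>q\<close> first multiplies \<open>q\<close> by it; \<open>k\<close>
  counts the cancellations.\<close>

lemma pseudo_division:
  assumes R: "subring_on R" and p: "p \<in> polys_over R" "degree p > 0" and q: "q \<in> polys_over R"
  shows "\<exists>k h r. h \<in> polys_over R \<and> r \<in> polys_over R \<and>
    smult (lead_coeff p ^ k) q = p * h + r \<and> degree r < degree p"
  using q
proof (induction "degree q" arbitrary: q rule: less_induct)
  case less
  define a where "a = lead_coeff p"
  have aR: "a \<in> R" using p by (simp add: a_def polys_over_def)
  show ?case
  proof (cases "degree q < degree p")
    case True
    then show ?thesis
      using less.prems R by (intro exI[of _ 0] exI[of _ q]) (simp add: polys_over_closed)
  next
    case False
    define m where "m = monom (lead_coeff q) (degree q - degree p)"
    have mR: "m \<in> polys_over R"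
      using less.prems R by (auto simp: m_def polys_over_def intro: subring_on_closed)
    define q' where "q' = smult a q - p * m"
    have q'R: "q' \<in> polys_over R"
      unfolding q'_def using R p less.prems mR aR by (intro polys_over_closed)
    have "degree (p * m) \<le> degree p + (degree q - degree p)"
      unfolding m_def by (rule order.trans[OF degree_mult_le add_left_mono[OF degree_monom_le]])
    then have "degree (p * m) \<le> degree q" using False by simp
    then have "degree q' \<le> degree q"
      unfolding q'_def by (intro degree_diff_le degree_smult_le)
    moreover have "coeff q' (degree q) = 0"
      using False by (simp add: q'_def a_def m_def mult.commute[of p] coeff_monom_mult)
    \<comment> \<open>The strict drop uses \<open>degree p > 0\<close>: a zero \<open>q'\<close> has
      degree 0, which lies below \<open>degree p\<close> and so below
      \<open>degree q\<close>.\<close>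
    ultimately have "degree q' < degree q"
      using False p(2) by (metis degree_0 eq_zero_or_degree_less linorder_not_less order_less_le_trans)
    from less.hyps[OF this q'R] obtain k h r where *: "h \<in> polys_over R" "r \<in> polys_over R"
      "smult (a ^ k) q' = p * h + r" "degree r < degree p"
      unfolding a_def by blast
    have "smult (a ^ Suc k) q = smult (a ^ k) q' + smult (a ^ k) (p * m)"
      by (simp add: q'_def smult_diff_right mult.commute)
    also have "\<dots> = p * (h + smult (a ^ k) m) + r"
      using *(3) by (simp add: algebra_simps)
    finally have "smult (a ^ Suc k) q = p * (h + smult (a ^ k) m) + r" .
    moreover have "h + smult (a ^ k) m \<in> polys_over R"
      using R * mR aR by (intro polys_over_closed subring_on_closed)
    ultimately show ?thesis
      using * unfolding a_def by blast
  qed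
qed

section \<open>Polynomials modulo a prime ideal\<close>

text \<open>The quotient by \<open>I\<close> is not formed. Congruence means that a difference lies
  in \<open>I\<close>, and a homomorphism out of a quotient is one on a subring \<open>R\<close>
  that vanishes on \<open>I \<inter> R\<close>.\<close>

locale prime_ideal_on =
  fixes B I :: "'a::comm_ring_1 set"
  assumes subring: "subring_on B"
    and ideal_subset: "I \<subseteq> B"
    and ideal_zero: "0 \<in> I"
    and ideal_add: "x \<in> I \<Longrightarrow> y \<in> I \<Longrightarrow> x + y \<in> I"
    and ideal_mult: "b \<in> B \<Longrightarrow> x \<in> I \<Longrightarrow> b * x \<in> I"
    and prime: "a \<in> B \<Longrightarrow> b \<in> B \<Longrightarrow> a * b \<in> I \<Longrightarrow> a \<in> I \<or> b \<in> I"
    and one_notin: "1 \<notin> I"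
begin

lemma ideal_mult': "b \<in> B \<Longrightarrow> x \<in> I \<Longrightarrow> x * b \<in> I"
  using ideal_mult by (simp add: mult.commute)

lemma ideal_neg: "x \<in> I \<Longrightarrow> - x \<in> I"
  using ideal_mult[of "-1" x] subring by (simp add: subring_on_closed)

lemma ideal_diff: "x \<in> I \<Longrightarrow> y \<in> I \<Longrightarrow> x - y \<in> I"
  using ideal_add[of x "- y"] ideal_neg by simp

lemma ideal_sum: "(\<And>i. i \<in> A \<Longrightarrow> f i \<in> I) \<Longrightarrow> sum f A \<in> I"
  using ideal_zero ideal_add by (rule sum_closed)

lemma power_notin: "a \<in> B \<Longrightarrow> a \<notin> I \<Longrightarrow> a ^ k \<notin> I"
  using one_notin prime[of a] subring_on_closed(7)[OF subring] by (induction k) auto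

lemma polys_over_ideal_closed:
  "p \<in> polys_over I \<Longrightarrow> q \<in> polys_over I \<Longrightarrow> p + q \<in> polys_over I"
  "p \<in> polys_over I \<Longrightarrow> q \<in> polys_over I \<Longrightarrow> p - q \<in> polys_over I"
  "p \<in> polys_over B \<Longrightarrow> q \<in> polys_over I \<Longrightarrow> p * q \<in> polys_over I"
  "p \<in> polys_over I \<Longrightarrow> q \<in> polys_over B \<Longrightarrow> p * q \<in> polys_over I"
  "0 \<in> polys_over I"
  by (auto simp: polys_over_def coeff_mult ideal_zero
      intro: ideal_add ideal_diff intro!: ideal_sum intro: ideal_mult ideal_mult')

lemma poly_mem: "p \<in> polys_over B \<Longrightarrow> X \<in> B \<Longrightarrow> poly p X \<in> B"
  unfolding poly_altdef using subring
  by (intro sum_closed subring_on_closed) (auto simp: polys_over_def)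

lemma poly_ideal: "p \<in> polys_over I \<Longrightarrow> X \<in> B \<Longrightarrow> poly p X \<in> I"
  unfolding poly_altdef using subring
  by (intro ideal_sum ideal_mult' subring_on_closed) (auto simp: polys_over_def)

text \<open>Top terms with coefficient in \<open>I\<close> are discarded until nothing is left or
  the top coefficient survives, so \<open>degree q'\<close> is the degree of \<open>q\<close> modulo
  \<open>I\<close>. The discarded coefficients lie in \<open>I \<inter> R\<close>, which keeps the
  result over \<open>R\<close>.\<close>

lemma exists_reduced_poly:
  assumes R: "subring_on R" and q: "q \<in> polys_over R"
  shows "\<exists>q'. q' \<in> polys_over R \<and> q - q' \<in> polys_over (I \<inter> R) \<and> degree q' \<le> degree q
    \<and> (q' = 0 \<or> lead_coeff q' \<notin> I)"
  using q
proof (induction "degree q" arbitrary: q rule: less_induct)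
  case less
  have zeroI: "0 \<in> I \<inter> R" using ideal_zero R by (simp add: subring_on_closed)
  show ?case
  proof (cases "lead_coeff q \<in> I")
    case False
    then show ?thesis using less.prems zeroI by (intro exI[of _ q]) (auto simp: polys_over_def)
  next
    case True
    show ?thesis
    proof (cases "degree q = 0")
      case deg0: True
      have "q - 0 \<in> polys_over (I \<inter> R)"
        using True deg0 less.prems zeroI
        by (auto simp: polys_over_def) (metis coeff_eq_0 neq0_conv)
      then show ?thesis using R by (intro exI[of _ 0]) (simp add: polys_over_closed)
    next
      case deg: False
      define m where "m = monom (lead_coeff q) (degree q)"
      have mI: "m \<in> polys_over (I \<inter> R)"
        using True less.prems zeroI by (auto simp: m_def polys_over_def)
      have "q - m \<in> polys_over R"
        using R less.prems mI by (auto simp: polys_over_def intro: subring_on_closed)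
      moreover have "degree (q - m) < degree q"
      proof -
        have "degree (q - m) \<le> degree q"
          by (rule degree_diff_le) (auto simp: m_def degree_monom_le)
        moreover have "coeff (q - m) (degree q) = 0" by (simp add: m_def)
        ultimately show ?thesis using deg
          by (metis degree_0 eq_zero_or_degree_less le_neq_implies_less not_gr0)
      qed
      ultimately obtain q' where q': "q' \<in> polys_over R" "q - m - q' \<in> polys_over (I \<inter> R)"
        "degree q' \<le> degree (q - m)" "q' = 0 \<or> lead_coeff q' \<notin> I"
        using less.hyps by blast
      have "q - q' = (q - m - q') + m" by simp
      also have "\<dots> \<in> polys_over (I \<inter> R)"
        using q'(2) mI R unfolding polys_over_def mem_Collect_eq coeff_add
        by (blast intro: subring_on_closed ideal_add)
      finally show ?thesis
        using q' \<open>degree (q - m) < degree q\<close> by (intro exI[of _ q']) auto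
    qed
  qed
qed

end

section \<open>Homomorphisms on subrings and adjunction of an element\<close>

definition hom_on :: "'a::comm_ring_1 set \<Rightarrow> ('a \<Rightarrow> 'k::field) \<Rightarrow> bool" where
  "hom_on R \<phi> \<longleftrightarrow> \<phi> 1 = 1 \<and>
    (\<forall>x\<in>R. \<forall>y\<in>R. \<phi> (x + y) = \<phi> x + \<phi> y \<and> \<phi> (x * y) = \<phi> x * \<phi> y)"

lemma hom_on_simps:
  assumes "hom_on R \<phi>" "subring_on R"
  shows "\<phi> 1 = 1" "\<phi> 0 = 0"
    "x \<in> R \<Longrightarrow> y \<in> R \<Longrightarrow> \<phi> (x + y) = \<phi> x + \<phi> y"
    "x \<in> R \<Longrightarrow> y \<in> R \<Longrightarrow> \<phi> (x * y) = \<phi> x * \<phi> y"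
    "x \<in> R \<Longrightarrow> \<phi> (- x) = - \<phi> x"
    "x \<in> R \<Longrightarrow> y \<in> R \<Longrightarrow> \<phi> (x - y) = \<phi> x - \<phi> y"
    "x \<in> R \<Longrightarrow> \<phi> (x ^ k) = \<phi> x ^ k"
proof -
  note R = subring_on_closed[OF assms(2)]
  show one: "\<phi> 1 = 1" using assms(1) by (simp add: hom_on_def)
  have add: "\<phi> (x + y) = \<phi> x + \<phi> y" if "x \<in> R" "y \<in> R" for x y
    using assms(1) that by (simp add: hom_on_def)
  then show "x \<in> R \<Longrightarrow> y \<in> R \<Longrightarrow> \<phi> (x + y) = \<phi> x + \<phi> y" .
  have mult: "\<phi> (x * y) = \<phi> x * \<phi> y" if "x \<in> R" "y \<in> R" for x y
    using assms(1) that by (simp add: hom_on_def)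
  then show "x \<in> R \<Longrightarrow> y \<in> R \<Longrightarrow> \<phi> (x * y) = \<phi> x * \<phi> y" .
  show zero: "\<phi> 0 = 0" using add[of 0 0] R(2) by (metis add.right_neutral add_cancel_left_right)
  have neg: "\<phi> (- x) = - \<phi> x" if "x \<in> R" for x
    using add[of x "- x"] R that zero by (simp add: eq_neg_iff_add_eq_0 add.commute)
  then show "x \<in> R \<Longrightarrow> \<phi> (- x) = - \<phi> x" .
  show "x \<in> R \<Longrightarrow> y \<in> R \<Longrightarrow> \<phi> (x - y) = \<phi> x - \<phi> y"
    using add[of x "- y"] neg[of y] R by simp
  show "x \<in> R \<Longrightarrow> \<phi> (x ^ k) = \<phi> x ^ k"
    using mult R one by (induction k) auto
qed

lemma hom_on_sum:
  assumes "hom_on R \<phi>" "subring_on R" "\<And>i. i \<in> A \<Longrightarrow> f i \<in> R"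
  shows "\<phi> (sum f A) = (\<Sum>i\<in>A. \<phi> (f i))"
  using assms(3)
proof (induction A rule: infinite_finite_induct)
  case (insert x F)
  have "sum f F \<in> R"
    using assms(2) insert.prems by (intro sum_closed subring_on_closed) auto
  then show ?case
    using insert by (simp add: hom_on_simps[OF assms(1,2)])
qed (simp_all add: hom_on_simps[OF assms(1,2)])

lemma map_poly_hom_on:
  assumes "hom_on R \<phi>" "subring_on R" "p \<in> polys_over R" "q \<in> polys_over R"
  shows "map_poly \<phi> (p + q) = map_poly \<phi> p + map_poly \<phi> q"
    and "map_poly \<phi> (p - q) = map_poly \<phi> p - map_poly \<phi> q"
    and "map_poly \<phi> (p * q) = map_poly \<phi> p * map_poly \<phi> q"
    and "c \<in> R \<Longrightarrow> map_poly \<phi> (smult c p) = smult (\<phi> c) (map_poly \<phi> p)"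
  using assms
  by (auto simp: poly_eq_iff coeff_map_poly hom_on_simps polys_over_def coeff_mult
      hom_on_sum[of R] subring_on_closed)

definition adjoin :: "'a::comm_ring_1 set \<Rightarrow> 'a \<Rightarrow> 'a set" where
  "adjoin R X = {poly q X |q. q \<in> polys_over R}"

lemma subring_on_adjoin:
  assumes "subring_on R"
  shows "subring_on (adjoin R X)"
  unfolding subring_on_def adjoin_def
proof (safe, goal_cases)
  case 1
  show ?case by (intro exI[of _ 1]) (simp add: polys_over_closed[OF assms])
next
  case (2 _ _ p q)
  then show ?case by (intro exI[of _ "p - q"]) (simp add: polys_over_closed[OF assms])
next
  case (3 _ _ p q)
  then show ?case by (intro exI[of _ "p * q"]) (simp add: polys_over_closed[OF assms])
qed

lemma adjoin_superset: "subring_on R \<Longrightarrow> R \<subseteq> adjoin R X"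
  unfolding adjoin_def by (force intro: polys_over_closed)

lemma adjoin_generator: "subring_on R \<Longrightarrow> X \<in> adjoin R X"
  unfolding adjoin_def by (auto intro!: exI[of _ "[:0, 1:]"] polys_over_closed)

section \<open>Extension of a homomorphism to one more generator\<close>

context prime_ideal_on
begin

lemma adjoin_subset: "R \<subseteq> B \<Longrightarrow> X \<in> B \<Longrightarrow> adjoin R X \<subseteq> B"
  unfolding adjoin_def by (force simp: polys_over_def intro: poly_mem)

text \<open>Sending \<open>X\<close> to \<open>\<xi>\<close> is well defined: two polynomials
  representing the same element differ by one whose value at \<open>X\<close> is 0, an element of
  \<open>I\<close>, so \<open>ker\<close> applies to the difference. The same hypothesis makes the
  extension vanish on \<open>I\<close>.\<close>

lemma extend_hom_by_root:
  assumes R: "subring_on R" "R \<subseteq> B" and X: "X \<in> B" and \<phi>: "hom_on R \<phi>"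
    and ker: "\<And>q. q \<in> polys_over R \<Longrightarrow> poly q X \<in> I \<Longrightarrow> poly (map_poly \<phi> q) \<xi> = 0"
  shows "\<exists>\<psi>. hom_on (adjoin R X) \<psi> \<and> (\<forall>x\<in>R. \<psi> x = \<phi> x) \<and> (\<forall>x\<in>I \<inter> adjoin R X. \<psi> x = 0) \<and>
    (\<forall>q\<in>polys_over R. \<psi> (poly q X) = poly (map_poly \<phi> q) \<xi>)"
proof -
  define \<psi> where "\<psi> y = poly (map_poly \<phi> (SOME q. q \<in> polys_over R \<and> poly q X = y)) \<xi>" for y
  have \<psi>: "\<psi> (poly q X) = poly (map_poly \<phi> q) \<xi>" if q: "q \<in> polys_over R" for q
  proof -
    define q' where "q' = (SOME q'. q' \<in> polys_over R \<and> poly q' X = poly q X)"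
    have q': "q' \<in> polys_over R \<and> poly q' X = poly q X"
      unfolding q'_def by (rule someI[of _ q]) (use q in simp)
    then have "poly (map_poly \<phi> (q' - q)) \<xi> = 0"
      using q R by (intro ker polys_over_closed) (auto simp: ideal_zero)
    then show ?thesis
      using q q' by (simp add: \<psi>_def q'_def[symmetric] map_poly_hom_on[OF \<phi> R(1)])
  qed
  have const: "\<psi> x = \<phi> x" if "x \<in> R" for x
    using \<psi>[of "[:x:]"] that R hom_on_simps(2)[OF \<phi> R(1)]
    by (cases "x = 0") (simp_all add: polys_over_closed map_poly_pCons)
  have "hom_on (adjoin R X) \<psi>"
    unfolding hom_on_def adjoin_def
  proof (safe, goal_cases)
    case 1
    show ?case using const[of 1] R \<phi> by (simp add: subring_on_closed hom_on_simps)
  next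
    case (2 _ _ p q)
    then show ?case
      using \<psi>[of "p + q"] by (simp add: \<psi> map_poly_hom_on[OF \<phi> R(1)] polys_over_closed[OF R(1)])
  next
    case (3 _ _ p q)
    then show ?case
      using \<psi>[of "p * q"] by (simp add: \<psi> map_poly_hom_on[OF \<phi> R(1)] polys_over_closed[OF R(1)])
  qed
  moreover have "\<forall>x\<in>I \<inter> adjoin R X. \<psi> x = 0"
    using ker \<psi> by (auto simp: adjoin_def)
  ultimately show ?thesis using const \<psi> by blast
qed

text \<open>Every relation of \<open>X\<close> modulo \<open>I\<close> has its coefficients in
  \<open>I\<close>, and \<open>\<phi>\<close> kills those, so any value \<open>\<xi>\<close> is
  allowed for \<open>X\<close>. The image of \<open>r\<close> is a nonzero polynomial over an
  infinite field, so some \<open>\<xi>\<close> is not a root of it.\<close>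

lemma extend_hom_transcendental:
  fixes \<phi> :: "'a \<Rightarrow> 'k::field_char_0"
  assumes R: "subring_on R" "R \<subseteq> B" and X: "X \<in> B"
    and \<phi>: "hom_on R \<phi>" "\<forall>x\<in>I \<inter> R. \<phi> x = 0"
    and tr: "\<And>q. q \<in> polys_over R \<Longrightarrow> poly q X \<in> I \<Longrightarrow> q \<in> polys_over I"
    and r: "r \<in> polys_over R" "\<phi> (coeff r i) \<noteq> 0"
  shows "\<exists>\<psi>. hom_on (adjoin R X) \<psi> \<and> (\<forall>x\<in>R. \<psi> x = \<phi> x) \<and> (\<forall>x\<in>I \<inter> adjoin R X. \<psi> x = 0) \<and>
    \<psi> (poly r X) \<noteq> 0"
proof -
  note \<phi>0 = hom_on_simps(2)[OF \<phi>(1) R(1)]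
  have "map_poly \<phi> r \<noteq> 0"
    using r \<phi>0 by (metis coeff_0 coeff_map_poly)
  then obtain \<xi> where \<xi>: "poly (map_poly \<phi> r) \<xi> \<noteq> 0"
    using poly_all_0_iff_0 by blast
  have "map_poly \<phi> q = 0" if "q \<in> polys_over R" "poly q X \<in> I" for q
    using tr[OF that] that \<phi>(2) \<phi>0 by (auto simp: poly_eq_iff coeff_map_poly polys_over_def)
  then show ?thesis
    using extend_hom_by_root[OF R X \<phi>(1), of \<xi>] \<xi> r(1) by (metis poly_0)
qed

text \<open>In the algebraic case everything is done modulo \<open>I\<close>: \<open>p\<close> is a minimal polynomial of \<open>X\<close>
  modulo \<open>I\<close>, and a nonzero constant \<open>c\<close> is a combination of \<open>p\<close> and \<open>r\<close> modulo \<open>I\<close>.\<close>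

lemma algebraic_bezout:
  assumes R: "subring_on R" "R \<subseteq> B" and X: "X \<in> B"
    and p: "p \<in> polys_over R" "poly p X \<in> I" "lead_coeff p \<notin> I"
    and min: "\<And>q. q \<in> polys_over R \<Longrightarrow> poly q X \<in> I \<Longrightarrow> degree q < degree p \<Longrightarrow> q \<in> polys_over I"
    and r: "r \<in> polys_over R" "poly r X \<notin> I"
  shows "\<exists>u v w c. u \<in> polys_over R \<and> v \<in> polys_over R \<and> w \<in> polys_over (I \<inter> R) \<and>
    c \<in> R - I \<and> [:c:] = u * p + v * r + w"
proof -
  have polysB: "q \<in> polys_over B" if "q \<in> polys_over R" for q
    using that R(2) by (auto simp: polys_over_def)
  have mem_diff: "q \<in> polys_over (I \<inter> R)" if "q \<in> polys_over I" "q \<in> polys_over R" for q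
    using that by (auto simp: polys_over_def)
  \<comment> \<open>The ideal generated by \<open>p\<close> and \<open>r\<close> among the
    polynomials over \<open>R\<close>, together with all polynomials that vanish modulo
    \<open>I\<close>.\<close>
  define E where "E = {u * p + v * r + w |u v w.
    u \<in> polys_over R \<and> v \<in> polys_over R \<and> w \<in> polys_over (I \<inter> R)}"
  have ER: "q \<in> polys_over R" if "q \<in> E" for q
    using that R(1) p(1) r(1) unfolding E_def
    by (auto intro!: polys_over_closed) (auto simp: polys_over_def)
  have I0: "0 \<in> polys_over (I \<inter> R)"
    using R(1) by (simp add: polys_over_def ideal_zero subring_on_closed)
  have E_add: "q + w \<in> E" if "q \<in> E" "w \<in> polys_over (I \<inter> R)" for q w
  proof -
    from that(1) obtain u v w' where "u \<in> polys_over R" "v \<in> polys_over R"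
      "w' \<in> polys_over (I \<inter> R)" "q = u * p + v * r + w'"
      unfolding E_def by blast
    moreover have "w' + w \<in> polys_over (I \<inter> R)"
      using calculation(3) that(2) R(1)
      by (auto simp: polys_over_def intro: ideal_add subring_on_closed)
    moreover have "q + w = u * p + v * r + (w' + w)" using calculation(4) by simp
    ultimately show ?thesis unfolding E_def by blast
  qed
  have E_comb: "smult a q - q' * h \<in> E" if "a \<in> R" "q \<in> E" "q' \<in> E" "h \<in> polys_over R" for a q q' h
  proof -
    from that(2) obtain u v w where 1: "u \<in> polys_over R" "v \<in> polys_over R"
      "w \<in> polys_over (I \<inter> R)" "q = u * p + v * r + w"
      unfolding E_def by blast
    from that(3) obtain u' v' w' where 2: "u' \<in> polys_over R" "v' \<in> polys_over R"
      "w' \<in> polys_over (I \<inter> R)" "q' = u' * p + v' * r + w'"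
      unfolding E_def by blast
    have "smult a w - w' * h \<in> polys_over R"
      using R(1) 1(3) 2(3) that by (intro polys_over_closed) (auto simp: polys_over_def)
    moreover have "smult a w - w' * h \<in> polys_over I"
      using 1(3) 2(3) that polysB[OF that(4)] R(2)
      by (intro polys_over_ideal_closed) (auto simp: polys_over_def intro: ideal_mult)
    ultimately have "smult a w - w' * h \<in> polys_over (I \<inter> R)" by (simp add: mem_diff)
    moreover have "smult a q - q' * h =
      (smult a u - u' * h) * p + (smult a v - v' * h) * r + (smult a w - w' * h)"
      by (simp add: 1(4) 2(4) algebra_simps smult_add_right)
    moreover have "smult a u - u' * h \<in> polys_over R" "smult a v - v' * h \<in> polys_over R"
      using 1 2 that R(1) by (auto intro!: polys_over_closed)
    ultimately show ?thesis unfolding E_def by blast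
  qed
  have pE: "p \<in> E" and rE: "r \<in> E"
    unfolding E_def using R(1) I0
    by (force intro: exI[of _ 1] exI[of _ 0] polys_over_closed)+
  \<comment> \<open>An element of least degree with surviving leading coefficient plays the part of
    a greatest common divisor of \<open>p\<close> and \<open>r\<close> over the fraction field of
    \<open>R\<close> modulo \<open>I\<close>.\<close>
  define P where "P q \<longleftrightarrow> q \<in> E \<and> lead_coeff q \<notin> I" for q
  obtain g where g: "P g" and g_min: "\<And>q. P q \<Longrightarrow> degree g \<le> degree q"
    using ex_has_least_nat[of P p degree] pE p(3) by (auto simp: P_def)
  have gR: "g \<in> polys_over R" using g ER by (simp add: P_def)
  have lgR: "lead_coeff g \<in> R" using gR by (simp add: polys_over_def)
  \<comment> \<open>Reducing \<open>q\<close> stays inside \<open>E\<close>, so a nonzero reduction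
    of smaller degree would contradict the choice of \<open>g\<close>.\<close>
  have E_low: "q \<in> polys_over I" if q: "q \<in> E" "degree q < degree g" for q
  proof -
    obtain q' where q': "q' \<in> polys_over R" "q - q' \<in> polys_over (I \<inter> R)" "degree q' \<le> degree q"
      "q' = 0 \<or> lead_coeff q' \<notin> I"
      using exists_reduced_poly[OF R(1) ER[OF q(1)]] by blast
    have "q' - q \<in> polys_over (I \<inter> R)"
      using q'(2) R(1) by (auto simp: polys_over_def) (metis ideal_neg minus_diff_eq subring_on_closed(3))+
    from E_add[OF q(1) this] have "q' \<in> E" by simp
    then have "q' = 0" using q'(3,4) q(2) g_min[of q'] by (auto simp: P_def)
    then show ?thesis using q'(2) by (auto simp: polys_over_def)
  qed
  \<comment> \<open>Otherwise \<open>g\<close> divides both \<open>p\<close> and \<open>r\<close>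
    modulo \<open>I\<close>, up to powers of its leading coefficient. As \<open>r\<close> does not
    vanish at \<open>X\<close> modulo \<open>I\<close>, neither does \<open>g\<close>; so the
    cofactor of \<open>p\<close> vanishes there, against the minimality of \<open>p\<close>.\<close>
  have "degree g = 0"
  proof (rule ccontr)
    assume "degree g \<noteq> 0"
    then have dg: "degree g > 0" by simp
    note div = pseudo_division[OF R(1) gR dg]
    have division: "\<exists>k h s. h \<in> polys_over R \<and> s \<in> polys_over I \<and>
      smult (lead_coeff g ^ k) q = g * h + s" if "q \<in> E" for q
    proof -
      from div[OF ER[OF that]] obtain k h s where *: "h \<in> polys_over R"
        "smult (lead_coeff g ^ k) q = g * h + s" "degree s < degree g"
        by blast
      have "s = smult (lead_coeff g ^ k) q - g * h" using *(2) by simp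
      also have "\<dots> \<in> E"
        using that g *(1) lgR R(1) by (intro E_comb subring_on_closed) (auto simp: P_def)
      finally show ?thesis using * E_low by blast
    qed
    have lg: "lead_coeff g ^ k \<notin> I" for k
      using g lgR R(2) by (intro power_notin) (auto simp: P_def)
    have lgB: "lead_coeff g ^ k \<in> B" for k
      using lgR R by (blast intro: subring_on_closed)
    have gB: "poly g X \<in> B" using polysB[OF gR] X by (rule poly_mem)
    have gX: "poly g X \<notin> I"
    proof
      assume *: "poly g X \<in> I"
      obtain k h s where hs: "h \<in> polys_over R" "s \<in> polys_over I"
        "smult (lead_coeff g ^ k) r = g * h + s"
        using division[OF rE] by blast
      have "lead_coeff g ^ k * poly r X = poly g X * poly h X + poly s X"
        using arg_cong[OF hs(3), of "\<lambda>q. poly q X"] by simp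
      also have "\<dots> \<in> I"
        by (rule ideal_add[OF ideal_mult'[OF poly_mem[OF polysB[OF hs(1)] X] *]
              poly_ideal[OF hs(2) X]])
      finally show False
        using prime lg[of k] r(2) lgR R poly_mem[OF polysB[OF r(1)] X]
        by (meson subring_on_closed(7) subset_iff)
    qed
    obtain k h s where hs: "h \<in> polys_over R" "s \<in> polys_over I"
      "smult (lead_coeff g ^ k) p = g * h + s"
      using division[OF pE] by blast
    have "poly g X * poly h X = lead_coeff g ^ k * poly p X - poly s X"
      using arg_cong[OF hs(3), of "\<lambda>q. poly q X"] by simp
    also have "\<dots> \<in> I"
      using R lgR by (intro ideal_diff ideal_mult[OF _ p(2)] poly_ideal[OF hs(2) X])
        (auto intro: subring_on_closed)
    finally have hX: "poly h X \<in> I"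
      using prime[OF gB poly_mem[OF polysB[OF hs(1)] X]] gX by blast
    obtain h' where h': "h' \<in> polys_over R" "h - h' \<in> polys_over (I \<inter> R)"
      "h' = 0 \<or> lead_coeff h' \<notin> I"
      using exists_reduced_poly[OF R(1) hs(1)] by blast
    have hI: "h - h' \<in> polys_over I" using h'(2) by (auto simp: polys_over_def)
    have "poly h' X = poly h X - poly (h - h') X" by simp
    also have "\<dots> \<in> I" using hX poly_ideal[OF hI X] by (intro ideal_diff)
    finally have h'X: "poly h' X \<in> I" .
    have gh': "smult (lead_coeff g ^ k) p - g * h' \<in> polys_over I"
    proof -
      have "smult (lead_coeff g ^ k) p - g * h' = g * (h - h') + s"
        using hs(3) by (simp add: algebra_simps)
      also have "\<dots> \<in> polys_over I"
        by (rule polys_over_ideal_closed(1)[OF polys_over_ideal_closed(3)[OF polysB[OF gR] hI] hs(2)])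
      finally show ?thesis .
    qed
    show False
    proof (cases "h' = 0")
      case True
      then have "lead_coeff g ^ k * lead_coeff p \<in> I"
        using gh' by (simp add: polys_over_def)
      then show False
        using prime[of "lead_coeff g ^ k" "lead_coeff p"] lg[of k] p(1,3) lgB polysB[OF p(1)]
        by (simp add: polys_over_def)
    next
      case False
      \<comment> \<open>\<open>h'\<close> is a relation of \<open>X\<close> with surviving leading
        coefficient, so minimality bounds its degree from below. The top coefficient of
        \<open>g * h'\<close> then sits beyond the degree of \<open>p\<close> and must lie in
        \<open>I\<close>.\<close>
      have "degree h' \<ge> degree p"
        using False h' min[OF h'(1) h'X] by (force simp: polys_over_def)
      then have "coeff p (degree g + degree h') = 0"
        using dg by (intro coeff_eq_0) simp
      then have "lead_coeff g * lead_coeff h' \<in> I"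
        using gh' ideal_neg unfolding polys_over_def
        by (auto simp: coeff_mult_degree_sum dest!: spec[of _ "degree g + degree h'"])
          (metis add.inverse_inverse)
      then show False
        using prime[of "lead_coeff g" "lead_coeff h'"] False h'(1,3) g lgR R(2)
        by (auto simp: P_def polys_over_def)
    qed
  qed
  then obtain c where c: "g = [:c:]" using degree_eq_zeroE by blast
  have "c \<in> R - I" using g lgR by (auto simp: P_def c)
  moreover have "[:c:] \<in> E" using g by (simp add: P_def c)
  ultimately show ?thesis unfolding E_def by blast
qed

text \<open>The value of \<open>X\<close> is a root \<open>\<xi>\<close> of the image of the minimal
  relation \<open>p\<close>; this image keeps its positive degree because \<open>\<phi>\<close> does
  not kill the leading coefficient. The Bezout identity prevents \<open>r\<close> from vanishing at
  the same root.\<close>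

lemma extend_hom_algebraic:
  fixes \<phi> :: "'a \<Rightarrow> 'k::alg_closed_field"
  assumes R: "subring_on R" "R \<subseteq> B" and X: "X \<in> B"
    and \<phi>: "hom_on R \<phi>" "\<forall>x\<in>I \<inter> R. \<phi> x = 0"
    and p: "p \<in> polys_over R" "degree p > 0" "\<phi> (lead_coeff p) \<noteq> 0" "poly p X \<in> I"
    and min: "\<And>q. q \<in> polys_over R \<Longrightarrow> poly q X \<in> I \<Longrightarrow> degree q < degree p \<Longrightarrow> q \<in> polys_over I"
    and r: "r \<in> polys_over R"
    and bezout: "u \<in> polys_over R" "v \<in> polys_over R" "w \<in> polys_over (I \<inter> R)"
      "\<phi> c \<noteq> 0" "[:c:] = u * p + v * r + w"
  shows "\<exists>\<psi>. hom_on (adjoin R X) \<psi> \<and> (\<forall>x\<in>R. \<psi> x = \<phi> x) \<and> (\<forall>x\<in>I \<inter> adjoin R X. \<psi> x = 0) \<and>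
    \<psi> (poly r X) \<noteq> 0"
proof -
  note \<phi>0 = hom_on_simps(2)[OF \<phi>(1) R(1)]
  note map = map_poly_hom_on[OF \<phi>(1) R(1)]
  note closed = polys_over_closed[OF R(1)]
  have polysI: "q \<in> polys_over R \<Longrightarrow> q \<in> polys_over I \<Longrightarrow> map_poly \<phi> q = 0" for q
    using \<phi>(2) \<phi>0 by (auto simp: poly_eq_iff coeff_map_poly polys_over_def)
  have "degree (map_poly \<phi> p) > 0"
    using p(2,3) \<phi>0 by (metis coeff_map_poly le_degree order_less_le_trans)
  then obtain \<xi> where \<xi>: "poly (map_poly \<phi> p) \<xi> = 0"
    using alg_closed_imp_poly_has_root by blast
  have lpR: "lead_coeff p \<in> R" using p(1) by (simp add: polys_over_def)
  \<comment> \<open>Pseudo-division of a relation \<open>q\<close> by \<open>p\<close> leaves a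
    relation of smaller degree, which lies over \<open>I\<close> by minimality and is killed by
    \<open>\<phi>\<close>. The factor in front of \<open>q\<close> cancels because its image is
    nonzero.\<close>
  have ker: "poly (map_poly \<phi> q) \<xi> = 0" if q: "q \<in> polys_over R" "poly q X \<in> I" for q
  proof -
    obtain k h s where hs: "h \<in> polys_over R" "s \<in> polys_over R"
      "smult (lead_coeff p ^ k) q = p * h + s" "degree s < degree p"
      using pseudo_division[OF R(1) p(1,2) q(1)] by blast
    have lpk: "lead_coeff p ^ k \<in> R" using lpR R(1) by (rule subring_on_closed(7)[rotated])
    have "poly s X = lead_coeff p ^ k * poly q X - poly p X * poly h X"
      using arg_cong[OF hs(3), of "\<lambda>q. poly q X"] by simp
    also have "\<dots> \<in> I"
    proof (rule ideal_diff)
      show "lead_coeff p ^ k * poly q X \<in> I" using lpk R(2) q(2) by (blast intro: ideal_mult)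
      have "poly h X \<in> B" using hs(1) R(2) X by (intro poly_mem) (auto simp: polys_over_def)
      then show "poly p X * poly h X \<in> I" using p(4) by (rule ideal_mult')
    qed
    finally have "map_poly \<phi> s = 0" using min hs polysI by blast
    then have "smult (\<phi> (lead_coeff p ^ k)) (map_poly \<phi> q) = map_poly \<phi> p * map_poly \<phi> h"
      using arg_cong[OF hs(3), of "map_poly \<phi>"] hs(1,2) p(1) q(1) lpk
      by (simp add: map closed)
    from arg_cong[OF this, of "\<lambda>q. poly q \<xi>"] show ?thesis
      using \<xi> p(3) lpR by (simp add: hom_on_simps[OF \<phi>(1) R(1)])
  qed
  obtain \<psi> where \<psi>: "hom_on (adjoin R X) \<psi>" "\<forall>x\<in>R. \<psi> x = \<phi> x" "\<forall>x\<in>I \<inter> adjoin R X. \<psi> x = 0"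
    "\<forall>q\<in>polys_over R. \<psi> (poly q X) = poly (map_poly \<phi> q) \<xi>"
    using extend_hom_by_root[OF R X \<phi>(1), of \<xi>] ker by blast
  have wR: "w \<in> polys_over R" "w \<in> polys_over I" using bezout(3) by (auto simp: polys_over_def)
  \<comment> \<open>\<open>w\<close> disappears under \<open>\<phi>\<close>. At \<open>\<xi>\<close>
    the \<open>p\<close> term disappears too, so the nonzero \<open>\<phi> c\<close> is a multiple
    of the value of the image of \<open>r\<close>.\<close>
  have "map_poly \<phi> [:c:] = map_poly \<phi> u * map_poly \<phi> p + map_poly \<phi> v * map_poly \<phi> r"
    using bezout wR p(1) r polysI[OF wR] by (simp add: map closed)
  from arg_cong[OF this, of "\<lambda>q. poly q \<xi>"] have "poly (map_poly \<phi> r) \<xi> \<noteq> 0"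
    using \<xi> bezout(4) \<phi>0 by (cases "c = 0") (auto simp: map_poly_pCons)
  then show ?thesis using \<psi> r by force
qed

text \<open>\<open>g'\<close> is chosen before \<open>\<phi>\<close> and serves every
  \<open>\<phi>\<close> at once. In the application this uniformity makes the set of points that can
  be lifted contain a basic open set.\<close>

lemma extend_hom_adjoin:
  assumes R: "subring_on R" "R \<subseteq> B" and X: "X \<in> B" and g: "g \<in> adjoin R X" "g \<notin> I"
  shows "\<exists>g'\<in>R - I. \<forall>\<phi> :: 'a \<Rightarrow> 'k::{alg_closed_field, field_char_0}.
    hom_on R \<phi> \<longrightarrow> (\<forall>x\<in>I \<inter> R. \<phi> x = 0) \<longrightarrow> \<phi> g' \<noteq> 0 \<longrightarrow>
    (\<exists>\<psi>. hom_on (adjoin R X) \<psi> \<and> (\<forall>x\<in>R. \<psi> x = \<phi> x) \<and> (\<forall>x\<in>I \<inter> adjoin R X. \<psi> x = 0) \<and>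
      \<psi> g \<noteq> 0)"
proof -
  obtain r where r: "r \<in> polys_over R" "g = poly r X" using g(1) by (auto simp: adjoin_def)
  show ?thesis
  proof (cases "\<forall>q\<in>polys_over R. poly q X \<in> I \<longrightarrow> q \<in> polys_over I")
    case True
    \<comment> \<open>Transcendental case: any coefficient of \<open>r\<close> outside
      \<open>I\<close> can serve as \<open>g'\<close>.\<close>
    obtain i where "coeff r i \<notin> I"
      using g(2) r(2) poly_ideal[OF _ X, of r] unfolding polys_over_def by blast
    then have "coeff r i \<in> R - I" using r(1) by (simp add: polys_over_def)
    then show ?thesis
      using extend_hom_transcendental[OF R X _ _ _ r(1)] True unfolding r(2) by blast
  next
    case False
    define P where "P q \<longleftrightarrow> q \<in> polys_over R \<and> poly q X \<in> I \<and> lead_coeff q \<notin> I" for q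
    have reduce: "\<exists>q'. P q' \<and> degree q' \<le> degree q"
      if q: "q \<in> polys_over R" "poly q X \<in> I" "q \<notin> polys_over I" for q
    proof -
      obtain q' where q': "q' \<in> polys_over R" "q - q' \<in> polys_over (I \<inter> R)" "degree q' \<le> degree q"
        "q' = 0 \<or> lead_coeff q' \<notin> I"
        using exists_reduced_poly[OF R(1) q(1)] by blast
      have qI: "q - q' \<in> polys_over I" using q'(2) by (auto simp: polys_over_def)
      have "poly q' X = poly q X - poly (q - q') X" by simp
      also have "\<dots> \<in> I" using q(2) poly_ideal[OF qI X] by (rule ideal_diff)
      finally show ?thesis using q' q(3) qI by (auto simp: P_def intro!: exI[of _ q'])
    qed
    obtain q where q: "P q" using False reduce by blast
    obtain p where p: "P p" and p_min: "\<And>q. P q \<Longrightarrow> degree p \<le> degree q"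
      using ex_has_least_nat[of P q degree] q by auto
    have min: "q \<in> polys_over I"
      if "q \<in> polys_over R" "poly q X \<in> I" "degree q < degree p" for q
      using reduce[OF that(1,2)] p_min that(3) by fastforce
    have "degree p > 0"
    proof (rule ccontr)
      assume "\<not> degree p > 0"
      then obtain c where "p = [:c:]" using degree_eq_zeroE by blast
      then show False using p by (simp add: P_def)
    qed
    obtain u v w c where b: "u \<in> polys_over R" "v \<in> polys_over R" "w \<in> polys_over (I \<inter> R)"
      "c \<in> R - I" "[:c:] = u * p + v * r + w"
      using algebraic_bezout[OF R X _ _ _ min r(1)] p g(2) r(2) unfolding P_def by blast
    have lp: "lead_coeff p \<in> R - I" using p by (simp add: P_def polys_over_def)
    \<comment> \<open>Algebraic case: this product is \<open>g'\<close>. Its first factor preserves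
      the degree of \<open>p\<close> under \<open>\<phi>\<close>, the second is the Bezout constant,
      and primality keeps the product outside \<open>I\<close>.\<close>
    have "lead_coeff p * c \<in> R - I"
      using lp b(4) R prime[of "lead_coeff p" c] by (auto intro: subring_on_closed)
    moreover have "\<phi> (lead_coeff p) \<noteq> 0 \<and> \<phi> c \<noteq> 0"
      if "hom_on R \<phi>" "\<phi> (lead_coeff p * c) \<noteq> 0" for \<phi> :: "'a \<Rightarrow> 'k"
      using that lp b(4) by (simp add: hom_on_simps[OF that(1) R(1)])
    moreover have "p \<in> polys_over R" "poly p X \<in> I" using p by (auto simp: P_def)
    ultimately show ?thesis
      using extend_hom_algebraic[OF R X _ _ _ \<open>degree p > 0\<close> _ _ min r(1) b(1-3) _ b(5)]
      unfolding r(2) by blast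
  qed
qed

end

section \<open>Finitely many generators\<close>

fun adjoin_list :: "'a::comm_ring_1 set \<Rightarrow> 'a list \<Rightarrow> 'a set" where
  "adjoin_list R [] = R"
| "adjoin_list R (X # Xs) = adjoin_list (adjoin R X) Xs"

lemma adjoin_list_properties:
  assumes "subring_on R"
  shows "subring_on (adjoin_list R Xs)" "R \<subseteq> adjoin_list R Xs" "set Xs \<subseteq> adjoin_list R Xs"
  using assms
proof (induction Xs arbitrary: R)
  case (Cons X Xs)
  case 1
  then show ?case using Cons.IH(1)[OF subring_on_adjoin[OF 1]] by simp
next
  case (Cons X Xs)
  case 2
  then show ?case using Cons.IH(2)[OF subring_on_adjoin[OF 2]] adjoin_superset[OF 2] by force
next
  case (Cons X Xs)
  case 3
  then show ?case
    using Cons.IH(2,3)[OF subring_on_adjoin[OF 3]] adjoin_generator[OF 3] by force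
qed auto

text \<open>Chevalley's extension theorem. The nonvanishing condition descends the tower: the later
  generators turn \<open>g\<close> into \<open>g1\<close> over \<open>adjoin R X\<close>, and the
  first generator turns \<open>g1\<close> into \<open>g'\<close> over \<open>R\<close>.\<close>

theorem (in prime_ideal_on) extend_hom_adjoin_list:
  assumes "subring_on R" "R \<subseteq> B" "set Xs \<subseteq> B" "g \<in> adjoin_list R Xs" "g \<notin> I"
  shows "\<exists>g'\<in>R - I. \<forall>\<phi> :: 'a \<Rightarrow> 'k::{alg_closed_field, field_char_0}.
    hom_on R \<phi> \<longrightarrow> (\<forall>x\<in>I \<inter> R. \<phi> x = 0) \<longrightarrow> \<phi> g' \<noteq> 0 \<longrightarrow>
    (\<exists>\<psi>. hom_on (adjoin_list R Xs) \<psi> \<and> (\<forall>x\<in>R. \<psi> x = \<phi> x) \<and>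
      (\<forall>x\<in>I \<inter> adjoin_list R Xs. \<psi> x = 0) \<and> \<psi> g \<noteq> 0)"
  using assms
proof (induction Xs arbitrary: R)
  case Nil
  then show ?case by auto
next
  case (Cons X Xs)
  note R = Cons.prems(1,2)
  have X: "X \<in> B" using Cons.prems(3) by simp
  have "set Xs \<subseteq> B" "g \<in> adjoin_list (adjoin R X) Xs" using Cons.prems by auto
  note IH = Cons.IH[OF subring_on_adjoin[OF R(1)] adjoin_subset[OF R(2) X] this Cons.prems(5)]
  obtain g1 where g1: "g1 \<in> adjoin R X - I" and ext1: "\<And>\<phi> :: 'a \<Rightarrow> 'k.
    hom_on (adjoin R X) \<phi> \<Longrightarrow> (\<forall>x\<in>I \<inter> adjoin R X. \<phi> x = 0) \<Longrightarrow> \<phi> g1 \<noteq> 0 \<Longrightarrow>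
    \<exists>\<psi>. hom_on (adjoin_list R (X # Xs)) \<psi> \<and> (\<forall>x\<in>adjoin R X. \<psi> x = \<phi> x) \<and>
      (\<forall>x\<in>I \<inter> adjoin_list R (X # Xs). \<psi> x = 0) \<and> \<psi> g \<noteq> 0"
    using IH unfolding adjoin_list.simps by blast
  obtain g' where g': "g' \<in> R - I" and ext: "\<And>\<phi> :: 'a \<Rightarrow> 'k.
    hom_on R \<phi> \<Longrightarrow> (\<forall>x\<in>I \<inter> R. \<phi> x = 0) \<Longrightarrow> \<phi> g' \<noteq> 0 \<Longrightarrow>
    \<exists>\<psi>. hom_on (adjoin R X) \<psi> \<and> (\<forall>x\<in>R. \<psi> x = \<phi> x) \<and> (\<forall>x\<in>I \<inter> adjoin R X. \<psi> x = 0) \<and>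
      \<psi> g1 \<noteq> 0"
    using extend_hom_adjoin[OF R X, of g1] g1 by blast
  show ?case
  proof (intro bexI[OF _ g'] allI impI)
    fix \<phi> :: "'a \<Rightarrow> 'k"
    assume "hom_on R \<phi>" "\<forall>x\<in>I \<inter> R. \<phi> x = 0" "\<phi> g' \<noteq> 0"
    from ext[OF this] obtain \<psi> where \<psi>: "hom_on (adjoin R X) \<psi>" "\<forall>x\<in>R. \<psi> x = \<phi> x"
      "\<forall>x\<in>I \<inter> adjoin R X. \<psi> x = 0" "\<psi> g1 \<noteq> 0" by blast
    from ext1[OF \<psi>(1,3,4)] \<psi>(2) adjoin_superset[OF R(1), of X]
    show "\<exists>\<psi>. hom_on (adjoin_list R (X # Xs)) \<psi> \<and> (\<forall>x\<in>R. \<psi> x = \<phi> x) \<and>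
      (\<forall>x\<in>I \<inter> adjoin_list R (X # Xs). \<psi> x = 0) \<and> \<psi> g \<noteq> 0"
      by (metis subset_iff)
  qed
qed

section \<open>Prime ideals avoiding a multiplicative set\<close>

text \<open>An ideal maximal among those containing \<open>J\<close> and disjoint from
  \<open>S\<close> is prime: if \<open>a\<close> and \<open>b\<close> lie outside it, the ideals it
  generates with \<open>a\<close> and with \<open>b\<close> both meet \<open>S\<close>, and the
  product of two such meeting points would lie in \<open>I\<close> if \<open>a * b\<close>
  did.\<close>

lemma exists_prime_ideal_disjoint:
  fixes B J S :: "'a::comm_ring_1 set"
  assumes B: "subring_on B" and J: "J \<subseteq> B" "0 \<in> J" "\<And>x y. x \<in> J \<Longrightarrow> y \<in> J \<Longrightarrow> x + y \<in> J"
      "\<And>b x. b \<in> B \<Longrightarrow> x \<in> J \<Longrightarrow> b * x \<in> J"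
    and S: "S \<subseteq> B" "1 \<in> S" "\<And>x y. x \<in> S \<Longrightarrow> y \<in> S \<Longrightarrow> x * y \<in> S" "J \<inter> S = {}"
  shows "\<exists>I. prime_ideal_on B I \<and> J \<subseteq> I \<and> I \<inter> S = {}"
proof -
  define id where "id I \<longleftrightarrow> I \<subseteq> B \<and> 0 \<in> I \<and> (\<forall>x\<in>I. \<forall>y\<in>I. x + y \<in> I) \<and> (\<forall>b\<in>B. \<forall>x\<in>I. b * x \<in> I)"
    for I
  define \<A> where "\<A> = {I. id I \<and> J \<subseteq> I \<and> I \<inter> S = {}}"
  have "J \<in> \<A>" using J S by (auto simp: \<A>_def id_def)
  have "\<Union>C \<in> \<A>" if C: "C \<noteq> {}" "subset.chain \<A> C" for C
  proof -
    have CA: "I \<in> \<A>" if "I \<in> C" for I using C(2) that by (auto simp: subset.chain_def)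
    have idC: "I \<subseteq> B" "J \<subseteq> I" "I \<inter> S = {}" "0 \<in> I" "\<And>x y. x \<in> I \<Longrightarrow> y \<in> I \<Longrightarrow> x + y \<in> I"
      "\<And>b x. b \<in> B \<Longrightarrow> x \<in> I \<Longrightarrow> b * x \<in> I" if "I \<in> C" for I
      using CA[OF that] by (simp_all add: \<A>_def id_def)
    have "x + y \<in> \<Union>C" if xy: "x \<in> \<Union>C" "y \<in> \<Union>C" for x y
    proof -
      obtain I I' where I: "I \<in> C" "x \<in> I" "I' \<in> C" "y \<in> I'" using xy by blast
      then have "I \<subseteq> I' \<or> I' \<subseteq> I" using C(2) by (auto simp: subset_chain_def)
      then show ?thesis
        using I idC by (meson UnionI subset_iff)
    qed
    moreover have "b * x \<in> \<Union>C" if "b \<in> B" "x \<in> \<Union>C" for b x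
      using that idC by (meson UnionE UnionI)
    moreover have "\<Union>C \<subseteq> B" "J \<subseteq> \<Union>C" "\<Union>C \<inter> S = {}" "0 \<in> \<Union>C"
      using C(1) idC by (blast+)
    ultimately show ?thesis
      unfolding \<A>_def id_def by simp
  qed
  then obtain I where IA: "I \<in> \<A>" and max: "\<And>X. X \<in> \<A> \<Longrightarrow> I \<subseteq> X \<Longrightarrow> X = I"
    using subset_Zorn_nonempty[of \<A>] \<open>J \<in> \<A>\<close> by blast
  have I: "I \<subseteq> B" "0 \<in> I" "\<And>x y. x \<in> I \<Longrightarrow> y \<in> I \<Longrightarrow> x + y \<in> I"
    "\<And>b x. b \<in> B \<Longrightarrow> x \<in> I \<Longrightarrow> b * x \<in> I" "J \<subseteq> I" "I \<inter> S = {}"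
    using IA by (auto simp: \<A>_def id_def)
  note Bc = subring_on_closed[OF B]
  have meets: "\<exists>x b. x \<in> I \<and> b \<in> B \<and> x + b * a \<in> S" if a: "a \<in> B" "a \<notin> I" for a
  proof (rule ccontr)
    assume no: "\<not> ?thesis"
    define I' where "I' = {x + b * a |x b. x \<in> I \<and> b \<in> B}"
    have "I' \<subseteq> B" using I(1) a(1) Bc by (auto simp: I'_def)
    moreover have II': "I \<subseteq> I'" using Bc(2) by (force simp: I'_def)
    moreover have "x + y \<in> I'" if "x \<in> I'" "y \<in> I'" for x y
    proof -
      from that obtain u b v c where
        "u \<in> I" "b \<in> B" "x = u + b * a" "v \<in> I" "c \<in> B" "y = v + c * a"
        unfolding I'_def by blast
      then have "x + y = (u + v) + (b + c) * a" "u + v \<in> I" "b + c \<in> B"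
        using I(3) Bc by (auto simp: algebra_simps)
      then show ?thesis unfolding I'_def by blast
    qed
    moreover have "c * x \<in> I'" if "c \<in> B" "x \<in> I'" for c x
    proof -
      from that obtain u b where "u \<in> I" "b \<in> B" "x = u + b * a" unfolding I'_def by blast
      then have "c * x = c * u + (c * b) * a" "c * u \<in> I" "c * b \<in> B"
        using I(4) Bc that by (auto simp: algebra_simps)
      then show ?thesis unfolding I'_def by blast
    qed
    moreover have "I' \<inter> S = {}" using no by (auto simp: I'_def)
    ultimately have "I' \<in> \<A>" using I(2,5) by (auto simp: \<A>_def id_def)
    then have "I' = I" using max II' by blast
    moreover have "a \<in> I'" using I(2) Bc(1) unfolding I'_def by force
    ultimately show False using a(2) by blast
  qed
  have "prime_ideal_on B I"
  proof
    fix a b assume ab: "a \<in> B" "b \<in> B" "a * b \<in> I"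
    show "a \<in> I \<or> b \<in> I"
    proof (rule ccontr)
      assume "\<not> ?thesis"
      then obtain x c y d where *: "x \<in> I" "c \<in> B" "x + c * a \<in> S" "y \<in> I" "d \<in> B" "y + d * b \<in> S"
        using meets ab by metis
      have "(x + c * a) * (y + d * b) = (y + d * b) * x + (c * a) * y + (c * d) * (a * b)"
        by (simp add: algebra_simps)
      also have "\<dots> \<in> I"
      proof (intro I(3))
        show "(y + d * b) * x \<in> I" using * S(1) by (intro I(4)[of "y + d * b" x]) auto
        show "(c * a) * y \<in> I" using * ab Bc by (intro I(4)[of "c * a" y]) auto
        show "(c * d) * (a * b) \<in> I" using * ab Bc by (intro I(4)[of "c * d" "a * b"]) auto
      qed
      finally show False using S(3)[OF *(3,6)] I(6) by blast
    qed
  qed (use B I S in auto)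
  then show ?thesis using I by blast
qed

section \<open>The adjoint representation\<close>

text \<open>Agreement is asked only on \<open>Y\<close>, because multiplication and inversion of
  \<open>Q\<close> are given by polynomials only on its carrier.\<close>

lemma poly_functions_compose_on:
  assumes "p \<in> poly_functions F"
    and "\<And>f. f \<in> F \<Longrightarrow> \<exists>q\<in>poly_functions G. \<forall>y\<in>Y. f (\<phi> y) = q y"
  shows "\<exists>q\<in>poly_functions G. \<forall>y\<in>Y. p (\<phi> y) = q y"
  using assms(1)
proof induction
  case (const c)
  show ?case by (intro bexI[of _ "\<lambda>_. c"] poly_functions.const) simp
next
  case (add f g)
  then obtain f' g' where "f' \<in> poly_functions G" "\<forall>y\<in>Y. f (\<phi> y) = f' y"
    "g' \<in> poly_functions G" "\<forall>y\<in>Y. g (\<phi> y) = g' y" by blast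
  then show ?case by (intro bexI[of _ "\<lambda>x. f' x + g' x"] poly_functions.add) simp_all
next
  case (mult f g)
  then obtain f' g' where "f' \<in> poly_functions G" "\<forall>y\<in>Y. f (\<phi> y) = f' y"
    "g' \<in> poly_functions G" "\<forall>y\<in>Y. g (\<phi> y) = g' y" by blast
  then show ?case by (intro bexI[of _ "\<lambda>x. f' x * g' x"] poly_functions.mult) simp_all
qed (use assms(2) in blast)

lemma sum_list_fun_apply: "(\<Sum>p\<leftarrow>l. h p :: 'a \<Rightarrow> 'b::comm_monoid_add) x = (\<Sum>p\<leftarrow>l. h p x)"
  by (induction l) auto

text \<open>The list stands for a sum of pure tensors; the value is the function of two points that
  this tensor defines.\<close>

definition tensor_sum :: "(('a \<Rightarrow> 'k) \<times> ('b \<Rightarrow> 'k)) list \<Rightarrow> 'a \<Rightarrow> 'b \<Rightarrow> 'k::comm_ring_1" where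
  "tensor_sum l x y = (\<Sum>p\<leftarrow>l. fst p x * snd p y)"

lemma tensor_sum_mult:
  "tensor_sum l x y * tensor_sum l' x y =
    tensor_sum (concat (map (\<lambda>p. map (\<lambda>q. (\<lambda>x. fst p x * fst q x, \<lambda>y. snd p y * snd q y)) l') l)) x y"
proof -
  have "fst p x * snd p y * tensor_sum l' x y =
    tensor_sum (map (\<lambda>q. (\<lambda>x. fst p x * fst q x, \<lambda>y. snd p y * snd q y)) l') x y" for p
    by (induction l') (simp_all add: tensor_sum_def algebra_simps)
  then show ?thesis
    by (induction l) (simp_all add: tensor_sum_def algebra_simps)
qed

abbreviation coords :: "('k::field ^ 'n \<Rightarrow> 'k) set" where
  "coords \<equiv> range (\<lambda>i x. x $ i)"

lemma poly_functions_tensor_sum: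
  fixes p :: "('k::field ^ 'n) \<times> ('k ^ 'm) \<Rightarrow> 'k"
  assumes "p \<in> poly_functions (range (\<lambda>j (x, y). x $ j) \<union> range (\<lambda>j (x, y). y $ j))"
  shows "\<exists>l. set l \<subseteq> poly_functions coords \<times> poly_functions coords \<and>
    (\<forall>x y. p (x, y) = tensor_sum l x y)"
  using assms
proof induction
  case (const c)
  show ?case
    by (intro exI[of _ "[(\<lambda>_. c, \<lambda>_. 1)]"]) (simp add: tensor_sum_def poly_functions.const)
next
  case (coord f)
  then consider j where "f = (\<lambda>(x, y). x $ j)" | j where "f = (\<lambda>(x, y). y $ j)" by blast
  then show ?case
  proof cases
    case 1
    then show ?thesis
      by (intro exI[of _ "[(\<lambda>x. x $ j, \<lambda>_. 1)]"])
        (auto simp: tensor_sum_def intro: poly_functions.intros)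
  next
    case 2
    then show ?thesis
      by (intro exI[of _ "[(\<lambda>_. 1, \<lambda>y. y $ j)]"])
        (auto simp: tensor_sum_def intro: poly_functions.intros)
  qed
next
  case (add f g)
  then obtain l l' where "set l \<subseteq> poly_functions coords \<times> poly_functions coords"
    "\<forall>x y. f (x, y) = tensor_sum l x y" "set l' \<subseteq> poly_functions coords \<times> poly_functions coords"
    "\<forall>x y. g (x, y) = tensor_sum l' x y" by blast
  then show ?case by (intro exI[of _ "l @ l'"]) (simp add: tensor_sum_def)
next
  case (mult f g)
  then obtain l l' where l: "set l \<subseteq> poly_functions coords \<times> poly_functions coords"
    "\<forall>x y. f (x, y) = tensor_sum l x y" "set l' \<subseteq> poly_functions coords \<times> poly_functions coords"
    "\<forall>x y. g (x, y) = tensor_sum l' x y" by blast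
  show ?case
  proof (intro exI conjI allI)
    show "f (x, y) * g (x, y) = tensor_sum (concat (map (\<lambda>p. map (\<lambda>q.
      (\<lambda>x. fst p x * fst q x, \<lambda>y. snd p y * snd q y)) l') l)) x y" for x y
      using l by (simp add: tensor_sum_mult)
  qed (use l in \<open>auto intro!: poly_functions.mult\<close>)
qed

section \<open>Regular functions, comultiplication and translations\<close>

lemma coordinate_ring_iff:
  "f \<in> coordinate_ring X \<longleftrightarrow>
    (\<exists>p\<in>poly_functions coords. \<forall>x\<in>X. f x = p x) \<and> (\<forall>x. x \<notin> X \<longrightarrow> f x = 0)"
  unfolding coordinate_ring_def by (auto simp: fun_eq_iff)

lemma coordinate_ring_closed:
  shows coordinate_ring_zero: "0 \<in> coordinate_ring X"
    and coordinate_ring_const: "(\<lambda>x. if x \<in> X then c else 0) \<in> coordinate_ring X"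
    and coordinate_ring_add: "f \<in> coordinate_ring X \<Longrightarrow> g \<in> coordinate_ring X \<Longrightarrow> f + g \<in> coordinate_ring X"
    and coordinate_ring_mult: "f \<in> coordinate_ring X \<Longrightarrow> g \<in> coordinate_ring X \<Longrightarrow> f * g \<in> coordinate_ring X"
    and coordinate_ring_scale: "f \<in> coordinate_ring X \<Longrightarrow> (\<lambda>x. c * f x) \<in> coordinate_ring X"
proof -
  show const: "(\<lambda>x. if x \<in> X then c else 0) \<in> coordinate_ring X" for c
    unfolding coordinate_ring_def by (auto intro: poly_functions.const)
  from const[of 0] show "0 \<in> coordinate_ring X" by (simp add: zero_fun_def)
  show "f + g \<in> coordinate_ring X" if fg: "f \<in> coordinate_ring X" "g \<in> coordinate_ring X" for f g
  proof -
    obtain p q where "p \<in> poly_functions coords" "f = (\<lambda>x. if x \<in> X then p x else 0)"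
      "q \<in> poly_functions coords" "g = (\<lambda>x. if x \<in> X then q x else 0)"
      using fg by (auto simp: coordinate_ring_def)
    then show ?thesis
      unfolding coordinate_ring_def
      by (auto intro!: exI[of _ "\<lambda>x. p x + q x"] poly_functions.add)
  qed
  show mult: "f * g \<in> coordinate_ring X" if fg: "f \<in> coordinate_ring X" "g \<in> coordinate_ring X" for f g
  proof -
    obtain p q where "p \<in> poly_functions coords" "f = (\<lambda>x. if x \<in> X then p x else 0)"
      "q \<in> poly_functions coords" "g = (\<lambda>x. if x \<in> X then q x else 0)"
      using fg by (auto simp: coordinate_ring_def)
    then show ?thesis
      unfolding coordinate_ring_def
      by (auto intro!: exI[of _ "\<lambda>x. p x * q x"] poly_functions.mult)
  qed
  show "(\<lambda>x. c * f x) \<in> coordinate_ring X" if f: "f \<in> coordinate_ring X"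
  proof -
    have "(\<lambda>x. c * f x) = (\<lambda>x. if x \<in> X then c else 0) * f"
      using f by (auto simp: coordinate_ring_iff)
    then show ?thesis using mult[OF const f] by simp
  qed
qed

lemma coordinate_ring_sum_list:
  "(\<And>p. p \<in> set l \<Longrightarrow> h p \<in> coordinate_ring X) \<Longrightarrow> (\<Sum>p\<leftarrow>l. h p) \<in> coordinate_ring X"
  by (induction l) (auto intro: coordinate_ring_closed)

locale alg_group =
  fixes Q :: "('k::field ^ 'n) monoid" (structure)
  assumes affine: "affine_algebraic_group Q"

sublocale alg_group \<subseteq> group Q
  using affine by (simp add: affine_algebraic_group_def)

context alg_group
begin

abbreviation "A \<equiv> coordinate_ring (carrier Q)"
abbreviation "L \<equiv> lie_algebra Q"

text \<open>Multiplication is polynomial in the two points, and a polynomial in two groups of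
  variables splits into products. Hence all translates of \<open>f\<close> are combinations of
  finitely many fixed regular functions, to which derivations can be applied termwise.\<close>

lemma comultiplication:
  assumes "f \<in> A"
  obtains l where "set l \<subseteq> A \<times> A"
    and "\<And>x y. x \<in> carrier Q \<Longrightarrow> y \<in> carrier Q \<Longrightarrow> f (x \<otimes> y) = tensor_sum l x y"
proof -
  obtain p where p: "p \<in> poly_functions coords" "f = (\<lambda>x. if x \<in> carrier Q then p x else 0)"
    using assms by (auto simp: coordinate_ring_def)
  define G :: "(('k ^ 'n) \<times> ('k ^ 'n) \<Rightarrow> 'k) set"
    where "G = range (\<lambda>j (x, y). x $ j) \<union> range (\<lambda>j (x, y). y $ j)"
  have "\<exists>q\<in>poly_functions G. \<forall>z\<in>carrier Q \<times> carrier Q. h (case z of (x, y) \<Rightarrow> x \<otimes> y) = q z"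
    if "h \<in> coords" for h
    using that affine by (force simp: affine_algebraic_group_def G_def)
  from poly_functions_compose_on[OF p(1) this] obtain q where q: "q \<in> poly_functions G"
    "\<And>x y. x \<in> carrier Q \<Longrightarrow> y \<in> carrier Q \<Longrightarrow> p (x \<otimes> y) = q (x, y)" by force
  obtain l where l: "set l \<subseteq> poly_functions coords \<times> poly_functions coords"
    "\<forall>x y. q (x, y) = tensor_sum l x y"
    using poly_functions_tensor_sum q(1) unfolding G_def by blast
  define res :: "('k ^ 'n \<Rightarrow> 'k) \<Rightarrow> 'k ^ 'n \<Rightarrow> 'k"
    where "res u = (\<lambda>x. if x \<in> carrier Q then u x else 0)" for u
  have "set (map (map_prod res res) l) \<subseteq> A \<times> A"
    using l(1) by (auto simp: coordinate_ring_def res_def)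
  moreover have "f (x \<otimes> y) = tensor_sum (map (map_prod res res) l) x y"
    if "x \<in> carrier Q" "y \<in> carrier Q" for x y
    using that p(2) q(2)[OF that] l(2) by (simp add: tensor_sum_def res_def o_def)
  ultimately show thesis using that by blast
qed

definition antipode :: "('k ^ 'n \<Rightarrow> 'k) \<Rightarrow> 'k ^ 'n \<Rightarrow> 'k" where
  "antipode f = (\<lambda>x. if x \<in> carrier Q then f (inv x) else 0)"

lemma antipode_one: "antipode f \<one> = f \<one>"
  by (simp add: antipode_def)

lemma antipode_closed:
  assumes "f \<in> A"
  shows "antipode f \<in> A"
proof -
  obtain p where p: "p \<in> poly_functions coords" "f = (\<lambda>x. if x \<in> carrier Q then p x else 0)"
    using assms by (auto simp: coordinate_ring_def)
  have "\<exists>q\<in>poly_functions coords. \<forall>z\<in>carrier Q. h (inv z) = q z"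
    if "h \<in> coords" for h
    using that affine by (force simp: affine_algebraic_group_def)
  from poly_functions_compose_on[OF p(1) this] show ?thesis
    using p(2) by (auto simp: coordinate_ring_iff antipode_def)
qed

lemma tensor_sum_outside:
  assumes "set l \<subseteq> A \<times> A"
  shows "y \<notin> carrier Q \<Longrightarrow> tensor_sum l x y = 0" "x \<notin> carrier Q \<Longrightarrow> tensor_sum l x y = 0"
  using assms by (induction l) (auto simp: tensor_sum_def coordinate_ring_iff)

lemma tensor_sum_left:
  assumes "set l \<subseteq> A \<times> A"
  shows "(\<lambda>y. if y \<in> carrier Q then tensor_sum l x y else 0)
    = (\<Sum>p\<leftarrow>l. (\<lambda>y. fst p x * snd p y))"
  using tensor_sum_outside[OF assms] by (auto simp: fun_eq_iff sum_list_fun_apply tensor_sum_def)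

lemma tensor_sum_right:
  assumes "set l \<subseteq> A \<times> A"
  shows "(\<lambda>x. if x \<in> carrier Q then tensor_sum l x y else 0)
    = (\<Sum>p\<leftarrow>l. (\<lambda>x. snd p y * fst p x))"
  using tensor_sum_outside[OF assms]
  by (auto simp: fun_eq_iff sum_list_fun_apply tensor_sum_def mult.commute)

lemma left_translate_tensor:
  assumes "set l \<subseteq> A \<times> A"
    "\<And>x y. x \<in> carrier Q \<Longrightarrow> y \<in> carrier Q \<Longrightarrow> f (x \<otimes> y) = tensor_sum l x y" "g \<in> carrier Q"
  shows "left_translate Q g f = (\<Sum>p\<leftarrow>l. (\<lambda>y. fst p (inv g) * snd p y))"
  unfolding tensor_sum_left[OF assms(1), symmetric] left_translate_def
  using assms by (auto simp: fun_eq_iff)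

lemma right_translate_tensor:
  assumes "set l \<subseteq> A \<times> A"
    "\<And>x y. x \<in> carrier Q \<Longrightarrow> y \<in> carrier Q \<Longrightarrow> f (x \<otimes> y) = tensor_sum l x y" "g \<in> carrier Q"
  shows "right_translate Q g f = (\<Sum>p\<leftarrow>l. (\<lambda>x. snd p g * fst p x))"
  unfolding tensor_sum_right[OF assms(1), symmetric] right_translate_def
  using assms by (auto simp: fun_eq_iff)

lemma translate_closed:
  assumes "f \<in> A" "g \<in> carrier Q"
  shows "left_translate Q g f \<in> A" "right_translate Q g f \<in> A"
proof -
  obtain l where l: "set l \<subseteq> A \<times> A"
    "\<And>x y. x \<in> carrier Q \<Longrightarrow> y \<in> carrier Q \<Longrightarrow> f (x \<otimes> y) = tensor_sum l x y"
    using comultiplication[OF assms(1)] by blast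
  show "left_translate Q g f \<in> A"
    by (subst left_translate_tensor[OF l assms(2)], assumption+)
      (intro coordinate_ring_sum_list coordinate_ring_scale, use l(1) in auto)
  show "right_translate Q g f \<in> A"
    by (subst right_translate_tensor[OF l assms(2)], assumption+)
      (intro coordinate_ring_sum_list coordinate_ring_scale, use l(1) in auto)
qed

section \<open>Left-invariant derivations\<close>

lemma lie_mem:
  assumes "D \<in> L"
  shows lie_closed: "f \<in> A \<Longrightarrow> D f \<in> A"
    and lie_outside: "f \<notin> A \<Longrightarrow> D f = 0"
    and lie_add: "f \<in> A \<Longrightarrow> g \<in> A \<Longrightarrow> D (f + g) = D f + D g"
    and lie_scale: "f \<in> A \<Longrightarrow> D (\<lambda>x. c * f x) = (\<lambda>x. c * D f x)"
    and lie_mult: "f \<in> A \<Longrightarrow> g \<in> A \<Longrightarrow> D (f * g) = D f * g + f * D g"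
    and lie_left: "x \<in> carrier Q \<Longrightarrow> f \<in> A \<Longrightarrow> D (left_translate Q x f) = left_translate Q x (D f)"
  using assms by (auto simp: lie_algebra_def Let_def)

lemma lie_algebraI:
  assumes "\<And>f. f \<in> A \<Longrightarrow> D f \<in> A" "\<And>f. f \<notin> A \<Longrightarrow> D f = 0"
    "\<And>f g. f \<in> A \<Longrightarrow> g \<in> A \<Longrightarrow> D (f + g) = D f + D g"
    "\<And>c f. f \<in> A \<Longrightarrow> D (\<lambda>x. c * f x) = (\<lambda>x. c * D f x)"
    "\<And>f g. f \<in> A \<Longrightarrow> g \<in> A \<Longrightarrow> D (f * g) = D f * g + f * D g"
    "\<And>x f. x \<in> carrier Q \<Longrightarrow> f \<in> A \<Longrightarrow> D (left_translate Q x f) = left_translate Q x (D f)"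
  shows "D \<in> L"
  using assms by (simp add: lie_algebra_def Let_def)

lemma lie_zero: "D \<in> L \<Longrightarrow> D 0 = 0"
  using lie_scale[of D 0 0] coordinate_ring_zero[of "carrier Q"] by (simp add: zero_fun_def)

lemma lie_diff:
  assumes "D \<in> L" "f \<in> A" "g \<in> A"
  shows "D (f - g) = D f - D g" "f - g \<in> A"
proof -
  have neg: "f - g = f + (\<lambda>x. -1 * g x)" by (simp add: fun_eq_iff)
  have negA: "(\<lambda>x. -1 * g x) \<in> A" using assms(3) by (rule coordinate_ring_scale)
  show "f - g \<in> A" unfolding neg using assms(2) negA by (rule coordinate_ring_add)
  show "D (f - g) = D f - D g"
    unfolding neg lie_add[OF assms(1,2) negA] lie_scale[OF assms(1,3)] by (simp add: fun_eq_iff)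
qed

lemma lie_sum_list:
  assumes "D \<in> L" "\<And>p. p \<in> set l \<Longrightarrow> h p \<in> A"
  shows "D (\<Sum>p\<leftarrow>l. h p) = (\<Sum>p\<leftarrow>l. D (h p))"
  using assms(2)
  by (induction l) (auto simp: lie_zero[OF assms(1)] lie_add[OF assms(1)] coordinate_ring_sum_list)

lemma lie_sum_list_apply:
  assumes "D \<in> L" "\<And>p. p \<in> set l \<Longrightarrow> h p \<in> A"
  shows "D (\<Sum>p\<leftarrow>l. h p) x = (\<Sum>p\<leftarrow>l. D (h p) x)"
  using lie_sum_list[of D l h, OF assms] by (simp only: sum_list_fun_apply)

text \<open>The unit of \<open>A\<close> is the indicator function \<open>u\<close> of the carrier,
  and the product rule for \<open>u * u = u\<close> gives \<open>D u = D u + D u\<close>.\<close>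

lemma lie_const:
  assumes "D \<in> L"
  shows "D (\<lambda>x. if x \<in> carrier Q then c else 0) = 0"
proof -
  define u :: "'k ^ 'n \<Rightarrow> 'k" where "u = (\<lambda>x. if x \<in> carrier Q then 1 else 0)"
  have uA: "u \<in> A" unfolding u_def by (rule coordinate_ring_const)
  have "u * u = u" by (auto simp: u_def)
  then have "D u = D u * u + u * D u" using lie_mult[OF assms uA uA] by simp
  moreover have "D u * u = D u" "u * D u = D u"
    using lie_closed[OF assms uA] by (auto simp: fun_eq_iff coordinate_ring_iff u_def)
  ultimately have "D u = 0" by simp
  moreover have "(\<lambda>x. if x \<in> carrier Q then c else 0) = (\<lambda>x. c * u x)" by (auto simp: u_def)
  ultimately show ?thesis using lie_scale[OF assms uA, of c] by (simp add: fun_eq_iff)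
qed

text \<open>Left invariance moves the evaluation from \<open>x\<close> to \<open>\<one>\<close>: the
  value of \<open>D f\<close> at \<open>x\<close> is that of \<open>D\<close> applied to y \<mapsto>
  f(x y) at the unit. So \<open>D\<close> is determined by its values at
  \<open>\<one>\<close>.\<close>

lemma lie_apply_tensor:
  assumes D: "D \<in> L" and f: "f \<in> A" and l: "set l \<subseteq> A \<times> A"
    "\<And>x y. x \<in> carrier Q \<Longrightarrow> y \<in> carrier Q \<Longrightarrow> f (x \<otimes> y) = tensor_sum l x y"
  shows "D f = (\<Sum>p\<leftarrow>l. (\<lambda>x. D (snd p) \<one> * fst p x))"
proof
  fix x
  show "D f x = (\<Sum>p\<leftarrow>l. (\<lambda>x. D (snd p) \<one> * fst p x)) x"
  proof (cases "x \<in> carrier Q")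
    case True
    have "D f x = D (left_translate Q (inv x) f) \<one>"
      using lie_left[OF D _ f, of "inv x"] True by (simp add: left_translate_def)
    also have "\<dots> = D (\<Sum>p\<leftarrow>l. (\<lambda>y. fst p x * snd p y)) \<one>"
      using left_translate_tensor[OF l, of "inv x"] True by simp
    also have "\<dots> = (\<Sum>p\<leftarrow>l. D (\<lambda>y. fst p x * snd p y) \<one>)"
      using l(1) by (intro lie_sum_list_apply[OF D]) (auto intro!: coordinate_ring_scale)
    also have "\<dots> = (\<Sum>p\<leftarrow>l. fst p x * D (snd p) \<one>)"
      using l(1) by (intro arg_cong[of _ _ sum_list] map_cong refl) (auto simp: lie_scale[OF D])
    finally show ?thesis by (simp add: sum_list_fun_apply mult.commute)
  next
    case False
    have "(\<Sum>p\<leftarrow>l. D (snd p) \<one> * fst p x) = 0"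
      using l(1) False by (induction l) (auto simp: coordinate_ring_iff)
    then show ?thesis
      using False lie_closed[OF D f] by (simp add: coordinate_ring_iff sum_list_fun_apply)
  qed
qed

text \<open>The function x \<mapsto> f(x x^-1) is constant. Writing it as a sum of products u(x)
  w(x^-1) and differentiating at \<open>\<one>\<close> gives
  \<open>D f \<one> + D (antipode f) \<one> = 0\<close>.\<close>

lemma lie_antipode:
  assumes D: "D \<in> L" and f: "f \<in> A"
  shows "D (antipode f) \<one> = - D f \<one>"
proof -
  obtain l where l: "set l \<subseteq> A \<times> A"
    "\<And>x y. x \<in> carrier Q \<Longrightarrow> y \<in> carrier Q \<Longrightarrow> f (x \<otimes> y) = tensor_sum l x y"
    using comultiplication[OF f] by blast
  have lA: "fst p \<in> A" "snd p \<in> A" "antipode (snd p) \<in> A" if "p \<in> set l" for p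
    using l(1) that antipode_closed by auto
  have s1: "D (fst p) \<one> * snd p \<one> = D (\<lambda>x. snd p \<one> * fst p x) \<one>" if "p \<in> set l" for p
    by (subst lie_scale[OF D lA(1)[OF that]]) (rule mult.commute)
  have s2: "fst p \<one> * D (antipode (snd p)) \<one> = D (\<lambda>x. fst p \<one> * antipode (snd p) x) \<one>"
    if "p \<in> set l" for p
    by (subst lie_scale[OF D lA(3)[OF that]]) (rule refl)
  have f1: "f = (\<Sum>p\<leftarrow>l. (\<lambda>x. snd p \<one> * fst p x))"
    unfolding tensor_sum_right[OF l(1), symmetric] using l(2)[of _ \<one>] f
    by (auto simp: fun_eq_iff coordinate_ring_iff)
  have f2: "antipode f = (\<Sum>p\<leftarrow>l. (\<lambda>x. fst p \<one> * antipode (snd p) x))"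
  proof
    fix x
    show "antipode f x = (\<Sum>p\<leftarrow>l. (\<lambda>x. fst p \<one> * antipode (snd p) x)) x"
      using l(2)[of \<one> "inv x"] by (simp add: antipode_def sum_list_fun_apply tensor_sum_def)
  qed
  have "(\<lambda>x. if x \<in> carrier Q then f \<one> else 0) = (\<Sum>p\<leftarrow>l. fst p * antipode (snd p))"
  proof
    fix x
    show "(if x \<in> carrier Q then f \<one> else 0) = (\<Sum>p\<leftarrow>l. fst p * antipode (snd p)) x"
      using l(2)[of x "inv x"] by (simp add: antipode_def sum_list_fun_apply tensor_sum_def)
  qed
  then have "0 = D (\<Sum>p\<leftarrow>l. fst p * antipode (snd p)) \<one>"
    using lie_const[OF D, of "f \<one>"] by simp
  also have "\<dots> = (\<Sum>p\<leftarrow>l. D (fst p * antipode (snd p)) \<one>)"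
    using lA by (intro lie_sum_list_apply[OF D] coordinate_ring_mult)
  also have "\<dots> = (\<Sum>p\<leftarrow>l. D (fst p) \<one> * snd p \<one> + fst p \<one> * D (antipode (snd p)) \<one>)"
    by (intro arg_cong[of _ _ sum_list] map_cong refl)
      (simp add: lie_mult[OF D] lA antipode_one)
  also have "\<dots> = (\<Sum>p\<leftarrow>l. D (\<lambda>x. snd p \<one> * fst p x) \<one>) + (\<Sum>p\<leftarrow>l. D (\<lambda>x. fst p \<one> * antipode (snd p) x) \<one>)"
    unfolding sum_list_addf
    by (intro arg_cong2[of _ _ _ _ "(+)"] arg_cong[of _ _ sum_list] map_cong refl s1 s2)
  also have "\<dots> = D (\<Sum>p\<leftarrow>l. (\<lambda>x. snd p \<one> * fst p x)) \<one> +
      D (\<Sum>p\<leftarrow>l. (\<lambda>x. fst p \<one> * antipode (snd p) x)) \<one>"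
    by (intro arg_cong2[of _ _ _ _ "(+)"] lie_sum_list_apply[OF D, symmetric] coordinate_ring_scale lA)
  also have "\<dots> = D f \<one> + D (antipode f) \<one>"
    unfolding f1[symmetric] f2[symmetric] ..
  finally show ?thesis by (metis add_eq_0_iff)
qed

text \<open>If \<open>f (x y) = \<Sum> u x * w y\<close>, then \<open>c g = \<Sum> w (g\<^sup>-\<^sup>1) * (\<xi> u) g\<close>.\<close>

lemma Ad_coefficient:
  assumes f: "f \<in> A" and \<xi>: "\<xi> \<in> L"
  defines "c \<equiv> \<lambda>g. if g \<in> carrier Q then Ad Q g \<xi> f \<one> else 0"
  shows "c \<in> A" and "D \<in> L \<Longrightarrow> D c \<one> = lie_bracket D \<xi> f \<one>"
proof -
  obtain l where l: "set l \<subseteq> A \<times> A"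
    "\<And>x y. x \<in> carrier Q \<Longrightarrow> y \<in> carrier Q \<Longrightarrow> f (x \<otimes> y) = tensor_sum l x y"
    using comultiplication[OF f] by blast
  have lA: "fst p \<in> A" "snd p \<in> A" "antipode (snd p) \<in> A" "\<xi> (fst p) \<in> A" if "p \<in> set l" for p
    using l(1) that antipode_closed lie_closed[OF \<xi>] by auto
  have c: "c = (\<Sum>p\<leftarrow>l. antipode (snd p) * \<xi> (fst p))"
  proof
    fix g
    show "c g = (\<Sum>p\<leftarrow>l. antipode (snd p) * \<xi> (fst p)) g"
    proof (cases "g \<in> carrier Q")
      case True
      \<comment> \<open>The outer right translation by \<open>g\<close>, evaluated at
        \<open>\<one>\<close>, is evaluation at \<open>g\<close>; only the inner translation has to
        be expanded.\<close>
      then have "c g = \<xi> (right_translate Q (inv g) f) g"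
        using f by (simp add: c_def Ad_def right_translate_def)
      also have "\<dots> = \<xi> (\<Sum>p\<leftarrow>l. (\<lambda>x. snd p (inv g) * fst p x)) g"
        using right_translate_tensor[OF l, of "inv g"] True by simp
      also have "\<dots> = (\<Sum>p\<leftarrow>l. \<xi> (\<lambda>x. snd p (inv g) * fst p x) g)"
        using lA by (intro lie_sum_list_apply[OF \<xi>] coordinate_ring_scale)
      also have "\<dots> = (\<Sum>p\<leftarrow>l. snd p (inv g) * \<xi> (fst p) g)"
        by (intro arg_cong[of _ _ sum_list] map_cong refl) (simp add: lie_scale[OF \<xi>] lA)
      finally show ?thesis using True by (simp add: sum_list_fun_apply antipode_def)
    qed (simp add: c_def sum_list_fun_apply antipode_def)
  qed
  then show "c \<in> A" using lA by (simp add: coordinate_ring_sum_list coordinate_ring_mult)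
  assume D: "D \<in> L"
  have f1: "f = (\<Sum>p\<leftarrow>l. (\<lambda>x. snd p \<one> * fst p x))"
    unfolding tensor_sum_right[OF l(1), symmetric] using l(2)[of _ \<one>] f
    by (auto simp: fun_eq_iff coordinate_ring_iff)
  have "D c \<one> = (\<Sum>p\<leftarrow>l. D (antipode (snd p) * \<xi> (fst p)) \<one>)"
    unfolding c using lA by (intro lie_sum_list_apply[OF D] coordinate_ring_mult)
  also have "\<dots> = (\<Sum>p\<leftarrow>l. D (antipode (snd p)) \<one> * \<xi> (fst p) \<one> + snd p \<one> * D (\<xi> (fst p)) \<one>)"
    by (intro arg_cong[of _ _ sum_list] map_cong refl)
      (simp add: lie_mult[OF D] lA antipode_one)
  \<comment> \<open>The minus sign from the antipode produces the commutator. The first sum is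
    \<open>\<xi> f\<close> under \<open>D\<close>, since f is the sum of w(1) u; the second is
    \<open>D f\<close> under \<open>\<xi>\<close>, since \<open>D f\<close> is the sum of (D w)(1) u
    by left invariance.\<close>
  also have "\<dots> = (\<Sum>p\<leftarrow>l. snd p \<one> * D (\<xi> (fst p)) \<one>) - (\<Sum>p\<leftarrow>l. D (snd p) \<one> * \<xi> (fst p) \<one>)"
    unfolding sum_list_subtractf[symmetric]
    by (intro arg_cong[of _ _ sum_list] map_cong refl) (simp add: lie_antipode[OF D] lA)
  also have "(\<Sum>p\<leftarrow>l. snd p \<one> * D (\<xi> (fst p)) \<one>) = D (\<xi> f) \<one>"
  proof -
    have "\<xi> f = \<xi> (\<Sum>p\<leftarrow>l. (\<lambda>x. snd p \<one> * fst p x))" using f1 by simp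
    also have "\<dots> = (\<Sum>p\<leftarrow>l. \<xi> (\<lambda>x. snd p \<one> * fst p x))"
      by (intro lie_sum_list[OF \<xi>] coordinate_ring_scale lA)
    also have "\<dots> = (\<Sum>p\<leftarrow>l. (\<lambda>x. snd p \<one> * \<xi> (fst p) x))"
      by (intro arg_cong[of _ _ sum_list] map_cong refl) (simp add: lie_scale[OF \<xi>] lA)
    finally have "D (\<xi> f) \<one> = D (\<Sum>p\<leftarrow>l. (\<lambda>x. snd p \<one> * \<xi> (fst p) x)) \<one>" by simp
    also have "\<dots> = (\<Sum>p\<leftarrow>l. D (\<lambda>x. snd p \<one> * \<xi> (fst p) x) \<one>)"
      by (intro lie_sum_list_apply[OF D] coordinate_ring_scale lA)
    also have "\<dots> = (\<Sum>p\<leftarrow>l. snd p \<one> * D (\<xi> (fst p)) \<one>)"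
      by (intro arg_cong[of _ _ sum_list] map_cong refl) (simp add: lie_scale[OF D] lA)
    finally show ?thesis by simp
  qed
  also have "(\<Sum>p\<leftarrow>l. D (snd p) \<one> * \<xi> (fst p) \<one>) = \<xi> (D f) \<one>"
  proof -
    have "\<xi> (D f) \<one> = \<xi> (\<Sum>p\<leftarrow>l. (\<lambda>x. D (snd p) \<one> * fst p x)) \<one>"
      by (subst lie_apply_tensor[OF D f l]) simp_all
    also have "\<dots> = (\<Sum>p\<leftarrow>l. \<xi> (\<lambda>x. D (snd p) \<one> * fst p x) \<one>)"
      by (intro lie_sum_list_apply[OF \<xi>] coordinate_ring_scale lA)
    also have "\<dots> = (\<Sum>p\<leftarrow>l. D (snd p) \<one> * \<xi> (fst p) \<one>)"
      by (intro arg_cong[of _ _ sum_list] map_cong refl) (simp add: lie_scale[OF \<xi>] lA)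
    finally show ?thesis by simp
  qed
  finally show "D c \<one> = lie_bracket D \<xi> f \<one>" by (simp add: lie_bracket_def)
qed

section \<open>Adjoint action and Lie bracket\<close>

lemma right_translate_simps:
  assumes "g \<in> carrier Q"
  shows "right_translate Q g (f + f') = right_translate Q g f + right_translate Q g f'"
    and "right_translate Q g (f * f') = right_translate Q g f * right_translate Q g f'"
    and "right_translate Q g (\<lambda>x. c * f x) = (\<lambda>x. c * right_translate Q g f x)"
    and "h \<in> carrier Q \<Longrightarrow> right_translate Q g (right_translate Q h f) = right_translate Q (g \<otimes> h) f"
    and "f \<in> A \<Longrightarrow> right_translate Q \<one> f = f"
    and "h \<in> carrier Q \<Longrightarrow> right_translate Q g (left_translate Q h f) = left_translate Q h (right_translate Q g f)"
    and "right_translate Q g 0 = 0"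
  using assms
  by (auto simp: right_translate_def left_translate_def fun_eq_iff m_assoc coordinate_ring_iff)

text \<open>Conjugation by an algebra automorphism preserves derivations, and left invariance
  survives because left and right translations commute.\<close>

lemma Ad_closed:
  assumes g: "g \<in> carrier Q" and D: "D \<in> L"
  shows "Ad Q g D \<in> L"
proof (rule lie_algebraI)
  note [simp] = right_translate_simps[OF g] right_translate_simps[OF inv_closed[OF g]]
    translate_closed g D coordinate_ring_closed lie_closed[OF D]
  show "Ad Q g D f \<in> A" if "f \<in> A" for f using that by (simp add: Ad_def)
  show "Ad Q g D f = 0" if "f \<notin> A" for f using that by (simp add: Ad_def)
  show "Ad Q g D (f + f') = Ad Q g D f + Ad Q g D f'" if "f \<in> A" "f' \<in> A" for f f'
    using that by (simp add: Ad_def lie_add[OF D])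
  show "Ad Q g D (\<lambda>x. c * f x) = (\<lambda>x. c * Ad Q g D f x)" if "f \<in> A" for c f
    using that by (simp add: Ad_def lie_scale[OF D])
  show "Ad Q g D (f * f') = Ad Q g D f * f' + f * Ad Q g D f'" if "f \<in> A" "f' \<in> A" for f f'
    using that by (simp add: Ad_def lie_mult[OF D])
  show "Ad Q g D (left_translate Q x f) = left_translate Q x (Ad Q g D f)"
    if "x \<in> carrier Q" "f \<in> A" for x f
    using that by (simp add: Ad_def lie_left[OF D])
qed

lemma Ad_Ad:
  assumes "g \<in> carrier Q" "h \<in> carrier Q"
  shows "Ad Q g (Ad Q h D) = Ad Q (g \<otimes> h) D"
  using assms by (auto simp: Ad_def fun_eq_iff right_translate_simps translate_closed inv_mult_group)

lemma Ad_one: "D \<in> L \<Longrightarrow> Ad Q \<one> D = D"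
  unfolding Ad_def inv_one
  by (rule ext) (simp add: right_translate_simps(5)[OF one_closed] lie_mem(1,2) zero_fun_def[symmetric])

lemma Ad_linear:
  "g \<in> carrier Q \<Longrightarrow> Ad Q g (D + E) = Ad Q g D + Ad Q g E"
  "Ad Q g (op_scale c D) = op_scale c (Ad Q g D)"
  by (auto simp: Ad_def fun_eq_iff right_translate_def op_scale_def)

lemma lie_bracket_Ad:
  assumes "g \<in> carrier Q" "D \<in> L" "E \<in> L"
  shows "lie_bracket (Ad Q g D) (Ad Q g E) = Ad Q g (lie_bracket D E)"
proof -
  have "right_translate Q g (u - v) = right_translate Q g u - right_translate Q g v" for u v
    by (simp add: right_translate_def fun_eq_iff)
  then show ?thesis
    using assms lie_zero[OF Ad_closed[OF assms(1,2)]] lie_zero[OF Ad_closed[OF assms(1,3)]]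
    by (auto simp: lie_bracket_def Ad_def fun_eq_iff right_translate_simps translate_closed lie_closed)
qed

lemma lie_bracket_closed:
  assumes D: "D \<in> L" and E: "E \<in> L"
  shows "lie_bracket D E \<in> L"
proof (rule lie_algebraI)
  note [simp] = coordinate_ring_closed lie_closed[OF D] lie_closed[OF E]
  show "lie_bracket D E f \<in> A" if "f \<in> A" for f
    using that lie_diff(2)[OF D] by (simp add: lie_bracket_def)
  show "lie_bracket D E f = 0" if "f \<notin> A" for f
    using that by (simp only: lie_bracket_def lie_outside[OF D] lie_outside[OF E]
        lie_zero[OF D] lie_zero[OF E] not_False_eq_True diff_self)
  show "lie_bracket D E (f + f') = lie_bracket D E f + lie_bracket D E f'" if "f \<in> A" "f' \<in> A" for f f'
    using that by (simp add: lie_bracket_def lie_add[OF D] lie_add[OF E])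
  show "lie_bracket D E (\<lambda>x. c * f x) = (\<lambda>x. c * lie_bracket D E f x)" if "f \<in> A" for c f
    using that
    by (simp add: lie_bracket_def lie_scale[OF D] lie_scale[OF E] fun_eq_iff right_diff_distrib)
  show "lie_bracket D E (f * f') = lie_bracket D E f * f' + f * lie_bracket D E f'"
    if "f \<in> A" "f' \<in> A" for f f'
    using that
    by (simp add: lie_bracket_def lie_mult[OF D] lie_mult[OF E] lie_add[OF D] lie_add[OF E]
        algebra_simps)
  show "lie_bracket D E (left_translate Q x f) = left_translate Q x (lie_bracket D E f)"
    if "x \<in> carrier Q" "f \<in> A" for x f
    using that
    by (simp add: lie_bracket_def lie_left[OF D] lie_left[OF E])
      (simp add: left_translate_def fun_eq_iff)
qed

lemma lie_subspace:
  "0 \<in> L" "D \<in> L \<Longrightarrow> E \<in> L \<Longrightarrow> D + E \<in> L" "D \<in> L \<Longrightarrow> op_scale c D \<in> L"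
proof -
  show "0 \<in> L"
    by (rule lie_algebraI) (auto simp: coordinate_ring_zero left_translate_def fun_eq_iff)
  show "D + E \<in> L" if D: "D \<in> L" and E: "E \<in> L"
  proof (rule lie_algebraI)
    show "(D + E) (left_translate Q x f) = left_translate Q x ((D + E) f)"
      if "x \<in> carrier Q" "f \<in> A" for x f
      using that by (simp add: lie_left[OF D] lie_left[OF E]) (simp add: left_translate_def fun_eq_iff)
  qed (simp_all add: lie_mem[OF D] lie_mem[OF E] coordinate_ring_closed algebra_simps fun_eq_iff)
  show "op_scale c D \<in> L" if D: "D \<in> L"
  proof (rule lie_algebraI)
    show "op_scale c D (left_translate Q x f) = left_translate Q x (op_scale c D f)"
      if "x \<in> carrier Q" "f \<in> A" for x f
      using that by (simp add: op_scale_def lie_left[OF D]) (simp add: left_translate_def fun_eq_iff)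
  qed (simp_all add: op_scale_def lie_mem[OF D] coordinate_ring_closed algebra_simps fun_eq_iff)
qed

lemma lie_bracket_antisym: "lie_bracket D E = - lie_bracket E D"
  by (simp add: lie_bracket_def fun_eq_iff)

lemma lie_bracket_add_right:
  assumes "D \<in> L" "E \<in> L" "E' \<in> L"
  shows "lie_bracket D (E + E') = lie_bracket D E + lie_bracket D E'"
proof
  fix f
  show "lie_bracket D (E + E') f = (lie_bracket D E + lie_bracket D E') f"
  proof (cases "f \<in> A")
    case True
    show ?thesis
      unfolding lie_bracket_def plus_fun_apply lie_add[OF assms(1) lie_closed[OF assms(2) True]
        lie_closed[OF assms(3) True]] by (simp add: fun_eq_iff)
  next
    case False
    show ?thesis
      unfolding lie_bracket_def plus_fun_apply lie_outside[OF assms(1) False]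
        lie_outside[OF assms(2) False] lie_outside[OF assms(3) False] add_0_left
        lie_zero[OF assms(1)] lie_zero[OF assms(2)] lie_zero[OF assms(3)] by (simp add: fun_eq_iff)
  qed
qed

lemma lie_bracket_scale_right:
  assumes "D \<in> L" "E \<in> L"
  shows "lie_bracket D (op_scale c E) = op_scale c (lie_bracket D E)"
proof
  fix f
  show "lie_bracket D (op_scale c E) f = op_scale c (lie_bracket D E) f"
  proof (cases "f \<in> A")
    case True
    show ?thesis
      unfolding lie_bracket_def op_scale_def lie_scale[OF assms(1) lie_closed[OF assms(2) True]]
      by (simp add: fun_eq_iff right_diff_distrib)
  next
    case False
    have z: "(\<lambda>x. c * (0 :: 'k ^ 'n \<Rightarrow> 'k) x) = 0" by (rule ext) simp
    show ?thesis
      unfolding lie_bracket_def op_scale_def lie_outside[OF assms(1) False]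
        lie_outside[OF assms(2) False] z lie_zero[OF assms(1)] lie_zero[OF assms(2)] diff_self ..
  qed
qed

end

section \<open>Nondegeneracy of contact forms\<close>

text \<open>Arguments are infinite sequences, so the first clause says that only the first
  \<open>p\<close> entries count. Linearity is restricted to \<open>W\<close> because linear forms
  are extended by zero outside it.\<close>

definition multilinear_on ::
    "('k::field \<Rightarrow> 'v::ab_group_add \<Rightarrow> 'v) \<Rightarrow> 'v set \<Rightarrow> nat \<Rightarrow> ((nat \<Rightarrow> 'v) \<Rightarrow> 'k) \<Rightarrow> bool" where
  "multilinear_on sc W p \<omega> \<longleftrightarrow>
    (\<forall>v v'. (\<forall>i<p. v i = v' i) \<longrightarrow> \<omega> v = \<omega> v') \<and>
    (\<forall>v j x y a. j < p \<longrightarrow> (\<forall>i<p. v i \<in> W) \<longrightarrow> x \<in> W \<longrightarrow> y \<in> W \<longrightarrow>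
      \<omega> (v(j := x + y)) = \<omega> (v(j := x)) + \<omega> (v(j := y)) \<and> \<omega> (v(j := sc a x)) = a * \<omega> (v(j := x)))"

text \<open>Vanishing of the interior product with \<open>\<eta>\<close>, stated for every slot
  since alternation of \<open>\<omega>\<close> is not assumed.\<close>

definition annihilated_by :: "'v \<Rightarrow> 'v set \<Rightarrow> nat \<Rightarrow> ((nat \<Rightarrow> 'v) \<Rightarrow> 'k::zero) \<Rightarrow> bool" where
  "annihilated_by \<eta> W p \<omega> \<longleftrightarrow> (\<forall>v j. j < p \<longrightarrow> (\<forall>i<p. v i \<in> W) \<longrightarrow> v j = \<eta> \<longrightarrow> \<omega> v = 0)"

lemma multilinear_on_cong:
  "multilinear_on sc W p \<omega> \<Longrightarrow> (\<And>i. i < p \<Longrightarrow> v i = v' i) \<Longrightarrow> \<omega> v = \<omega> v'"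
  unfolding multilinear_on_def by blast

text \<open>Entry \<open>\<sigma> k\<close> of the sequence is read by exactly one of the two
  factors: by the first at slot \<open>k\<close> if \<open>k < p\<close>, otherwise by the second at
  slot \<open>k - p\<close>.\<close>

lemma wedge_term_update:
  fixes v :: "nat \<Rightarrow> 'v::ab_group_add"
  assumes \<omega>: "multilinear_on sc W p \<omega>" and \<omega>': "multilinear_on sc W q \<omega>'"
    and \<sigma>: "\<sigma> permutes {..<p + q}" and k: "k < p + q"
  shows "k < p \<Longrightarrow> \<omega> (\<lambda>i. (v(\<sigma> k := x)) (\<sigma> i)) * \<omega>' (\<lambda>i. (v(\<sigma> k := x)) (\<sigma> (p + i)))
      = \<omega> ((\<lambda>i. v (\<sigma> i))(k := x)) * \<omega>' (\<lambda>i. v (\<sigma> (p + i)))"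
    and "\<not> k < p \<Longrightarrow> \<omega> (\<lambda>i. (v(\<sigma> k := x)) (\<sigma> i)) * \<omega>' (\<lambda>i. (v(\<sigma> k := x)) (\<sigma> (p + i)))
      = \<omega> (\<lambda>i. v (\<sigma> i)) * \<omega>' ((\<lambda>i. v (\<sigma> (p + i)))(k - p := x))"
proof -
  have inj: "\<sigma> i = \<sigma> i' \<longleftrightarrow> i = i'" for i i'
    using permutes_inj[OF \<sigma>] by (auto dest: injD)
  have 1: "(\<lambda>i. (v(\<sigma> k := x)) (\<sigma> i)) = (\<lambda>i. v (\<sigma> i))(k := x)"
    by (auto simp: inj)
  show "k < p \<Longrightarrow> \<omega> (\<lambda>i. (v(\<sigma> k := x)) (\<sigma> i)) * \<omega>' (\<lambda>i. (v(\<sigma> k := x)) (\<sigma> (p + i)))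
      = \<omega> ((\<lambda>i. v (\<sigma> i))(k := x)) * \<omega>' (\<lambda>i. v (\<sigma> (p + i)))"
    unfolding 1 by (intro arg_cong2[of _ _ _ _ "(*)"] refl multilinear_on_cong[OF \<omega>']) (auto simp: inj)
  assume "\<not> k < p"
  then have "(\<lambda>i. (v(\<sigma> k := x)) (\<sigma> (p + i))) = (\<lambda>i. v (\<sigma> (p + i)))(k - p := x)"
    by (auto simp: inj fun_eq_iff)
  then show "\<omega> (\<lambda>i. (v(\<sigma> k := x)) (\<sigma> i)) * \<omega>' (\<lambda>i. (v(\<sigma> k := x)) (\<sigma> (p + i)))
      = \<omega> (\<lambda>i. v (\<sigma> i)) * \<omega>' ((\<lambda>i. v (\<sigma> (p + i)))(k - p := x))"
    using \<open>\<not> k < p\<close>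
    by (intro arg_cong2[of _ _ _ _ "(*)"] multilinear_on_cong[OF \<omega>]) (auto simp: inj)
qed

lemma permutes_lessThan_less: "\<sigma> permutes {..<n::nat} \<Longrightarrow> i < n \<Longrightarrow> \<sigma> i < n"
  using permutes_in_image[of \<sigma> "{..<n}" i] by simp

lemma wedge_multilinear_on:
  fixes \<omega> \<omega>' :: "(nat \<Rightarrow> 'v::ab_group_add) \<Rightarrow> 'k::field_char_0"
  assumes \<omega>: "multilinear_on sc W p \<omega>" and \<omega>': "multilinear_on sc W q \<omega>'"
  shows "multilinear_on sc W (p + q) (wedge p q \<omega> \<omega>')"
proof -
  define P where "P = {\<sigma>. \<sigma> permutes {..<p + q}}"
  define T where "T \<sigma> v = \<omega> (\<lambda>i. v (\<sigma> i)) * \<omega>' (\<lambda>i. v (\<sigma> (p + i)))" for \<sigma> and v :: "nat \<Rightarrow> 'v"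
  have wedge: "wedge p q \<omega> \<omega>' v = (\<Sum>\<sigma>\<in>P. of_int (sign \<sigma>) * T \<sigma> v) / (fact p * fact q)" for v
    by (simp add: wedge_def P_def T_def mult.assoc)
  have cong: "T \<sigma> v = T \<sigma> v'" if "\<sigma> \<in> P" "\<forall>i<p + q. v i = v' i" for \<sigma> v v'
    unfolding T_def using that permutes_lessThan_less[of \<sigma> "p + q"]
    by (intro arg_cong2[of _ _ _ _ "(*)"] multilinear_on_cong[OF \<omega>] multilinear_on_cong[OF \<omega>'])
      (auto simp: P_def)
  have lin: "T \<sigma> (v(j := x + y)) = T \<sigma> (v(j := x)) + T \<sigma> (v(j := y)) \<and>
      T \<sigma> (v(j := sc a x)) = a * T \<sigma> (v(j := x))"
    if \<sigma>P: "\<sigma> \<in> P" and v: "j < p + q" "\<forall>i<p + q. v i \<in> W" "x \<in> W" "y \<in> W" for \<sigma> v j x y a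
  proof -
    have \<sigma>: "\<sigma> permutes {..<p + q}" using \<sigma>P by (simp add: P_def)
    obtain k where k: "k < p + q" "j = \<sigma> k"
      using permutes_image[OF \<sigma>] v(1) by (metis imageE lessThan_iff)
    have W: "v (\<sigma> i) \<in> W" if "i < p + q" for i
      using v(2) permutes_lessThan_less[OF \<sigma> that] by simp
    note upd = wedge_term_update[OF \<omega> \<omega>' \<sigma> k(1)]
    show ?thesis
    proof (cases "k < p")
      case True
      have "\<omega> ((\<lambda>i. v (\<sigma> i))(k := x + y)) = \<omega> ((\<lambda>i. v (\<sigma> i))(k := x)) + \<omega> ((\<lambda>i. v (\<sigma> i))(k := y)) \<and>
        \<omega> ((\<lambda>i. v (\<sigma> i))(k := sc a x)) = a * \<omega> ((\<lambda>i. v (\<sigma> i))(k := x))"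
        using \<omega> True W v unfolding multilinear_on_def by simp
      then show ?thesis unfolding T_def k(2) upd(1)[OF True] by (simp add: algebra_simps)
    next
      case False
      have "k - p < q" using False k(1) by simp
      then have "\<omega>' ((\<lambda>i. v (\<sigma> (p + i)))(k - p := x + y)) =
          \<omega>' ((\<lambda>i. v (\<sigma> (p + i)))(k - p := x)) + \<omega>' ((\<lambda>i. v (\<sigma> (p + i)))(k - p := y)) \<and>
        \<omega>' ((\<lambda>i. v (\<sigma> (p + i)))(k - p := sc a x)) = a * \<omega>' ((\<lambda>i. v (\<sigma> (p + i)))(k - p := x))"
        using \<omega>' W v unfolding multilinear_on_def by simp
      then show ?thesis unfolding T_def k(2) upd(2)[OF False] by (simp add: algebra_simps)
    qed
  qed
  show ?thesis
    unfolding multilinear_on_def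
  proof (intro conjI allI impI)
    fix v v' :: "nat \<Rightarrow> 'v"
    assume "\<forall>i<p + q. v i = v' i"
    then show "wedge p q \<omega> \<omega>' v = wedge p q \<omega> \<omega>' v'"
      unfolding wedge by (intro arg_cong2[of _ _ _ _ "(/)"] sum.cong refl) (simp add: cong)
  next
    fix v j x y and a :: 'k
    assume v: "j < p + q" "\<forall>i<p + q. v i \<in> W" "x \<in> W" "y \<in> W"
    note L = lin[OF _ v]
    show "wedge p q \<omega> \<omega>' (v(j := x + y)) = wedge p q \<omega> \<omega>' (v(j := x)) + wedge p q \<omega> \<omega>' (v(j := y))"
      unfolding wedge add_divide_distrib[symmetric] sum.distrib[symmetric]
      by (intro arg_cong2[of _ _ _ _ "(/)"] sum.cong refl) (simp add: L distrib_left)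
    show "wedge p q \<omega> \<omega>' (v(j := sc a x)) = a * wedge p q \<omega> \<omega>' (v(j := x))"
      unfolding wedge times_divide_eq_right sum_distrib_left
      by (intro arg_cong2[of _ _ _ _ "(/)"] sum.cong refl) (simp add: L)
  qed
qed

text \<open>In every summand \<open>\<eta>\<close> lands in a slot of one of the two factors, which
  then vanishes.\<close>

lemma wedge_annihilated_by:
  fixes \<omega> \<omega>' :: "(nat \<Rightarrow> 'v) \<Rightarrow> 'k::field_char_0"
  assumes \<omega>: "annihilated_by \<eta> W p \<omega>" and \<omega>': "annihilated_by \<eta> W q \<omega>'"
  shows "annihilated_by \<eta> W (p + q) (wedge p q \<omega> \<omega>')"
  unfolding annihilated_by_def
proof (intro allI impI)
  fix v j assume v: "j < p + q" "\<forall>i<p + q. v i \<in> W" "v j = \<eta>"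
  have "\<omega> (\<lambda>i. v (\<sigma> i)) * \<omega>' (\<lambda>i. v (\<sigma> (p + i))) = 0" if \<sigma>: "\<sigma> permutes {..<p + q}" for \<sigma>
  proof -
    obtain k where k: "k < p + q" "j = \<sigma> k"
      using permutes_image[OF \<sigma>] v(1) by (metis imageE lessThan_iff)
    have W: "v (\<sigma> i) \<in> W" if "i < p + q" for i
      using v(2) permutes_lessThan_less[OF \<sigma> that] by simp
    show ?thesis
    proof (cases "k < p")
      case True
      have "\<omega> (\<lambda>i. v (\<sigma> i)) = 0"
        using \<omega>[unfolded annihilated_by_def, rule_format, of k "\<lambda>i. v (\<sigma> i)"] True k v W by simp
      then show ?thesis by simp
    next
      case False
      have "\<omega>' (\<lambda>i. v (\<sigma> (p + i))) = 0"
        using \<omega>'[unfolded annihilated_by_def, rule_format, of "k - p" "\<lambda>i. v (\<sigma> (p + i))"]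
          False k v W by simp
      then show ?thesis by simp
    qed
  qed
  then have "(\<Sum>\<sigma> | \<sigma> permutes {..<p + q}. of_int (sign \<sigma>) * \<omega> (\<lambda>i. v (\<sigma> i)) *
      \<omega>' (\<lambda>i. v (\<sigma> (p + i)))) = 0"
    by (intro sum.neutral) (simp add: mult.assoc)
  then show "wedge p q \<omega> \<omega>' v = 0" by (simp add: wedge_def)
qed

text \<open>Composing with the transposition of \<open>a\<close> and \<open>b\<close> permutes the
  summands and changes only their sign, so the sum equals its negative and is zero in characteristic
  zero. Antisymmetrisation alone is responsible; the factors may be arbitrary.\<close>

lemma wedge_alternating:
  fixes \<omega> \<omega>' :: "(nat \<Rightarrow> 'v) \<Rightarrow> 'k::field_char_0"
  assumes ab: "a < p + q" "b < p + q" "a \<noteq> b" and v: "v a = v b"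
  shows "wedge p q \<omega> \<omega>' v = 0"
proof -
  define T where
    "T \<sigma> = of_int (sign \<sigma>) * \<omega> (\<lambda>i. v (\<sigma> i)) * \<omega>' (\<lambda>i. v (\<sigma> (p + i)))" for \<sigma>
  define \<tau> where "\<tau> = Transposition.transpose a b"
  have \<tau>: "\<tau> permutes {..<p + q}" unfolding \<tau>_def using ab by (intro permutes_swap_id) auto
  have v\<tau>: "v (\<tau> i) = v i" for i using v by (simp add: \<tau>_def Transposition.transpose_def)
  have neg: "T (\<tau> \<circ> \<sigma>) = - T \<sigma>" if "\<sigma> permutes {..<p + q}" for \<sigma>
  proof -
    have "sign (\<tau> \<circ> \<sigma>) = - sign \<sigma>"
      using that \<tau> ab(3) by (subst sign_compose)
        (auto simp: \<tau>_def sign_swap_id intro: permutation_permutes[THEN iffD2])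
    then show ?thesis by (simp add: T_def v\<tau>)
  qed
  have "(\<Sum>\<sigma> | \<sigma> permutes {..<p + q}. T \<sigma>) = (\<Sum>\<sigma> | \<sigma> permutes {..<p + q}. T (\<tau> \<circ> \<sigma>))"
    by (rule setum_permutations_compose_left[OF \<tau>])
  also have "\<dots> = - (\<Sum>\<sigma> | \<sigma> permutes {..<p + q}. T \<sigma>)"
    by (simp add: neg sum_negf)
  finally have "(\<Sum>\<sigma> | \<sigma> permutes {..<p + q}. T \<sigma>) = 0" by simp
  then show ?thesis by (simp add: wedge_def T_def)
qed

section \<open>Top-degree forms and the contact condition\<close>

text \<open>If \<open>\<Omega> v \<noteq> 0\<close>, then \<open>v\<close> spans \<open>W\<close>, and a nonzero \<open>\<eta>\<close> can replace one of the \<open>v i\<close> without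
  changing the span of the family, hence without making \<open>\<Omega>\<close> vanish.\<close>

lemma top_form_annihilated_by:
  fixes sc :: "'k::field \<Rightarrow> 'v::ab_group_add \<Rightarrow> 'v"
  assumes vs: "vector_space sc" and W: "module.subspace sc W"
    and dim: "vector_space.dim sc W = N" "N > 0"
    and lin: "multilinear_on sc W N \<Omega>"
    and alt: "\<And>v a b. a < N \<Longrightarrow> b < N \<Longrightarrow> a \<noteq> b \<Longrightarrow> v a = v b \<Longrightarrow> \<Omega> v = 0"
    and ann: "annihilated_by \<eta> W N \<Omega>" and \<eta>: "\<eta> \<in> W"
    and v: "\<forall>i<N. v i \<in> W" "\<Omega> v \<noteq> 0"
  shows "\<eta> = 0"
proof (rule ccontr)
  assume "\<eta> \<noteq> 0"
  interpret vector_space sc by fact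
  \<comment> \<open>By linearity in slot \<open>j\<close> it suffices to insert
    \<open>\<eta>\<close>, which annihilates \<open>\<Omega>\<close>, or another entry of
    \<open>v\<close>, which creates a repetition.\<close>
  have vanish: "\<Omega> (v(j := x)) = 0"
    if j: "j < N" and x: "x \<in> span (insert \<eta> (v ` ({..<N} - {j})))" for j x
  proof -
    have "x \<in> W \<and> \<Omega> (v(j := x)) = 0"
      using x
    proof (induction rule: span_induct_alt)
      case base
      have "\<Omega> (v(j := sc 0 0)) = 0"
        using lin j v(1) subspace_0[OF W] unfolding multilinear_on_def by (metis mult_zero_left)
      then show ?case using subspace_0[OF W] by (metis scale_zero_left)
    next
      case (step c x y)
      have xW: "x \<in> W" and x0: "\<Omega> (v(j := x)) = 0"
      proof -
        show "x \<in> W" using step(1) \<eta> v(1) by auto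
        show "\<Omega> (v(j := x)) = 0"
        proof (cases "x = \<eta>")
          case True
          then show ?thesis
            using ann j v(1) \<eta> unfolding annihilated_by_def
            by (metis fun_upd_apply)
        next
          case False
          then obtain i where "i < N" "i \<noteq> j" "x = v i" using step(1) by auto
          then show ?thesis using alt[of i j "v(j := x)"] j by simp
        qed
      qed
      have cW: "sc c x \<in> W" using W xW by (rule subspace_scale)
      have "\<Omega> (v(j := sc c x + y)) = c * \<Omega> (v(j := x)) + \<Omega> (v(j := y))"
        using lin j v(1) xW cW step unfolding multilinear_on_def by metis
      then have "\<Omega> (v(j := sc c x + y)) = 0" using step x0 by simp
      then show ?case using step cW subspace_add[OF W] by blast
    qed
    then show ?thesis by blast
  qed
  have notin: "v j \<notin> span (insert \<eta> (v ` ({..<N} - {j})))" if "j < N" for j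
    using vanish[OF that, of "v j"] v(2) by auto
  have notin': "v j \<notin> span (v ` ({..<N} - {j}))" if "j < N" for j
    using notin[OF that] span_mono[of "v ` ({..<N} - {j})" "insert \<eta> (v ` ({..<N} - {j}))"] by blast
  have inj: "inj_on v {..<N}"
  proof (rule inj_onI)
    fix i j assume "i \<in> {..<N}" "j \<in> {..<N}" "v i = v j"
    then show "i = j"
      using notin'[of j] span_base[of "v j" "v ` ({..<N} - {j})"]
      by (metis DiffI image_eqI lessThan_iff singletonD)
  qed
  have indep: "independent (v ` {..<N})"
    unfolding dependent_def
  proof clarify
    fix j assume j: "j < N" and "v j \<in> span (v ` {..<N} - {v j})"
    then show False
      using notin'[OF j] span_mono[of "v ` {..<N} - {v j}" "v ` ({..<N} - {j})"] by blast
  qed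
  obtain C where C: "C \<subseteq> W" "independent C" "W \<subseteq> span C" "card C = N"
    using basis_exists[of W] dim by auto
  \<comment> \<open>Infinite sets have cardinality 0 by convention, so positive dimension yields
    finiteness of the basis.\<close>
  have "finite C" using C(4) dim(2) card_ge_0_finite by blast
  have "\<eta> \<in> span (v ` {..<N})"
  proof (rule ccontr)
    assume no: "\<eta> \<notin> span (v ` {..<N})"
    have notin_image: "\<eta> \<notin> v ` {..<N}" using no span_base[of \<eta> "v ` {..<N}"] by fastforce
    have "independent (insert \<eta> (v ` {..<N}))"
      using no indep by (simp add: independent_insert)
    moreover have "insert \<eta> (v ` {..<N}) \<subseteq> span C" using \<eta> v(1) C(3) by auto
    ultimately have "card (insert \<eta> (v ` {..<N})) \<le> card C"
      by (rule conjunct2[OF independent_span_bound[OF \<open>finite C\<close>]])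
    then show False using notin_image C(4) by (simp add: card_image[OF inj])
  qed
  \<comment> \<open>With \<open>S\<close> a smallest index set whose vectors span
    \<open>\<eta>\<close>, the exchange lemma puts \<open>v j\<close>, for \<open>j\<close> in
    \<open>S\<close>, into the span of \<open>\<eta>\<close> and the other vectors, contradicting
    \<open>notin\<close>.\<close>
  define P where "P S \<longleftrightarrow> S \<subseteq> {..<N} \<and> \<eta> \<in> span (v ` S)" for S
  have "P {..<N}" using \<open>\<eta> \<in> span (v ` {..<N})\<close> by (simp add: P_def)
  then obtain S where S: "P S" and S_min: "\<And>S'. P S' \<Longrightarrow> card S \<le> card S'"
    using ex_has_least_nat[of P "{..<N}" card] by auto
  have finS: "finite S" using S finite_subset by (auto simp: P_def)
  have "S \<noteq> {}" using S \<open>\<eta> \<noteq> 0\<close> by (auto simp: P_def)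
  then obtain j where j: "j \<in> S" by blast
  have jN: "j < N" using S j by (auto simp: P_def)
  have "\<not> P (S - {j})"
    using S_min[of "S - {j}"] finS j by (metis card_Diff1_less not_less)
  then have "\<eta> \<notin> span (v ` (S - {j}))" using S by (auto simp: P_def)
  moreover have "\<eta> \<in> span (insert (v j) (v ` (S - {j})))"
    using S j by (simp add: P_def) (metis image_insert insert_Diff)
  ultimately have "v j \<in> span (insert \<eta> (v ` (S - {j})))" by (metis in_span_insert)
  moreover have "insert \<eta> (v ` (S - {j})) \<subseteq> insert \<eta> (v ` ({..<N} - {j}))"
    using S by (auto simp: P_def)
  ultimately show False using notin[OF jN] span_mono by blast
qed

text \<open>A vector in the kernels of both \<alpha> and its differential annihilates every wedge
  product built from the two forms. The contact form is such a product in top degree and is nonzero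
  on \<open>v\<close>.\<close>

lemma contact_form_nondegenerate:
  fixes sc :: "'k::field_char_0 \<Rightarrow> 'v::ab_group_add \<Rightarrow> 'v"
  assumes vs: "vector_space sc" and W: "module.subspace sc W"
    and dim: "vector_space.dim sc W = 2 * n + 1"
    and \<alpha>: "\<alpha> \<in> dual_space sc W"
    and br: "\<And>x y. x \<in> W \<Longrightarrow> y \<in> W \<Longrightarrow> br x y \<in> W"
      "\<And>x y z. x \<in> W \<Longrightarrow> y \<in> W \<Longrightarrow> z \<in> W \<Longrightarrow> br x (y + z) = br x y + br x z"
      "\<And>x y c. x \<in> W \<Longrightarrow> y \<in> W \<Longrightarrow> br x (sc c y) = sc c (br x y)"
      "\<And>x y. x \<in> W \<Longrightarrow> y \<in> W \<Longrightarrow> br x y = - br y x"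
    and v: "\<forall>i < 2 * n + 1. v i \<in> W"
      "wedge (2 * n) 1 (wedge_power 2 (chevalley_eilenberg br \<alpha>) n) (\<lambda>v. \<alpha> (v 0)) v \<noteq> 0"
    and \<eta>: "\<eta> \<in> W" "\<alpha> \<eta> = 0" "\<And>x. x \<in> W \<Longrightarrow> \<alpha> (br x \<eta>) = 0"
  shows "\<eta> = 0"
proof -
  interpret vector_space sc by fact
  have \<alpha>_lin: "\<alpha> (x + y) = \<alpha> x + \<alpha> y" "\<alpha> (sc c x) = c * \<alpha> x" if "x \<in> W" "y \<in> W" for x y c
    using \<alpha> that by (auto simp: dual_space_def)
  have \<alpha>_neg: "\<alpha> (- x) = - \<alpha> x" if "x \<in> W" for x
    using \<alpha>_lin(2)[OF that that, of "-1"] by simp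
  have br_left: "br (x + y) z = br x z + br y z" "br (sc c x) z = sc c (br x z)"
    if "x \<in> W" "y \<in> W" "z \<in> W" for x y z c
  proof -
    have "br (x + y) z = - br z (x + y)" using that subspace_add[OF W] by (intro br(4))
    also have "\<dots> = - br z x - br z y" using br(2)[OF that(3,1,2)] by simp
    also have "\<dots> = br x z + br y z"
      using br(4)[OF that(1,3)] br(4)[OF that(2,3)] by simp
    finally show "br (x + y) z = br x z + br y z" .
    have "br (sc c x) z = - br z (sc c x)" using that subspace_scale[OF W] by (intro br(4))
    also have "\<dots> = sc c (- br z x)" using br(3)[OF that(3,1)] by (simp add: scale_minus_right)
    also have "- br z x = br x z" using br(4)[OF that(1,3)] by simp
    finally show "br (sc c x) z = sc c (br x z)" .
  qed
  have swap: "\<alpha> (br x y) = - \<alpha> (br y x)" if "x \<in> W" "y \<in> W" for x y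
    using br(4)[OF that] \<alpha>_neg[OF br(1)[OF that(2,1)]] by simp
  define \<omega> where "\<omega> = chevalley_eilenberg br \<alpha>"
  have less2: "i < 2 \<longleftrightarrow> i = 0 \<or> i = Suc 0" for i :: nat by auto
  have \<omega>_lin: "multilinear_on sc W 2 \<omega>"
    unfolding multilinear_on_def \<omega>_def chevalley_eilenberg_def less2
    by (auto simp: br(1-3) br_left \<alpha>_lin[OF br(1) br(1)])
  have \<omega>_ann: "annihilated_by \<eta> W 2 \<omega>"
    unfolding annihilated_by_def \<omega>_def chevalley_eilenberg_def less2
    using \<eta> swap[of \<eta>] by auto
  have power: "multilinear_on sc W (2 * m) (wedge_power 2 \<omega> m) \<and>
    annihilated_by \<eta> W (2 * m) (wedge_power 2 \<omega> m)" for m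
  proof (induction m)
    case 0
    show ?case by (simp add: multilinear_on_def annihilated_by_def)
  next
    case (Suc m)
    then show ?case
      using wedge_multilinear_on[OF \<omega>_lin, of "2 * m"] wedge_annihilated_by[OF \<omega>_ann, of "2 * m"]
      by simp
  qed
  have "multilinear_on sc W 1 (\<lambda>v. \<alpha> (v 0))" "annihilated_by \<eta> W 1 (\<lambda>v. \<alpha> (v 0))"
    using \<alpha>_lin \<eta>(2) by (auto simp: multilinear_on_def annihilated_by_def)
  note one = this
  have \<Omega>: "multilinear_on sc W (2 * n + 1) (wedge (2 * n) 1 (wedge_power 2 \<omega> n) (\<lambda>v. \<alpha> (v 0)))"
    "annihilated_by \<eta> W (2 * n + 1) (wedge (2 * n) 1 (wedge_power 2 \<omega> n) (\<lambda>v. \<alpha> (v 0)))"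
    using wedge_multilinear_on[OF conjunct1[OF power] one(1)]
      wedge_annihilated_by[OF conjunct2[OF power] one(2)] by blast+
  show ?thesis
    by (rule top_form_annihilated_by[OF vs W dim _ \<Omega>(1) _ \<Omega>(2) \<eta>(1) v(1)
        v(2)[folded \<omega>_def]]) (simp, rule wedge_alternating)
qed

section \<open>Polynomial functions on a dual space\<close>

text \<open>A space of functionals with zero common kernel is the whole dual.
  \<open>\<alpha>\<close> is interpolated on a finite basis one vector at a time;
  \<open>sep_span\<close> supplies a correction that leaves the earlier values unchanged.\<close>

lemma separating_functionals_exhaust:
  fixes sc :: "'k::field \<Rightarrow> 'v::ab_group_add \<Rightarrow> 'v"
  assumes vs: "vector_space sc" and W: "module.subspace sc W" and dim: "vector_space.dim sc W > 0"
    and \<Lambda>: "\<And>l. l \<in> \<Lambda> \<Longrightarrow> (\<forall>x\<in>W. \<forall>y\<in>W. l (x + y) = l x + l y) \<and> (\<forall>c. \<forall>x\<in>W. l (sc c x) = c * l x)"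
    and zero: "(\<lambda>_. 0) \<in> \<Lambda>" and comb: "\<And>l m c. l \<in> \<Lambda> \<Longrightarrow> m \<in> \<Lambda> \<Longrightarrow> (\<lambda>x. l x + c * m x) \<in> \<Lambda>"
    and sep: "\<And>x. x \<in> W \<Longrightarrow> x \<noteq> 0 \<Longrightarrow> \<exists>l\<in>\<Lambda>. l x \<noteq> 0"
    and \<alpha>: "\<And>x y. x \<in> W \<Longrightarrow> y \<in> W \<Longrightarrow> \<alpha> (x + y) = \<alpha> x + \<alpha> y"
      "\<And>c x. x \<in> W \<Longrightarrow> \<alpha> (sc c x) = c * \<alpha> x"
  shows "\<exists>l\<in>\<Lambda>. \<forall>x\<in>W. l x = \<alpha> x"
proof -
  interpret vector_space sc by fact
  have add: "l (x + y) = l x + l y" and scale: "l (sc c x) = c * l x"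
    if "l \<in> \<Lambda>" "x \<in> W" "y \<in> W" for l x y c
    using \<Lambda>[OF that(1)] that by auto
  have sep_span: "\<exists>l\<in>\<Lambda>. (\<forall>b\<in>B. l b = 0) \<and> l v \<noteq> 0"
    if "finite B" "B \<subseteq> W" "v \<in> W" "v \<notin> span B" for B v
    using that
  proof (induction B arbitrary: v rule: finite_induct)
    case empty
    then show ?case using sep by auto
  next
    case (insert b B)
    have bW: "b \<in> W" and BW: "B \<subseteq> W" using insert.prems by auto
    show ?case
    proof (cases "\<exists>l\<in>\<Lambda>. (\<forall>b\<in>B. l b = 0) \<and> l b \<noteq> 0")
      case True
      then obtain l0 where l0: "l0 \<in> \<Lambda>" "\<forall>b\<in>B. l0 b = 0" "l0 b \<noteq> 0" by blast
      \<comment> \<open>Chosen so that \<open>l0\<close> vanishes at \<open>v + sc c b\<close>.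
        Accordingly, the value of \<open>l1\<close> at this vector is the value at \<open>v\<close>
        of the combination of \<open>l1\<close> and \<open>l0\<close> that vanishes at
        \<open>b\<close>.\<close>
      define c where "c = - (l0 v / l0 b)"
      have uW: "v + sc c b \<in> W"
        using insert.prems(2) bW W by (intro subspace_add subspace_scale)
      have "v + sc c b \<notin> span B"
      proof
        assume "v + sc c b \<in> span B"
        then have "v + sc c b \<in> span (insert b B)" using span_mono[of B "insert b B"] by blast
        then have "v + sc c b - sc c b \<in> span (insert b B)"
          by (rule span_diff) (intro span_scale span_base, simp)
        then show False using insert.prems(3) by simp
      qed
      with insert.IH[OF BW uW] obtain l1 where l1: "l1 \<in> \<Lambda>" "\<forall>b\<in>B. l1 b = 0"
        "l1 (v + sc c b) \<noteq> 0" by blast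
      have "l1 (v + sc c b) = l1 v + c * l1 b"
        using l1(1) insert.prems(2) bW W by (simp add: add scale subspace_scale)
      then have "l1 v + - (l1 b / l0 b) * l0 v \<noteq> 0"
        using l1(3) by (simp add: c_def mult.commute)
      moreover have "(\<lambda>x. l1 x + - (l1 b / l0 b) * l0 x) \<in> \<Lambda>"
        using l1(1) l0(1) by (rule comb)
      ultimately show ?thesis
        using l1(2) l0(2,3) by (intro bexI[of _ "\<lambda>x. l1 x + - (l1 b / l0 b) * l0 x"]) auto
    next
      case False
      \<comment> \<open>Here every functional in \<open>\<Lambda>\<close> that vanishes on
        \<open>B\<close> also vanishes at \<open>b\<close>, so the one given by induction already
        works.\<close>
      have "v \<notin> span B" using insert.prems(3) span_mono[of B "insert b B"] by blast
      then show ?thesis using insert.IH[OF BW insert.prems(2)] False by blast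
    qed
  qed
  obtain C where C: "C \<subseteq> W" "independent C" "W \<subseteq> span C" "card C = dim W"
    using basis_exists[of W] by auto
  have "finite C" using C(4) dim card_ge_0_finite by metis
  have "\<exists>l\<in>\<Lambda>. \<forall>b\<in>S. l b = \<alpha> b" if "finite S" "S \<subseteq> C" for S
    using that
  proof (induction S rule: finite_induct)
    case empty
    then show ?case using zero by auto
  next
    case (insert b S)
    then obtain l where l: "l \<in> \<Lambda>" "\<forall>b\<in>S. l b = \<alpha> b" by blast
    have "b \<notin> span S"
      using C(2) insert span_mono[of S "C - {b}"] unfolding dependent_def by blast
    then obtain m where m: "m \<in> \<Lambda>" "\<forall>b\<in>S. m b = 0" "m b \<noteq> 0"
      using sep_span[OF insert.hyps(1)] insert.prems C(1) by blast
    show ?case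
      using comb[OF l(1) m(1), of "(\<alpha> b - l b) / m b"] l(2) m(2,3)
      by (intro bexI[of _ "\<lambda>x. l x + (\<alpha> b - l b) / m b * m x"]) auto
  qed
  then obtain l where l: "l \<in> \<Lambda>" "\<forall>b\<in>C. l b = \<alpha> b" using \<open>finite C\<close> by blast
  have "x \<in> W \<and> l x = \<alpha> x" if "x \<in> span C" for x
    using that
  proof (induction rule: span_induct_alt)
    case base
    have "l (sc 0 0) = \<alpha> (sc 0 0)"
      using scale[OF l(1)] \<alpha>(2) subspace_0[OF W] by (metis mult_zero_left)
    then show ?case using subspace_0[OF W] by simp
  next
    case (step c x y)
    then have "x \<in> W" "sc c x \<in> W" "y \<in> W" using C(1) W subspace_scale by auto
    then show ?case
      using step l W by (auto simp: add scale \<alpha> intro: subspace_add)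
  qed
  then show ?thesis using l(1) C(3) by blast
qed

section \<open>Polynomial functions and directional derivatives\<close>

abbreviation (input) evaluations :: "'v set \<Rightarrow> (('v \<Rightarrow> 'k) \<Rightarrow> 'k) set" where
  "evaluations W \<equiv> {\<lambda>\<alpha>. \<alpha> \<xi> |\<xi>. \<xi> \<in> W}"

lemma poly_functions_diff:
  assumes "f \<in> poly_functions F" "g \<in> poly_functions F"
  shows "(\<lambda>x. f x - g x) \<in> poly_functions F"
  using poly_functions.add[OF assms(1) poly_functions.mult[OF poly_functions.const[of "-1"] assms(2)]]
  by simp

lemma poly_functions_power:
  "f \<in> poly_functions F \<Longrightarrow> (\<lambda>x. f x ^ k) \<in> poly_functions F"
  by (induction k) (auto intro: poly_functions.const poly_functions.mult)

lemma subring_on_poly_functions: "subring_on (poly_functions F)"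
  unfolding subring_on_def one_fun_def fun_diff_def times_fun_def
  by (auto intro: poly_functions.const poly_functions_diff poly_functions.mult)

lemma poly_functions_evaluations_cong:
  "F \<in> poly_functions (evaluations W) \<Longrightarrow> (\<And>\<xi>. \<xi> \<in> W \<Longrightarrow> a \<xi> = b \<xi>) \<Longrightarrow> F a = F b"
  by (induction rule: poly_functions.induct) auto

text \<open>A relation, because one polynomial function has many expressions; it follows one of
  them, so that statements about derivatives can be proved by induction along that
  expression.\<close>

inductive directional_derivative ::
    "'v set \<Rightarrow> ('v \<Rightarrow> 'k) \<Rightarrow> (('v \<Rightarrow> 'k) \<Rightarrow> 'k) \<Rightarrow> (('v \<Rightarrow> 'k) \<Rightarrow> 'k::field) \<Rightarrow> bool"
  for W w where
  const: "directional_derivative W w (\<lambda>_. c) (\<lambda>_. 0)"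
| coord: "\<xi> \<in> W \<Longrightarrow> directional_derivative W w (\<lambda>\<alpha>. \<alpha> \<xi>) (\<lambda>_. w \<xi>)"
| add: "directional_derivative W w F F' \<Longrightarrow> directional_derivative W w G G' \<Longrightarrow>
    directional_derivative W w (\<lambda>\<alpha>. F \<alpha> + G \<alpha>) (\<lambda>\<alpha>. F' \<alpha> + G' \<alpha>)"
| mult: "directional_derivative W w F F' \<Longrightarrow> directional_derivative W w G G' \<Longrightarrow>
    directional_derivative W w (\<lambda>\<alpha>. F \<alpha> * G \<alpha>) (\<lambda>\<alpha>. F' \<alpha> * G \<alpha> + F \<alpha> * G' \<alpha>)"

lemma directional_derivative_exists:
  assumes "F \<in> poly_functions (evaluations W)"
  shows "\<exists>F'. directional_derivative W w F F'"
  using assms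
proof induction
  case (const c)
  show ?case using directional_derivative.const[of W w c] by blast
next
  case (coord f)
  then show ?case by (auto intro: directional_derivative.coord)
next
  case (add f g)
  then show ?case by (blast intro: directional_derivative.add)
next
  case (mult f g)
  then show ?case by (blast intro: directional_derivative.mult)
qed

lemma directional_derivative_poly_functions:
  assumes "directional_derivative W w F F'"
  shows "F \<in> poly_functions (evaluations W) \<and> F' \<in> poly_functions (evaluations W)"
  using assms
  by induction (auto intro!: poly_functions.add poly_functions.mult poly_functions.const
      intro: poly_functions.coord)

text \<open>Reduces derivatives on a dual space, whose points are functions, to formal derivatives
  of polynomials in one variable.\<close>

lemma directional_derivative_line:
  assumes "directional_derivative W w F F'"
  shows "\<exists>p. (\<forall>s. F (\<lambda>\<xi>. a \<xi> + s * w \<xi>) = poly p s) \<and>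
    (\<forall>s. F' (\<lambda>\<xi>. a \<xi> + s * w \<xi>) = poly (pderiv p) s)"
  using assms
proof induction
  case (const c)
  show ?case by (intro exI[of _ "[:c:]"]) simp
next
  case (coord \<xi>)
  show ?case by (intro exI[of _ "[:a \<xi>, w \<xi>:]"]) (simp add: pderiv_pCons)
next
  case (add F F' G G')
  then obtain p q where "\<forall>s. F (\<lambda>\<xi>. a \<xi> + s * w \<xi>) = poly p s"
    "\<forall>s. F' (\<lambda>\<xi>. a \<xi> + s * w \<xi>) = poly (pderiv p) s"
    "\<forall>s. G (\<lambda>\<xi>. a \<xi> + s * w \<xi>) = poly q s"
    "\<forall>s. G' (\<lambda>\<xi>. a \<xi> + s * w \<xi>) = poly (pderiv q) s" by blast
  then show ?case by (intro exI[of _ "p + q"]) (simp add: pderiv_add)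
next
  case (mult F F' G G')
  then obtain p q where "\<forall>s. F (\<lambda>\<xi>. a \<xi> + s * w \<xi>) = poly p s"
    "\<forall>s. F' (\<lambda>\<xi>. a \<xi> + s * w \<xi>) = poly (pderiv p) s"
    "\<forall>s. G (\<lambda>\<xi>. a \<xi> + s * w \<xi>) = poly q s"
    "\<forall>s. G' (\<lambda>\<xi>. a \<xi> + s * w \<xi>) = poly (pderiv q) s" by blast
  then show ?case by (intro exI[of _ "p * q"]) (simp add: pderiv_mult algebra_simps)
qed

text \<open>In characteristic zero a nonconstant polynomial has a nonzero derivative of smaller
  degree, so induction on the degree leaves only constants.\<close>

lemma poly_eq_0_if_pderivs_vanish:
  fixes p :: "'k::field_char_0 poly"
  assumes "\<And>k. poly ((pderiv ^^ k) p) 0 = 0"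
  shows "p = 0"
  using assms
proof (induction "degree p" arbitrary: p rule: less_induct)
  case less
  have "degree p = 0"
  proof (rule ccontr)
    assume "degree p \<noteq> 0"
    moreover have "pderiv p = 0"
      using less.prems[of "Suc _"] \<open>degree p \<noteq> 0\<close>
      by (intro less.hyps) (simp_all add: degree_pderiv funpow_swap1)
    ultimately show False by (simp add: pderiv_eq_0_iff)
  qed
  then obtain c where "p = [:c:]" using degree_eq_zeroE by blast
  then show ?case using less.prems[of 0] by simp
qed

text \<open>Taylor expansion at \<open>\<alpha>\<close> along the line from \<open>\<alpha>\<close> to \<open>\<beta>\<close>.\<close>

lemma vanishing_of_derivatives:
  fixes sc :: "'k::field_char_0 \<Rightarrow> 'v::ab_group_add \<Rightarrow> 'v" and W :: "'v set"
  defines "V \<equiv> dual_space sc W"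
  assumes closed: "\<And>F F' w. w \<in> V \<Longrightarrow> directional_derivative W w F F' \<Longrightarrow>
      (\<forall>z\<in>Z. F z = 0) \<Longrightarrow> (\<forall>z\<in>Z. F' z = 0)"
    and F: "F \<in> poly_functions (evaluations W)" "\<forall>z\<in>Z. F z = 0"
    and \<alpha>: "\<alpha> \<in> Z" "\<alpha> \<in> V" and \<beta>: "\<beta> \<in> V"
  shows "F \<beta> = 0"
proof -
  define w where "w = (\<lambda>\<xi>. \<beta> \<xi> - \<alpha> \<xi>)"
  have wV: "w \<in> V"
    using \<alpha>(2) \<beta> by (auto simp: V_def dual_space_def w_def algebra_simps)
  obtain p where p: "\<forall>s. F (\<lambda>\<xi>. \<alpha> \<xi> + s * w \<xi>) = poly p s"
    using directional_derivative_exists[OF F(1)] directional_derivative_line by metis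
  \<comment> \<open>The iterated derivatives of \<open>F\<close> along \<open>w\<close> all vanish
    on \<open>Z\<close>, in particular at \<open>\<alpha>\<close>, which is the point
    \<open>s = 0\<close> of the line.\<close>
  have "\<exists>G\<in>poly_functions (evaluations W). (\<forall>z\<in>Z. G z = 0) \<and>
    (\<forall>s. G (\<lambda>\<xi>. \<alpha> \<xi> + s * w \<xi>) = poly ((pderiv ^^ k) p) s)" for k
  proof (induction k)
    case 0
    then show ?case using F p by auto
  next
    case (Suc k)
    then obtain G where G: "G \<in> poly_functions (evaluations W)" "\<forall>z\<in>Z. G z = 0"
      "\<forall>s. G (\<lambda>\<xi>. \<alpha> \<xi> + s * w \<xi>) = poly ((pderiv ^^ k) p) s" by blast
    obtain G' where G': "directional_derivative W w G G'"
      using directional_derivative_exists[OF G(1)] by blast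
    obtain q where q: "\<forall>s. G (\<lambda>\<xi>. \<alpha> \<xi> + s * w \<xi>) = poly q s"
      "\<forall>s. G' (\<lambda>\<xi>. \<alpha> \<xi> + s * w \<xi>) = poly (pderiv q) s"
      using directional_derivative_line[OF G'] by blast
    \<comment> \<open>The restriction of \<open>G\<close> to the line comes with a new polynomial;
      over an infinite field equal values force it to be the one already tracked.\<close>
    have "q = (pderiv ^^ k) p"
      using q(1) G(3) by (metis poly_eqI_degree_lead_coeff poly_eq_poly_eq_iff ext)
    then show ?case
      using q(2) closed[OF wV G' G(2)] directional_derivative_poly_functions[OF G'] by auto
  qed
  then have "poly ((pderiv ^^ k) p) 0 = 0" for k
    using \<alpha>(1) by (metis (no_types, lifting) add.right_neutral mult_zero_left ext)
  then have "p = 0" by (rule poly_eq_0_if_pderivs_vanish)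
  then have "F (\<lambda>\<xi>. \<alpha> \<xi> + 1 * w \<xi>) = 0" using p by (metis poly_0)
  then show ?thesis by (simp add: w_def)
qed

text \<open>Irreducibility of the dual space, tested on the line through \<open>\<alpha>\<close> and
  \<open>\<beta>\<close>: the two restrictions are nonzero polynomials in one variable, and so is
  their product.\<close>

lemma poly_functions_common_nonzero:
  fixes sc :: "'k::field_char_0 \<Rightarrow> 'v::ab_group_add \<Rightarrow> 'v"
  assumes "F \<in> poly_functions (evaluations W)" "G \<in> poly_functions (evaluations W)"
    and "\<alpha> \<in> dual_space sc W" "F \<alpha> \<noteq> 0" "\<beta> \<in> dual_space sc W" "G \<beta> \<noteq> 0"
  shows "\<exists>\<gamma>\<in>dual_space sc W. F \<gamma> \<noteq> 0 \<and> G \<gamma> \<noteq> 0"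
proof -
  define w where "w = (\<lambda>\<xi>. \<beta> \<xi> - \<alpha> \<xi>)"
  have line: "\<exists>p. \<forall>s. H (\<lambda>\<xi>. \<alpha> \<xi> + s * w \<xi>) = poly p s"
    if "H \<in> poly_functions (evaluations W)" for H
    using directional_derivative_exists[OF that] directional_derivative_line by metis
  obtain p q where p: "\<forall>s. F (\<lambda>\<xi>. \<alpha> \<xi> + s * w \<xi>) = poly p s"
    and q: "\<forall>s. G (\<lambda>\<xi>. \<alpha> \<xi> + s * w \<xi>) = poly q s"
    using line[OF assms(1)] line[OF assms(2)] by blast
  have "poly p 0 \<noteq> 0" "poly q 1 \<noteq> 0"
    using spec[OF p, of 0] spec[OF q, of 1] assms by (auto simp: w_def)
  then have "p * q \<noteq> 0" by auto
  then obtain s where "poly (p * q) s \<noteq> 0" using poly_all_0_iff_0 by blast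
  moreover have "(\<lambda>\<xi>. \<alpha> \<xi> + s * w \<xi>) \<in> dual_space sc W"
    using assms(3,5) by (auto simp: dual_space_def w_def algebra_simps)
  ultimately show ?thesis using p q by (metis mult_eq_0_iff poly_mult)
qed

section \<open>The orbit of a contact form\<close>

locale contact_group = alg_group Q
  for Q :: "('k::{alg_closed_field, field_char_0} ^ 'n) monoid" (structure) +
  fixes n :: nat
  assumes dim: "vector_space.dim op_scale (lie_algebra Q) = 2 * n + 1"
begin

section \<open>The extended action and its orbits\<close>

abbreviation "V \<equiv> lie_dual Q"
abbreviation "polys \<equiv> poly_functions (evaluations L :: (_ \<Rightarrow> 'k) set)"
abbreviation "act g t \<equiv> extended_action Q (g, t)"

definition orb :: "(('k, 'n) operator \<Rightarrow> 'k) \<Rightarrow> (('k, 'n) operator \<Rightarrow> 'k) set" where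
  "orb \<alpha> = orbit (extended_group Q) (extended_action Q) \<alpha>"

lemma subspace_lie: "module.subspace op_scale L"
proof -
  interpret op: vector_space "op_scale :: 'k \<Rightarrow> ('k, 'n) operator \<Rightarrow> ('k, 'n) operator"
    by (rule vector_space_op_scale)
  show ?thesis unfolding op.subspace_def using lie_subspace by blast
qed

lemma mem_orb_iff: "\<beta> \<in> orb \<alpha> \<longleftrightarrow> (\<exists>g\<in>carrier Q. \<exists>t. t \<noteq> 0 \<and> \<beta> = act g t \<alpha>)"
  by (auto simp: orb_def orbit_def extended_group_def mult_group_def)

lemma act_apply: "act g t \<alpha> \<xi> = (if \<xi> \<in> L then t * \<alpha> (Ad Q (inv g) \<xi>) else 0)"
  by (simp add: extended_action_def coadjoint_def)

lemma act_act:
  assumes "g \<in> carrier Q" "h \<in> carrier Q"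
  shows "act g t (act h s \<alpha>) = act (g \<otimes> h) (t * s) \<alpha>"
  using assms by (auto simp: fun_eq_iff act_apply Ad_closed Ad_Ad inv_mult_group)

lemma act_one: "\<alpha> \<in> V \<Longrightarrow> act \<one> 1 \<alpha> = \<alpha>"
  by (auto simp: fun_eq_iff act_apply Ad_one dual_space_def)

lemma act_closed:
  assumes "g \<in> carrier Q" "\<alpha> \<in> V"
  shows "act g t \<alpha> \<in> V"
  using assms lie_subspace Ad_closed[of "inv g"]
  by (auto simp: dual_space_def act_apply Ad_linear algebra_simps)

lemma orb_self: "\<alpha> \<in> V \<Longrightarrow> \<alpha> \<in> orb \<alpha>"
  using act_one[of \<alpha>] unfolding mem_orb_iff by (intro bexI[of _ \<one>] exI[of _ 1]) auto

lemma orb_subset: "\<alpha> \<in> V \<Longrightarrow> orb \<alpha> \<subseteq> V"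
  using act_closed by (auto simp: mem_orb_iff)

lemma orb_act: "\<beta> \<in> orb \<alpha> \<Longrightarrow> g \<in> carrier Q \<Longrightarrow> t \<noteq> 0 \<Longrightarrow> act g t \<beta> \<in> orb \<alpha>"
  unfolding mem_orb_iff
  by (elim bexE exE conjE) (metis act_act m_closed mult_eq_0_iff)

lemma act_inverse:
  assumes "g \<in> carrier Q" "t \<noteq> 0" "\<alpha> \<in> V"
  shows "act (inv g) (1 / t) (act g t \<alpha>) = \<alpha>" "act g t (act (inv g) (1 / t) \<alpha>) = \<alpha>"
  using assms by (simp_all add: act_act act_one)

lemma orb_sym:
  assumes "\<alpha> \<in> V" "\<beta> \<in> orb \<alpha>"
  shows "\<alpha> \<in> orb \<beta>"
proof -
  obtain g t where gt: "g \<in> carrier Q" "t \<noteq> 0" "\<beta> = act g t \<alpha>"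
    using assms(2) by (auto simp: mem_orb_iff)
  have "\<alpha> = act (inv g) (1 / t) \<beta>" using act_inverse(1)[OF gt(1,2) assms(1)] gt(3) by simp
  then show ?thesis using gt by (auto simp: mem_orb_iff intro!: bexI[of _ "inv g"] exI[of _ "1 / t"])
qed

lemma orb_trans: "\<beta> \<in> orb \<alpha> \<Longrightarrow> \<gamma> \<in> orb \<beta> \<Longrightarrow> \<gamma> \<in> orb \<alpha>"
  using orb_act unfolding mem_orb_iff[of \<gamma> \<beta>] by blast

lemma polys_act:
  assumes "F \<in> polys" "g \<in> carrier Q"
  shows "(\<lambda>\<beta>. F (act g t \<beta>)) \<in> polys"
proof -
  have "\<exists>q\<in>polys. \<forall>\<beta>\<in>UNIV. f (act g t \<beta>) = q \<beta>" if "f \<in> evaluations L" for f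
  proof -
    from that obtain \<xi> where \<xi>: "\<xi> \<in> L" "f = (\<lambda>\<alpha>. \<alpha> \<xi>)" by blast
    have "(\<lambda>\<beta>. t * \<beta> (Ad Q (inv g) \<xi>)) \<in> polys"
      using Ad_closed[OF inv_closed[OF assms(2)] \<xi>(1)]
      by (intro poly_functions.mult poly_functions.const poly_functions.coord) blast
    then show ?thesis
      using \<xi> by (intro bexI[of _ "\<lambda>\<beta>. t * \<beta> (Ad Q (inv g) \<xi>)"]) (simp_all add: act_apply)
  qed
  from poly_functions_compose_on[where \<phi> = "act g t" and Y = UNIV, OF assms(1) this]
  obtain q where "q \<in> polys" "\<forall>\<beta>. F (act g t \<beta>) = q \<beta>" by blast
  then show ?thesis by (metis (no_types, lifting) ext)
qed

section \<open>Tangent directions along the orbit\<close>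

text \<open>The functionals \<xi> \<mapsto> (\<xi> f)(1) form a subspace of the dual, and they
  separate points because a left-invariant derivation is determined by its values at the
  unit.\<close>

lemma functional_is_evaluation:
  assumes "\<alpha> \<in> V"
  obtains f where "f \<in> A" "\<And>\<xi>. \<xi> \<in> L \<Longrightarrow> \<alpha> \<xi> = \<xi> f \<one>"
proof -
  define \<Lambda> :: "(('k, 'n) operator \<Rightarrow> 'k) set"
    where "\<Lambda> = {\<lambda>\<xi>. if \<xi> \<in> L then \<xi> f \<one> else 0 |f. f \<in> A}"
  have "\<exists>l\<in>\<Lambda>. \<forall>\<xi>\<in>L. l \<xi> = \<alpha> \<xi>"
  proof (rule separating_functionals_exhaust[OF vector_space_op_scale subspace_lie])
    show "0 < vector_space.dim op_scale L" using dim by simp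
    show "(\<forall>x\<in>L. \<forall>y\<in>L. l (x + y) = l x + l y) \<and> (\<forall>c. \<forall>x\<in>L. l (op_scale c x) = c * l x)"
      if "l \<in> \<Lambda>" for l
      using that lie_subspace by (auto simp: \<Lambda>_def op_scale_def)
    show "(\<lambda>_. 0) \<in> \<Lambda>"
      unfolding \<Lambda>_def using coordinate_ring_zero[of "carrier Q"]
      by (auto intro!: exI[of _ 0] simp: fun_eq_iff lie_zero)
    show "(\<lambda>x. l x + c * m x) \<in> \<Lambda>" if lm: "l \<in> \<Lambda>" "m \<in> \<Lambda>" for l m c
    proof -
      obtain f g where fg: "f \<in> A" "l = (\<lambda>\<xi>. if \<xi> \<in> L then \<xi> f \<one> else 0)"
        "g \<in> A" "m = (\<lambda>\<xi>. if \<xi> \<in> L then \<xi> g \<one> else 0)"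
        using lm unfolding \<Lambda>_def by blast
      have cg: "(\<lambda>x. c * g x) \<in> A" using fg(3) by (rule coordinate_ring_scale)
      have "(\<lambda>x. l x + c * m x) = (\<lambda>\<xi>. if \<xi> \<in> L then \<xi> (f + (\<lambda>x. c * g x)) \<one> else 0)"
        unfolding fg(2,4) using fg(1,3) cg by (auto simp: fun_eq_iff lie_add lie_scale)
      then show ?thesis
        unfolding \<Lambda>_def using coordinate_ring_add[OF fg(1) cg] by blast
    qed
    show "\<exists>l\<in>\<Lambda>. l \<xi> \<noteq> 0" if \<xi>: "\<xi> \<in> L" "\<xi> \<noteq> 0" for \<xi>
    proof (rule ccontr)
      assume "\<not> ?thesis"
      then have zero: "\<xi> f \<one> = 0" if "f \<in> A" for f
        using that \<xi>(1) unfolding \<Lambda>_def by fastforce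
      have "\<xi> f x = 0" for f x
      proof (cases "f \<in> A \<and> x \<in> carrier Q")
        case True
        have "\<xi> f x = \<xi> (left_translate Q (inv x) f) \<one>"
          using lie_left[OF \<xi>(1), of "inv x" f] True by (simp add: left_translate_def)
        then show ?thesis using zero[OF translate_closed(1)] True by simp
      next
        case False
        then show ?thesis
          using lie_outside[OF \<xi>(1), of f] lie_closed[OF \<xi>(1), of f]
          by (cases "f \<in> A") (auto simp: coordinate_ring_iff)
      qed
      then show False using \<xi>(2) by (auto simp: fun_eq_iff)
    qed
    show "\<alpha> (x + y) = \<alpha> x + \<alpha> y" if "x \<in> L" "y \<in> L" for x y
      using assms that by (simp add: dual_space_def)
    show "\<alpha> (op_scale c x) = c * \<alpha> x" if "x \<in> L" for c x
      using assms that by (simp add: dual_space_def)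
  qed
  then obtain l where "l \<in> \<Lambda>" "\<forall>\<xi>\<in>L. l \<xi> = \<alpha> \<xi>" by blast
  then show thesis using that unfolding \<Lambda>_def by fastforce
qed

text \<open>Writing \<open>\<beta>\<close> as evaluation of derivations at a regular function turns
  \<open>c\<close> into a coefficient of the adjoint representation.\<close>

lemma orbit_map_derivative:
  assumes "\<beta> \<in> V" "\<xi> \<in> L"
  defines "c \<equiv> \<lambda>g. if g \<in> carrier Q then \<beta> (Ad Q g \<xi>) else 0"
  shows "c \<in> A" "D \<in> L \<Longrightarrow> D c \<one> = \<beta> (lie_bracket D \<xi>)"
proof -
  obtain f where f: "f \<in> A" "\<And>\<xi>. \<xi> \<in> L \<Longrightarrow> \<beta> \<xi> = \<xi> f \<one>"
    using functional_is_evaluation[OF assms(1)] by blast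
  have "c = (\<lambda>g. if g \<in> carrier Q then Ad Q g \<xi> f \<one> else 0)"
    using f(2) Ad_closed assms(2) by (auto simp: c_def)
  then show "c \<in> A" "D \<in> L \<Longrightarrow> D c \<one> = \<beta> (lie_bracket D \<xi>)"
    using Ad_coefficient[OF f(1) assms(2)] f(2)[OF lie_bracket_closed[OF _ assms(2)]] by simp_all
qed

text \<open>The form in which the contact condition is used: the functionals \<xi> \<mapsto>
  \<beta>([D, \<xi>]) and \<beta> itself have zero common kernel. It passes along the orbit without
  any wedge products.\<close>

definition nondegenerate :: "(('k, 'n) operator \<Rightarrow> 'k) \<Rightarrow> bool" where
  "nondegenerate \<beta> \<longleftrightarrow> \<beta> \<in> V \<and>
    (\<forall>\<eta>\<in>L. \<beta> \<eta> = 0 \<longrightarrow> (\<forall>D\<in>L. \<beta> (lie_bracket D \<eta>) = 0) \<longrightarrow> \<eta> = 0)"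

lemma contact_nondegenerate:
  assumes "contact_linear_form Q n \<alpha>"
  shows "nondegenerate \<alpha>"
  unfolding nondegenerate_def
proof (intro conjI ballI impI)
  show "\<alpha> \<in> V" using assms by (simp add: contact_linear_form_def)
  fix \<eta> assume \<eta>: "\<eta> \<in> L" "\<alpha> \<eta> = 0" "\<forall>D\<in>L. \<alpha> (lie_bracket D \<eta>) = 0"
  obtain v where v: "\<forall>i < 2 * n + 1. v i \<in> L"
    "wedge (2 * n) 1 (wedge_power 2 (chevalley_eilenberg lie_bracket \<alpha>) n) (\<lambda>v. \<alpha> (v 0)) v \<noteq> 0"
    using assms unfolding contact_linear_form_def by blast
  show "\<eta> = 0"
  proof (rule contact_form_nondegenerate[where sc = op_scale and W = L and br = lie_bracket
        and \<alpha> = \<alpha> and v = v and n = n])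
    show "lie_bracket x y = - lie_bracket y x" for x y by (rule lie_bracket_antisym)
  qed (use vector_space_op_scale subspace_lie dim \<open>\<alpha> \<in> V\<close> v \<eta>
      in \<open>auto simp: lie_bracket_closed lie_bracket_add_right lie_bracket_scale_right\<close>)
qed

text \<open>\<open>Ad\<close> preserves the bracket and permutes \<open>L\<close>, so a vector in
  the common kernel for the translated form is carried by \<open>Ad Q (inv g)\<close> to one for
  \<open>\<alpha>\<close>.\<close>

lemma nondegenerate_act:
  assumes \<alpha>: "nondegenerate \<alpha>" and g: "g \<in> carrier Q" and t: "t \<noteq> 0"
  shows "nondegenerate (act g t \<alpha>)"
  unfolding nondegenerate_def
proof (intro conjI ballI impI)
  show "act g t \<alpha> \<in> V" using act_closed g \<alpha> by (simp add: nondegenerate_def)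
  fix \<eta> assume \<eta>: "\<eta> \<in> L" "act g t \<alpha> \<eta> = 0" "\<forall>D\<in>L. act g t \<alpha> (lie_bracket D \<eta>) = 0"
  have AdL: "Ad Q (inv g) \<eta> \<in> L" using \<eta>(1) g by (simp add: Ad_closed)
  have "\<alpha> (lie_bracket E (Ad Q (inv g) \<eta>)) = 0" if E: "E \<in> L" for E
  proof -
    have gE: "Ad Q g E \<in> L" using E g by (rule Ad_closed[rotated])
    have "Ad Q (inv g) (Ad Q g E) = E" using g E by (simp add: Ad_Ad Ad_one)
    then have "lie_bracket E (Ad Q (inv g) \<eta>) = Ad Q (inv g) (lie_bracket (Ad Q g E) \<eta>)"
      using lie_bracket_Ad[OF inv_closed[OF g] gE \<eta>(1)] by simp
    then show ?thesis
      using bspec[OF \<eta>(3) gE] lie_bracket_closed[OF gE \<eta>(1)] t by (simp add: act_apply)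
  qed
  then have "Ad Q (inv g) \<eta> = 0"
    using \<alpha> \<eta>(1,2) AdL t by (auto simp: nondegenerate_def act_apply)
  moreover have "Ad Q g (Ad Q (inv g) \<eta>) = \<eta>" using g \<eta>(1) by (simp add: Ad_Ad Ad_one)
  moreover have "Ad Q g 0 = 0"
    using Ad_linear(2)[of g 0 "0 :: ('k, 'n) operator"] by (simp add: op_scale_def zero_fun_def)
  ultimately show "\<eta> = 0" by simp
qed

text \<open>The functionals on the right form a subspace of the dual, and nondegeneracy says that
  they separate points; in finite dimension they are therefore all functionals.\<close>

lemma tangent_space_full:
  assumes \<beta>: "nondegenerate \<beta>" and w: "w \<in> V"
  obtains D c where "D \<in> L" "\<And>\<xi>. \<xi> \<in> L \<Longrightarrow> w \<xi> = \<beta> (lie_bracket D \<xi>) + c * \<beta> \<xi>"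
proof -
  have \<beta>V: "\<beta> \<in> V" using \<beta> by (simp add: nondegenerate_def)
  have \<beta>_lin: "\<beta> (x + y) = \<beta> x + \<beta> y" "\<beta> (op_scale c x) = c * \<beta> x" if "x \<in> L" "y \<in> L" for x y c
    using \<beta>V that by (auto simp: dual_space_def)
  have bracket_left: "\<beta> (lie_bracket (D + op_scale c E) \<xi>) =
    \<beta> (lie_bracket D \<xi>) + c * \<beta> (lie_bracket E \<xi>)" if "D \<in> L" "E \<in> L" "\<xi> \<in> L" for D E \<xi> c
  proof -
    have scale_neg: "op_scale c (- X) = - op_scale c X" for X :: "('k, 'n) operator"
      by (simp add: op_scale_def fun_eq_iff)
    have cE: "op_scale c E \<in> L" using that lie_subspace by blast
    have "lie_bracket (D + op_scale c E) \<xi> = - lie_bracket \<xi> (D + op_scale c E)"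
      by (rule lie_bracket_antisym)
    also have "\<dots> = - lie_bracket \<xi> D + op_scale c (- lie_bracket \<xi> E)"
      unfolding lie_bracket_add_right[OF that(3,1) cE] lie_bracket_scale_right[OF that(3,2)]
        scale_neg by simp
    also have "\<dots> = lie_bracket D \<xi> + op_scale c (lie_bracket E \<xi>)"
      unfolding lie_bracket_antisym[of D] lie_bracket_antisym[of E] ..
    finally show ?thesis
      using that by (simp add: \<beta>_lin lie_bracket_closed lie_subspace)
  qed
  define \<Lambda> where
    "\<Lambda> = {\<lambda>\<xi>. if \<xi> \<in> L then \<beta> (lie_bracket D \<xi>) + c * \<beta> \<xi> else 0 |D c. D \<in> L}"
  have "\<exists>l\<in>\<Lambda>. \<forall>\<xi>\<in>L. l \<xi> = w \<xi>"
  proof (rule separating_functionals_exhaust[OF vector_space_op_scale subspace_lie])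
    show "0 < vector_space.dim op_scale L" using dim by simp
    show "(\<forall>x\<in>L. \<forall>y\<in>L. l (x + y) = l x + l y) \<and> (\<forall>c. \<forall>x\<in>L. l (op_scale c x) = c * l x)"
      if "l \<in> \<Lambda>" for l
    proof -
      obtain D c where "D \<in> L" "l = (\<lambda>\<xi>. if \<xi> \<in> L then \<beta> (lie_bracket D \<xi>) + c * \<beta> \<xi> else 0)"
        using \<open>l \<in> \<Lambda>\<close> unfolding \<Lambda>_def by blast
      then show ?thesis
        by (auto simp: lie_bracket_add_right lie_bracket_scale_right \<beta>_lin lie_bracket_closed lie_subspace algebra_simps)
    qed
    have zero: "lie_bracket 0 \<xi> = 0" if "\<xi> \<in> L" for \<xi>
      using lie_zero[OF that] by (simp add: lie_bracket_def zero_fun_def)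
    have \<beta>0: "\<beta> 0 = 0"
      using \<beta>_lin(2)[OF lie_subspace(1) lie_subspace(1), of 0] by (simp add: op_scale_def zero_fun_def)
    show "\<exists>l\<in>\<Lambda>. l \<xi> \<noteq> 0" if \<xi>: "\<xi> \<in> L" "\<xi> \<noteq> 0" for \<xi>
    proof (rule ccontr)
      assume "\<not> ?thesis"
      then have all0: "l \<xi> = 0" if "l \<in> \<Lambda>" for l using that by blast
      have *: "\<beta> (lie_bracket D \<xi>) + c * \<beta> \<xi> = 0" if "D \<in> L" for D c
        using all0[of "\<lambda>\<xi>. if \<xi> \<in> L then \<beta> (lie_bracket D \<xi>) + c * \<beta> \<xi> else 0"] that \<xi>(1)
        unfolding \<Lambda>_def by auto
      \<comment> \<open>The pair \<open>D = 0\<close>, \<open>c = 1\<close> isolates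
        \<open>\<beta>\<close>; afterwards \<open>c = 0\<close> isolates the brackets.\<close>
      have "\<beta> \<xi> = 0" using *[OF lie_subspace(1), of 1] zero[OF \<xi>(1)] \<beta>0 by simp
      moreover have "\<forall>D\<in>L. \<beta> (lie_bracket D \<xi>) = 0" using *[of _ 0] by simp
      ultimately show False using \<beta> \<xi> by (auto simp: nondegenerate_def)
    qed
    show "w (x + y) = w x + w y" if "x \<in> L" "y \<in> L" for x y
      using w that by (simp add: dual_space_def)
    show "w (op_scale c x) = c * w x" if "x \<in> L" for c x
      using w that by (simp add: dual_space_def)
    have "(\<lambda>_. 0) = (\<lambda>\<xi>. if \<xi> \<in> L then \<beta> (lie_bracket 0 \<xi>) + 0 * \<beta> \<xi> else 0)"
      by (rule ext) (simp add: zero \<beta>0)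
    then show "(\<lambda>_. 0) \<in> \<Lambda>"
      unfolding \<Lambda>_def using lie_subspace(1) by blast
    show "(\<lambda>x. l x + c * m x) \<in> \<Lambda>" if lm: "l \<in> \<Lambda>" "m \<in> \<Lambda>" for l m c
    proof -
      obtain D a E b where DE: "D \<in> L" "E \<in> L"
        "l = (\<lambda>\<xi>. if \<xi> \<in> L then \<beta> (lie_bracket D \<xi>) + a * \<beta> \<xi> else 0)"
        "m = (\<lambda>\<xi>. if \<xi> \<in> L then \<beta> (lie_bracket E \<xi>) + b * \<beta> \<xi> else 0)"
        using lm unfolding \<Lambda>_def by blast
      have "(\<lambda>x. l x + c * m x) =
        (\<lambda>\<xi>. if \<xi> \<in> L then \<beta> (lie_bracket (D + op_scale c E) \<xi>) + (a + c * b) * \<beta> \<xi> else 0)"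
        by (auto simp: fun_eq_iff DE bracket_left algebra_simps)
      moreover have "D + op_scale c E \<in> L" using DE(1,2) lie_subspace by blast
      ultimately show ?thesis unfolding \<Lambda>_def by blast
    qed
  qed
  then obtain D c where D: "D \<in> L"
    "\<forall>\<xi>\<in>L. (if \<xi> \<in> L then \<beta> (lie_bracket D \<xi>) + c * \<beta> \<xi> else 0) = w \<xi>"
    unfolding \<Lambda>_def by blast
  show thesis by (rule that[OF D(1), of c]) (use D(2) in auto)
qed

section \<open>Density of the orbit\<close>

lemma polys_common_nonzero:
  assumes "F \<in> polys" "G \<in> polys" "\<exists>\<alpha>\<in>V. F \<alpha> \<noteq> 0" "\<exists>\<beta>\<in>V. G \<beta> \<noteq> 0"
  shows "\<exists>\<gamma>\<in>V. F \<gamma> \<noteq> 0 \<and> G \<gamma> \<noteq> 0"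
proof -
  from assms(3,4) obtain \<alpha> \<beta> where "\<alpha> \<in> V" "F \<alpha> \<noteq> 0" "\<beta> \<in> V" "G \<beta> \<noteq> 0" by blast
  with poly_functions_common_nonzero[where sc = op_scale and W = L and F = F and G = G, of \<alpha> \<beta>]
    assms(1,2) show ?thesis by blast
qed

text \<open>The chain rule for \<open>F\<close> along the curve through \<open>\<beta>\<close> with tangent vector
  \<open>\<beta> \<circ> ad D + c \<beta>\<close>: both sides are derivations in \<open>F\<close>.\<close>

lemma derivative_along_orbit:
  assumes \<beta>: "\<beta> \<in> V" and D: "D \<in> L"
    and w: "\<And>\<xi>. \<xi> \<in> L \<Longrightarrow> w \<xi> = \<beta> (lie_bracket D \<xi>) + c * \<beta> \<xi>"
    and "directional_derivative L w F F'"
  defines "h \<equiv> \<lambda>F g. if g \<in> carrier Q then F (act (inv g) 1 \<beta>) else 0"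
  shows "h F \<in> A \<and> (\<exists>p. (\<forall>s. F (\<lambda>\<xi>. s * \<beta> \<xi>) = poly p s) \<and>
    F' \<beta> = D (h F) \<one> + c * poly (pderiv p) 1)"
  using assms(4)
proof induction
  case (const a)
  show ?case
    unfolding h_def lie_const[OF D]
    by (intro conjI exI[of _ "[:a:]"]) (simp_all add: coordinate_ring_const)
next
  case (coord \<xi>)
  \<comment> \<open>The inverse in \<open>h\<close> cancels the one in the coadjoint action, which
    leaves the regular function of \<open>orbit_map_derivative\<close>. The scaling direction is
    recorded separately by the polynomial \<open>p\<close>.\<close>
  have h: "h (\<lambda>\<alpha>. \<alpha> \<xi>) = (\<lambda>g. if g \<in> carrier Q then \<beta> (Ad Q g \<xi>) else 0)"
    using coord by (simp add: h_def act_apply cong: if_cong)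
  show ?case
    unfolding h using orbit_map_derivative[OF \<beta> coord] D
    by (intro conjI exI[of _ "[:0, \<beta> \<xi>:]"]) (simp_all add: w[OF coord] pderiv_pCons)
next
  case (add F F' G G')
  obtain p q where pq: "\<forall>s. F (\<lambda>\<xi>. s * \<beta> \<xi>) = poly p s" "\<forall>s. G (\<lambda>\<xi>. s * \<beta> \<xi>) = poly q s"
    "F' \<beta> = D (h F) \<one> + c * poly (pderiv p) 1" "G' \<beta> = D (h G) \<one> + c * poly (pderiv q) 1"
    using add.IH by blast
  have hA: "h F \<in> A" "h G \<in> A" using add.IH by auto
  have h: "h (\<lambda>\<alpha>. F \<alpha> + G \<alpha>) = h F + h G" by (auto simp: h_def fun_eq_iff)
  have Dh: "D (h F + h G) \<one> = D (h F) \<one> + D (h G) \<one>"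
    unfolding lie_add[OF D hA] by simp
  show ?case
    unfolding h Dh
    by (intro conjI exI[of _ "p + q"] coordinate_ring_add hA)
      (simp_all add: pq pderiv_add algebra_simps)
next
  case (mult F F' G G')
  obtain p q where pq: "\<forall>s. F (\<lambda>\<xi>. s * \<beta> \<xi>) = poly p s" "\<forall>s. G (\<lambda>\<xi>. s * \<beta> \<xi>) = poly q s"
    "F' \<beta> = D (h F) \<one> + c * poly (pderiv p) 1" "G' \<beta> = D (h G) \<one> + c * poly (pderiv q) 1"
    using mult.IH by blast
  have hA: "h F \<in> A" "h G \<in> A" using mult.IH by auto
  have h: "h (\<lambda>\<alpha>. F \<alpha> * G \<alpha>) = h F * h G" by (auto simp: h_def fun_eq_iff)
  have h1: "h F \<one> = F \<beta>" "h G \<one> = G \<beta>" using act_one[OF \<beta>] by (simp_all add: h_def)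
  \<comment> \<open>The two product rules combine because the pullback at \<open>\<one>\<close> and
    the scaling polynomial at 1 take the same value.\<close>
  have p1: "poly p 1 = F \<beta>" "poly q 1 = G \<beta>"
    using spec[OF pq(1), of 1] spec[OF pq(2), of 1] by simp_all
  have Dh: "D (h F * h G) \<one> = D (h F) \<one> * G \<beta> + F \<beta> * D (h G) \<one>"
    unfolding lie_mult[OF D hA] by (simp add: h1)
  show ?case
    unfolding h Dh
    by (intro conjI exI[of _ "p * q"] coordinate_ring_mult hA)
      (simp_all add: pq pderiv_mult p1 algebra_simps)
qed

text \<open>Nondegeneracy holds at every point of the orbit, so every direction \<open>w\<close> is
  tangent there. If \<open>F\<close> vanishes on the orbit, both parts of its derivative vanish: its
  pullback to \<open>Q\<close> is zero and so is its scaling polynomial.\<close>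

lemma orbit_dense:
  assumes \<alpha>: "nondegenerate \<alpha>" and F: "F \<in> polys" "\<forall>\<beta>\<in>orb \<alpha>. F \<beta> = 0" and \<gamma>: "\<gamma> \<in> V"
  shows "F \<gamma> = 0"
proof (rule vanishing_of_derivatives[OF _ F orb_self _ \<gamma>])
  show \<alpha>V: "\<alpha> \<in> V" "\<alpha> \<in> V" using \<alpha> by (auto simp: nondegenerate_def)
  fix F F' w
  assume w: "w \<in> V" and F': "directional_derivative L w F F'" and F: "\<forall>\<beta>\<in>orb \<alpha>. F \<beta> = 0"
  show "\<forall>\<beta>\<in>orb \<alpha>. F' \<beta> = 0"
  proof
    fix \<beta> assume \<beta>: "\<beta> \<in> orb \<alpha>"
    then have "nondegenerate \<beta>" using nondegenerate_act[OF \<alpha>] by (auto simp: mem_orb_iff)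
    then obtain D c where D: "D \<in> L" "\<And>\<xi>. \<xi> \<in> L \<Longrightarrow> w \<xi> = \<beta> (lie_bracket D \<xi>) + c * \<beta> \<xi>"
      using tangent_space_full w by blast
    have \<beta>V: "\<beta> \<in> V" using \<beta> orb_subset[OF \<alpha>V(1)] by blast
    obtain p where p: "\<forall>s. F (\<lambda>\<xi>. s * \<beta> \<xi>) = poly p s"
      "F' \<beta> = D (\<lambda>g. if g \<in> carrier Q then F (act (inv g) 1 \<beta>) else 0) \<one> + c * poly (pderiv p) 1"
      using derivative_along_orbit[OF \<beta>V D F'] by blast
    have "(\<lambda>g. if g \<in> carrier Q then F (act (inv g) 1 \<beta>) else 0) = 0"
      using F orb_act[OF \<beta>] by (auto simp: fun_eq_iff)
    \<comment> \<open>The action reaches only nonzero \<open>s\<close>, which still gives infinitely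
      many roots.\<close>
    moreover have "p = 0"
    proof (rule ccontr)
      assume "p \<noteq> 0"
      have "poly p s = 0" if "s \<noteq> 0" for s
      proof -
        have "act \<one> s \<beta> = (\<lambda>\<xi>. s * \<beta> \<xi>)"
          using \<beta>V by (auto simp: fun_eq_iff act_apply Ad_one dual_space_def)
        then show ?thesis using orb_act[OF \<beta> one_closed that] F p(1) by metis
      qed
      then have "- {0} \<subseteq> {s. poly p s = 0}" by auto
      then have "finite (- {0 :: 'k})"
        using poly_roots_finite[OF \<open>p \<noteq> 0\<close>] finite_subset by blast
      then show False using infinite_UNIV_char_0[where 'a = 'k] by (simp add: finite_compl)
    qed
    ultimately show "F' \<beta> = 0" using p(2) lie_zero[OF D(1)] by simp
  qed
qed

section \<open>A basic open set inside the orbit\<close>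

text \<open>A point over \<open>\<beta>\<close> is found as a homomorphism to K: one that kills
  \<open>I\<close> is evaluation at some \<open>(x, t)\<close> with \<open>x\<close> in
  \<open>Q\<close>, agreement with evaluation at \<open>\<beta>\<close> on the pulled-back functions
  says that the orbit map sends this point to \<open>\<beta>\<close>, and a nonzero value on
  \<open>snd\<close> makes \<open>t\<close> invertible.\<close>

lemma orbit_contains_basic_open:
  assumes \<alpha>: "nondegenerate \<alpha>"
  shows "\<exists>G\<in>polys. (\<exists>\<beta>\<in>V. G \<beta> \<noteq> 0) \<and> (\<forall>\<beta>\<in>V. G \<beta> \<noteq> 0 \<longrightarrow> \<beta> \<in> orb \<alpha>)"
proof -
  have \<alpha>V: "\<alpha> \<in> V" using \<alpha> by (simp add: nondegenerate_def)
  have "\<exists>p\<in>poly_functions coords. \<forall>g\<in>carrier Q. \<alpha> (Ad Q g \<xi>) = p g" if "\<xi> \<in> L" for \<xi>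
    using orbit_map_derivative(1)[OF \<alpha>V that] by (auto simp: coordinate_ring_iff)
  then obtain m where m: "\<And>\<xi>. \<xi> \<in> L \<Longrightarrow> m \<xi> \<in> poly_functions coords"
    "\<And>\<xi> g. \<xi> \<in> L \<Longrightarrow> g \<in> carrier Q \<Longrightarrow> \<alpha> (Ad Q g \<xi>) = m \<xi> g" by metis
  define C :: "(('k ^ 'n) \<times> 'k \<Rightarrow> 'k) set" where "C = insert snd (range (\<lambda>i z. fst z $ i))"
  define B where "B = poly_functions C"
  \<comment> \<open>Extends the orbit map polynomially to all of K^n x K. Since each
    \<open>m \<xi>\<close> is chosen on its own, \<open>\<psi> z\<close> may fail to be linear when
    \<open>fst z\<close> is off the group.\<close>
  define \<psi> :: "('k ^ 'n) \<times> 'k \<Rightarrow> ('k, 'n) operator \<Rightarrow> 'k" where "\<psi> z = (\<lambda>\<xi>. snd z * m \<xi> (fst z))" for z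
  define R where "R = {\<lambda>z. F (\<psi> z) |F. F \<in> polys}"
  define J where "J = {f \<in> B. \<forall>z\<in>carrier Q \<times> (- {0}). f z = 0}"
  \<comment> \<open>Avoiding \<open>S\<close> keeps both t and every polynomial function that is not
    identically zero on \<open>V\<close> outside the prime ideal; t itself is not inverted in
    \<open>B\<close>.\<close>
  define S where "S = {\<lambda>z. snd z ^ k * F (\<psi> z) |k F. F \<in> polys \<and> (\<exists>\<beta>\<in>V. F \<beta> \<noteq> 0)}"

  have B: "subring_on B" unfolding B_def by (rule subring_on_poly_functions)
  have snd_B: "snd \<in> B" unfolding B_def C_def by (intro poly_functions.coord) simp
  have fst_B: "(\<lambda>z. f (fst z)) \<in> B" if "f \<in> poly_functions coords" for f
  proof -
    have "\<exists>q\<in>B. \<forall>z\<in>UNIV. h (fst z) = q z" if "h \<in> coords" for h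
    proof -
      from that obtain i where i: "h = (\<lambda>x. x $ i)" by blast
      have "(\<lambda>z. fst z $ i) \<in> B" unfolding B_def C_def by (intro poly_functions.coord) blast
      then show ?thesis unfolding i by (intro bexI[of _ "\<lambda>z. fst z $ i"]) simp_all
    qed
    from poly_functions_compose_on[where \<phi> = fst and Y = UNIV, OF \<open>f \<in> poly_functions coords\<close>
        this[unfolded B_def]]
    obtain q where "q \<in> B" "\<forall>z :: ('k ^ 'n) \<times> 'k. f (fst z) = q z" unfolding B_def by blast
    then show ?thesis by (metis (no_types, lifting) ext)
  qed
  have \<psi>_B: "(\<lambda>z. F (\<psi> z)) \<in> B" if "F \<in> polys" for F
  proof -
    have "\<exists>q\<in>B. \<forall>z\<in>UNIV. f (\<psi> z) = q z" if f: "f \<in> evaluations L" for f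
    proof -
      from f obtain \<xi> where \<xi>: "\<xi> \<in> L" "f = (\<lambda>\<alpha>. \<alpha> \<xi>)" by blast
      have "(\<lambda>z. snd z * m \<xi> (fst z)) \<in> B"
        using snd_B fst_B[OF m(1)[OF \<xi>(1)]] unfolding B_def by (rule poly_functions.mult)
      then show ?thesis using \<xi>(2) by (intro bexI) (auto simp: \<psi>_def)
    qed
    from poly_functions_compose_on[where \<phi> = \<psi> and Y = UNIV, OF that this[unfolded B_def]]
    obtain q where "q \<in> B" "\<forall>z. F (\<psi> z) = q z" unfolding B_def by blast
    then show ?thesis by (metis (no_types, lifting) ext)
  qed
  have RI: "(\<lambda>z. F (\<psi> z)) \<in> R" if "F \<in> polys" for F using that unfolding R_def by blast
  have R: "subring_on R"
    unfolding subring_on_def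
  proof (intro conjI ballI)
    show "1 \<in> R"
      unfolding R_def one_fun_def using poly_functions.const[of 1 "evaluations L"] by fastforce
    fix f g assume "f \<in> R" "g \<in> R"
    then obtain F G where FG: "F \<in> polys" "G \<in> polys" "f = (\<lambda>z. F (\<psi> z))" "g = (\<lambda>z. G (\<psi> z))"
      unfolding R_def by blast
    have "f - g = (\<lambda>z. F (\<psi> z) - G (\<psi> z))" "f * g = (\<lambda>z. F (\<psi> z) * G (\<psi> z))"
      using FG by (auto simp: fun_eq_iff)
    then show "f - g \<in> R" "f * g \<in> R"
      using RI[OF poly_functions_diff[OF FG(1,2)]] RI[OF poly_functions.mult[OF FG(1,2)]] by simp_all
  qed
  have RB: "R \<subseteq> B" using \<psi>_B by (auto simp: R_def)

  have \<psi>_orbit: "F (\<psi> (g, t)) = F (act (inv g) t \<alpha>)" if "F \<in> polys" "g \<in> carrier Q" for F g t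
    using that m(2) by (intro poly_functions_evaluations_cong[OF that(1)]) (simp add: \<psi>_def act_apply)
  \<comment> \<open>On Q x K^* the factor t^k is invertible, so \<open>F\<close> would vanish on the
    orbit and by density on all of \<open>V\<close>.\<close>
  have nonvanishing: "(\<lambda>z. snd z ^ k * F (\<psi> z)) \<notin> J"
    if F: "F \<in> polys" "\<exists>\<beta>\<in>V. F \<beta> \<noteq> 0" for k F
  proof
    assume J: "(\<lambda>z. snd z ^ k * F (\<psi> z)) \<in> J"
    have "F \<beta> = 0" if "\<beta> \<in> orb \<alpha>" for \<beta>
    proof -
      from that obtain g t where gt: "g \<in> carrier Q" "t \<noteq> 0" "\<beta> = act g t \<alpha>"
        by (auto simp: mem_orb_iff)
      have "snd (inv g, t) ^ k * F (\<psi> (inv g, t)) = 0"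
        using J gt(1,2) unfolding J_def by blast
      then show ?thesis using gt \<psi>_orbit[OF F(1), of "inv g" t] by simp
    qed
    then show False using orbit_dense[OF \<alpha> F(1)] F(2) by blast
  qed
  have SI: "(\<lambda>z. snd z ^ k * F (\<psi> z)) \<in> S" if "F \<in> polys" "\<exists>\<beta>\<in>V. F \<beta> \<noteq> 0" for F k
    using that unfolding S_def by blast
  obtain I where I: "prime_ideal_on B I" "J \<subseteq> I" "I \<inter> S = {}"
  proof -
    have "\<exists>I. prime_ideal_on B I \<and> J \<subseteq> I \<and> I \<inter> S = {}"
    proof (rule exists_prime_ideal_disjoint[OF B])
      show "J \<subseteq> B" by (auto simp: J_def)
      show "0 \<in> J" using subring_on_closed(2)[OF B] by (simp add: J_def)
      show "x + y \<in> J" if "x \<in> J" "y \<in> J" for x y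
        using that subring_on_closed(4)[OF B] by (simp add: J_def)
      show "b * x \<in> J" if "b \<in> B" "x \<in> J" for b x
        using that subring_on_closed(6)[OF B] by (simp add: J_def)
      show "S \<subseteq> B"
      proof
        fix f assume "f \<in> S"
        then obtain k F where "F \<in> polys" "f = (\<lambda>z. snd z ^ k * F (\<psi> z))"
          unfolding S_def by blast
        then show "f \<in> B"
          using poly_functions.mult[OF poly_functions_power[OF snd_B[unfolded B_def]]
              \<psi>_B[unfolded B_def]] by (simp add: B_def)
      qed
      show "1 \<in> S" using SI[of "\<lambda>_. 1" 0] \<alpha>V by (auto simp: one_fun_def intro: poly_functions.const)
      show "J \<inter> S = {}" using nonvanishing unfolding S_def by blast
      show "f * g \<in> S" if fg: "f \<in> S" "g \<in> S" for f g
      proof -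
        obtain k F j G where *: "F \<in> polys" "\<exists>\<beta>\<in>V. F \<beta> \<noteq> 0" "f = (\<lambda>z. snd z ^ k * F (\<psi> z))"
          "G \<in> polys" "\<exists>\<beta>\<in>V. G \<beta> \<noteq> 0" "g = (\<lambda>z. snd z ^ j * G (\<psi> z))"
          using fg unfolding S_def by blast
        have "\<exists>\<gamma>\<in>V. F \<gamma> \<noteq> 0 \<and> G \<gamma> \<noteq> 0"
          using polys_common_nonzero *(1,2,4,5) by blast
        then have "\<exists>\<gamma>\<in>V. F \<gamma> * G \<gamma> \<noteq> 0" by auto
        moreover have "f * g = (\<lambda>z. snd z ^ (k + j) * (F (\<psi> z) * G (\<psi> z)))"
          unfolding *(3,6) by (simp add: fun_eq_iff power_add)
        ultimately show ?thesis
          using SI[OF poly_functions.mult[OF *(1,4)], of "k + j"] by simp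
      qed
    qed
    then show thesis using that by blast
  qed
  interpret prime_ideal_on B I by (rule I(1))
  \<comment> \<open>Thus \<open>R\<close> modulo \<open>I\<close> maps onto the polynomial functions
    on \<open>V\<close>, which makes evaluation at a point of \<open>V\<close> meaningful on
    \<open>R\<close>.\<close>
  have zero_on_V: "F \<beta> = 0" if F: "F \<in> polys" "(\<lambda>z. F (\<psi> z)) \<in> I" and \<beta>: "\<beta> \<in> V" for F \<beta>
  proof (rule ccontr)
    assume "F \<beta> \<noteq> 0"
    then have "(\<lambda>z. snd z ^ 0 * F (\<psi> z)) \<in> S" using SI[OF F(1)] \<beta> by blast
    then show False using F(2) I(3) by auto
  qed

  obtain js :: "'n list" where js: "set js = UNIV" using finite_list[OF finite[of UNIV]] by blast
  define Xs :: "(('k ^ 'n) \<times> 'k \<Rightarrow> 'k) list" where "Xs = snd # map (\<lambda>i z. fst z $ i) js"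
  have Xs: "set Xs = C" using js by (simp add: Xs_def C_def)
  note adj = adjoin_list_properties[OF R, of Xs]
  have constR: "(\<lambda>_. c) \<in> R" for c
    unfolding R_def using poly_functions.const[of c "evaluations L"] by fastforce
  have B_adj: "f \<in> adjoin_list R Xs" if "f \<in> B" for f
    using that unfolding B_def
  proof induction
    case (const c)
    show ?case using constR adj(2) by blast
  next
    case (coord f)
    then show ?case using adj(3) Xs by blast
  next
    case (add f g)
    then show ?case using subring_on_closed(4)[OF adj(1), of f g] by (simp add: plus_fun_def)
  next
    case (mult f g)
    then show ?case using subring_on_closed(6)[OF adj(1), of f g] by (simp add: times_fun_def)
  qed
  have "snd \<in> S" using SI[of "\<lambda>_. 1" 1] \<alpha>V by (auto intro: poly_functions.const)
  then have snd_I: "snd \<notin> I" using I(3) by auto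
  have "set Xs \<subseteq> B" unfolding Xs B_def by (auto intro: poly_functions.coord)
  \<comment> \<open>The element to be kept nonzero is \<open>snd\<close>, so that the point obtained
    has an invertible scalar coordinate.\<close>
  from extend_hom_adjoin_list[OF R RB this B_adj[OF snd_B] snd_I] obtain g' where g': "g' \<in> R - I"
    and ext: "\<And>\<phi> :: _ \<Rightarrow> 'k. hom_on R \<phi> \<Longrightarrow> \<forall>x\<in>I \<inter> R. \<phi> x = 0 \<Longrightarrow> \<phi> g' \<noteq> 0 \<Longrightarrow>
    \<exists>\<kappa>. hom_on (adjoin_list R Xs) \<kappa> \<and> (\<forall>x\<in>R. \<kappa> x = \<phi> x) \<and>
      (\<forall>x\<in>I \<inter> adjoin_list R Xs. \<kappa> x = 0) \<and> \<kappa> snd \<noteq> 0"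
    by blast
  then obtain G where G: "G \<in> polys" "g' = (\<lambda>z. G (\<psi> z))" unfolding R_def by blast
  \<comment> \<open>If \<open>G\<close> were zero on \<open>V\<close>, then \<open>g'\<close> would
    vanish on Q x K^* and hence lie in \<open>J\<close>, which is contained in
    \<open>I\<close>.\<close>
  have G_nonzero: "\<exists>\<beta>\<in>V. G \<beta> \<noteq> 0"
  proof (rule ccontr)
    assume "\<not> ?thesis"
    then have "G (\<psi> (g, t)) = 0" if "g \<in> carrier Q" for g t
      using \<psi>_orbit[OF G(1) that] act_closed[OF inv_closed[OF that] \<alpha>V] by simp
    then have "g' \<in> J" using \<psi>_B[OF G(1)] by (auto simp: J_def G(2))
    then show False using g' I(2) by blast
  qed
  have "\<beta> \<in> orb \<alpha>" if \<beta>: "\<beta> \<in> V" "G \<beta> \<noteq> 0" for \<beta>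
  proof -
    \<comment> \<open>Evaluation at \<open>\<beta>\<close>. Two choices of \<open>F\<close> with the
      same pullback agree on \<open>V\<close> by \<open>zero_on_V\<close>.\<close>
    define \<phi> where "\<phi> f = (SOME F. F \<in> polys \<and> f = (\<lambda>z. F (\<psi> z))) \<beta>" for f
    have \<phi>: "\<phi> (\<lambda>z. F (\<psi> z)) = F \<beta>" if F: "F \<in> polys" for F
    proof -
      define F' where "F' = (SOME F'. F' \<in> polys \<and> (\<lambda>z. F (\<psi> z)) = (\<lambda>z. F' (\<psi> z)))"
      have F': "F' \<in> polys \<and> (\<lambda>z. F (\<psi> z)) = (\<lambda>z. F' (\<psi> z))"
        unfolding F'_def by (rule someI[of _ F]) (use F in simp)
      then have "(\<lambda>z. F' (\<psi> z) - F (\<psi> z)) = 0" by (auto simp: fun_eq_iff)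
      then have "(\<lambda>z. F' (\<psi> z) - F (\<psi> z)) \<in> I" using ideal_zero by simp
      then have "F' \<beta> - F \<beta> = 0"
        using zero_on_V[OF poly_functions_diff, of F' F \<beta>] F F' \<beta>(1) by blast
      then show ?thesis by (simp add: \<phi>_def F'_def)
    qed
    have "hom_on R \<phi>"
      unfolding hom_on_def
    proof (intro conjI ballI)
      show "\<phi> 1 = 1" using \<phi>[OF poly_functions.const[of 1]] by (simp add: one_fun_def)
      fix f g assume "f \<in> R" "g \<in> R"
      then obtain F H where FH: "F \<in> polys" "H \<in> polys" "f = (\<lambda>z. F (\<psi> z))" "g = (\<lambda>z. H (\<psi> z))"
        unfolding R_def by blast
      show "\<phi> (f + g) = \<phi> f + \<phi> g"
        using \<phi>[OF poly_functions.add[OF FH(1,2)]] FH by (simp add: \<phi> plus_fun_def)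
      show "\<phi> (f * g) = \<phi> f * \<phi> g"
        using \<phi>[OF poly_functions.mult[OF FH(1,2)]] FH by (simp add: \<phi> times_fun_def)
    qed
    moreover have "\<forall>f\<in>I \<inter> R. \<phi> f = 0"
      using \<phi> zero_on_V[OF _ _ \<beta>(1)] by (auto simp: R_def)
    moreover have "\<phi> g' \<noteq> 0" using \<phi>[OF G(1)] \<beta>(2) by (simp add: G(2))
    ultimately obtain \<kappa> where \<kappa>: "hom_on (adjoin_list R Xs) \<kappa>" "\<forall>x\<in>R. \<kappa> x = \<phi> x"
      "\<forall>x\<in>I \<inter> adjoin_list R Xs. \<kappa> x = 0" "\<kappa> snd \<noteq> 0"
      using ext by blast
    define x where "x = (\<chi> i. \<kappa> (\<lambda>z. fst z $ i))"
    define t where "t = \<kappa> snd"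
    \<comment> \<open>\<open>\<kappa>\<close> fixes constants because they belong to
      \<open>R\<close>, and the generators take the coordinates of \<open>(x, t)\<close> by
      definition.\<close>
    have eval: "\<kappa> f = f (x, t)" if "f \<in> B" for f
      using that[unfolded B_def]
    proof induction
      case (const c)
      show ?case using \<kappa>(2) constR \<phi>[OF poly_functions.const] by simp
    next
      case (coord f)
      then show ?case by (auto simp: C_def x_def t_def)
    next
      case (add f g)
      then show ?case
        using B_adj hom_on_simps(3)[OF \<kappa>(1) adj(1), of f g] by (simp add: plus_fun_def B_def)
    next
      case (mult f g)
      then show ?case
        using B_adj hom_on_simps(4)[OF \<kappa>(1) adj(1), of f g] by (simp add: times_fun_def B_def)
    qed
    have J0: "f (x, t) = 0" if "f \<in> J" for f
      using eval that I(2) \<kappa>(3) B_adj by (force simp: J_def)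
    \<comment> \<open>The equations of \<open>Q\<close>, read as functions of the first component,
      lie in \<open>J\<close>.\<close>
    have xQ: "x \<in> carrier Q"
    proof -
      have "openin affine_space (UNIV - carrier Q)"
        using affine by (simp add: affine_algebraic_group_def closedin_def)
      then obtain T where T: "T \<subseteq> poly_functions coords" "UNIV - carrier Q = UNIV - {x. \<forall>f\<in>T. f x = 0}"
        unfolding openin_zariski_topology by auto
      then have Q: "carrier Q = {x. \<forall>f\<in>T. f x = 0}" by blast
      have "f x = 0" if "f \<in> T" for f
        using J0[of "\<lambda>z. f (fst z)"] fst_B that T(1) Q by (auto simp: J_def)
      then show ?thesis using Q by blast
    qed
    have "\<beta> \<xi> = act (inv x) t \<alpha> \<xi>" for \<xi>
    proof (cases "\<xi> \<in> L")
      case True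
      have ev: "(\<lambda>\<alpha>. \<alpha> \<xi>) \<in> polys" using True by (intro poly_functions.coord) blast
      have "\<beta> \<xi> = \<phi> (\<lambda>z. \<psi> z \<xi>)" using \<phi>[OF ev] by simp
      also have "\<dots> = \<kappa> (\<lambda>z. \<psi> z \<xi>)" using \<kappa>(2) ev unfolding R_def by force
      also have "\<dots> = \<psi> (x, t) \<xi>" using eval[OF \<psi>_B[OF ev]] by simp
      also have "\<dots> = act (inv x) t \<alpha> \<xi>" using \<psi>_orbit[OF ev xQ] by simp
      finally show ?thesis .
    next
      case False
      then show ?thesis using \<beta>(1) by (simp add: dual_space_def act_apply)
    qed
    then have "\<beta> = act (inv x) t \<alpha>" by blast
    then show ?thesis
      unfolding mem_orb_iff using xQ \<kappa>(4) by (intro bexI[of _ "inv x"] exI[of _ t]) (auto simp: t_def)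
  qed
  then show ?thesis by (intro bexI[of _ G] conjI ballI impI G_nonzero G(1))
qed

section \<open>Openness, closure and uniqueness of the orbit\<close>

text \<open>The orbit is the union of the translates of the basic open set where \<open>G\<close> is
  nonzero: any of its points can be moved to \<open>\<beta>\<close>, and moving back stays in the
  orbit.\<close>

lemma orbit_open:
  assumes \<alpha>: "nondegenerate \<alpha>"
  shows "openin (lie_dual_topology Q) (orb \<alpha>)"
proof -
  have \<alpha>V: "\<alpha> \<in> V" using \<alpha> by (simp add: nondegenerate_def)
  obtain G \<beta> where G: "G \<in> polys" "\<beta> \<in> V" "G \<beta> \<noteq> 0" "\<forall>\<beta>\<in>V. G \<beta> \<noteq> 0 \<longrightarrow> \<beta> \<in> orb \<alpha>"
    using orbit_contains_basic_open[OF \<alpha>] by blast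
  define S where "S = {\<lambda>\<gamma>. G (act g t \<gamma>) |g t. g \<in> carrier Q \<and> t \<noteq> 0}"
  have "S \<subseteq> polys" unfolding S_def using polys_act[OF G(1)] by blast
  moreover have "orb \<alpha> = V - {\<gamma> \<in> V. \<forall>f\<in>S. f \<gamma> = 0}"
  proof (intro equalityI subsetI)
    fix \<gamma> assume \<gamma>: "\<gamma> \<in> orb \<alpha>"
    have \<gamma>V: "\<gamma> \<in> V" using \<gamma> orb_subset[OF \<alpha>V] by blast
    have "\<beta> \<in> orb \<gamma>" using G(2-4) orb_trans orb_sym[OF \<alpha>V \<gamma>] by blast
    then obtain g t where gt: "g \<in> carrier Q" "t \<noteq> 0" "\<beta> = act g t \<gamma>" by (auto simp: mem_orb_iff)
    then have "G (act g t \<gamma>) \<noteq> 0" using G(3) by simp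
    then show "\<gamma> \<in> V - {\<gamma> \<in> V. \<forall>f\<in>S. f \<gamma> = 0}"
      using \<gamma>V gt(1,2) unfolding S_def by (intro DiffI) auto
  next
    fix \<gamma> assume "\<gamma> \<in> V - {\<gamma> \<in> V. \<forall>f\<in>S. f \<gamma> = 0}"
    then obtain g t where gt: "\<gamma> \<in> V" "g \<in> carrier Q" "t \<noteq> 0" "G (act g t \<gamma>) \<noteq> 0"
      unfolding S_def by blast
    then have "act g t \<gamma> \<in> orb \<alpha>" using G(4) act_closed by blast
    then have "act (inv g) (1 / t) (act g t \<gamma>) \<in> orb \<alpha>"
      by (rule orb_act) (use gt(2,3) in auto)
    then show "\<gamma> \<in> orb \<alpha>" using act_inverse(1)[OF gt(2,3,1)] by simp
  qed
  ultimately show ?thesis unfolding openin_zariski_topology by blast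
qed

text \<open>A nonempty open set contains a point where some polynomial function is nonzero;
  irreducibility of \<open>V\<close> makes this function and \<open>G\<close> nonzero at a common
  point, which lies in the orbit.\<close>

lemma orbit_closure:
  assumes \<alpha>: "nondegenerate \<alpha>"
  shows "lie_dual_topology Q closure_of orb \<alpha> = V"
proof -
  obtain G \<beta> where G: "G \<in> polys" "\<beta> \<in> V" "G \<beta> \<noteq> 0" "\<forall>\<beta>\<in>V. G \<beta> \<noteq> 0 \<longrightarrow> \<beta> \<in> orb \<alpha>"
    using orbit_contains_basic_open[OF \<alpha>] by blast
  have "\<exists>\<delta>\<in>orb \<alpha>. \<delta> \<in> T" if \<gamma>: "\<gamma> \<in> V" "\<gamma> \<in> T" and T: "openin (lie_dual_topology Q) T" for \<gamma> T
  proof -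
    obtain S where S: "S \<subseteq> polys" "T = V - {x \<in> V. \<forall>f\<in>S. f x = 0}"
      using T unfolding openin_zariski_topology by blast
    then obtain f where f: "f \<in> S" "f \<gamma> \<noteq> 0" using \<gamma> by blast
    then have "f \<in> polys" using S(1) by blast
    then obtain \<delta> where "\<delta> \<in> V" "f \<delta> \<noteq> 0" "G \<delta> \<noteq> 0"
      using polys_common_nonzero[of f G] G(1-3) \<gamma>(1) f(2) by blast
    then show ?thesis using G(4) S(2) f(1) by blast
  qed
  then show ?thesis by (auto simp: closure_of_def)
qed

lemma orbits_equal:
  assumes \<alpha>: "nondegenerate \<alpha>" and \<beta>: "nondegenerate \<beta>"
  shows "\<beta> \<in> orb \<alpha>"
proof -
  have V: "\<alpha> \<in> V" "\<beta> \<in> V" using \<alpha> \<beta> by (auto simp: nondegenerate_def)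
  obtain G \<gamma> where G: "G \<in> polys" "\<gamma> \<in> V" "G \<gamma> \<noteq> 0" "\<forall>\<gamma>\<in>V. G \<gamma> \<noteq> 0 \<longrightarrow> \<gamma> \<in> orb \<alpha>"
    using orbit_contains_basic_open[OF \<alpha>] by blast
  obtain H \<delta> where H: "H \<in> polys" "\<delta> \<in> V" "H \<delta> \<noteq> 0" "\<forall>\<delta>\<in>V. H \<delta> \<noteq> 0 \<longrightarrow> \<delta> \<in> orb \<beta>"
    using orbit_contains_basic_open[OF \<beta>] by blast
  obtain \<epsilon> where "\<epsilon> \<in> V" "G \<epsilon> \<noteq> 0" "H \<epsilon> \<noteq> 0"
    using polys_common_nonzero[of G H] G(1-3) H(1-3) by blast
  then have "\<epsilon> \<in> orb \<alpha>" "\<epsilon> \<in> orb \<beta>" using G(4) H(4) by auto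
  then show ?thesis using orb_sym[OF V(2)] orb_trans by blast
qed

end

theorem mainTheorem11:
  fixes Q :: "('k::{alg_closed_field, field_char_0} ^ 'n) monoid" and n :: nat
  assumes "connected_algebraic_group Q"
    and "vector_space.dim op_scale (lie_algebra Q) = 2 * n + 1"
  shows "(\<forall>\<alpha>. contact_linear_form Q n \<alpha> \<longrightarrow>
            openin (lie_dual_topology Q) (orbit (extended_group Q) (extended_action Q) \<alpha>) \<and>
            lie_dual_topology Q closure_of (orbit (extended_group Q) (extended_action Q) \<alpha>)
              = lie_dual Q) \<and>
         (\<forall>\<alpha> \<beta>. contact_linear_form Q n \<alpha> \<longrightarrow> contact_linear_form Q n \<beta> \<longrightarrow>
            \<beta> \<in> orbit (extended_group Q) (extended_action Q) \<alpha>)"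
proof -
  interpret contact_group Q n
    using assms by unfold_locales (simp_all add: connected_algebraic_group_def)
  show ?thesis
    using contact_nondegenerate orbit_open orbit_closure orbits_equal unfolding orb_def by blast
qed

end
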